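(* Let $P$ be a logic program over a first-order signature $\Sigma$ with coinductive model $\mathcal{M}$, and let $H$ be an H-formula such that the sequent $\Sigma;P\looparrowright H$ has a proof in co-hohh in which every atom occurring is a guarded atom. Let $H_1,\dots,H_n$ be distinct term-form ground instances of $H$ involving only guarded atoms, such that for each $k$ ($1\le k\le n$) and each atom $A\in\mathit{body}\,H_k$ we have $A^T\in\mathcal{M}$. Let $\mathcal{M}'$ be the coinductive model of $P\cup\{H_1,\dots,H_n\}$. Then $\mathcal{M}=\mathcal{M}'$.
   Context: Terms. Simple types are built from type variables (including $\iota$ and $o$) by $\to$. Terms are $x\mid c\mid (M\,N)\mid \lambda x.M\mid \mathit{fix}\,\lambda x.M$, simply typed with respect to a signature $\Sigma$ and a context, where $\mathit{fix}\,\lambda x.M:\tau$ if $M:\tau$ under $x:\tau$. Logical constants: $\land,\lor,\supset:o\to o\to o$, $\top:o$, $\forall_\tau,\exists_\tau:(\tau\to o)\to o$. Terms are kept in $\beta$-normal form ($\mathit{fix}$ treated as a constant). One-step $\mathit{fix}\beta$-reduction is $\mathit{fix}\,\lambda x.M\to_{\mathit{fix}\beta} M[x:=\mathit{fix}\,\lambda x.M]$, closed under all term constructors; $=_{\mathit{fix}\beta}$ is the equivalence generated by $=_\beta$ and $\to_{\mathit{fix}\beta}$. Order: $\mathit{Ord}(\sigma)=0$ for non-functional $\sigma$, $\mathit{Ord}(\tau_1\to\tau_2)=\max(\mathit{Ord}(\tau_1)+1,\mathit{Ord}(\tau_2))$. A term is first order if its type has order 0, its constant subterms have types of order $\le1$,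 its variable subterms have types of order 0, no subterm has type $o$, and it has no fixed-point subterm. A predicate is a variable or non-logical constant whose type is $o$ or has target $o$; it is first order if it is a non-logical constant of type order $\le1$ not having $o$ as an argument type. A signature is first-order if every non-logical constant has type order $\le 1$ and involves $o$ only if it is a first-order predicate. $\mathcal{U}_1^\Sigma$ (resp. $\mathcal{U}_2^\Sigma$) is the set of terms over $\Sigma$ not containing $\forall$ and $\supset$ (resp. not containing $\supset$). Guardedness. A guarded fixed point term is $\mathit{fix}\,\lambda x.\lambda y_1\ldots y_m.\ f\,L_1\ldots L_k\,(x\,N_1\ldots N_m)\,L_{k+1}\ldots L_r$ where $x:\iota\to\cdots\to\iota$ ($m\ge0$ arguments), $f$ is a constant of type $\iota\to\cdots\to\iota$ ($r+1$ arguments), the $L_i,N_j$ are first-order terms of type $\iota$, and $x\notin\{y_1,\dots,y_m\}=\bigcup FV(L_i)\cup\bigcup FV(N_j)$. A guarded full term is either a first-order term or $F\,M_1\ldots M_n$ with $F$ a guarded fixed point term of type $\iota^n\to\iota$ and $M_i$ first-order terms of type $\iota$. An atom is a term $h\,M_1\ldots M_n$ of type $o$ with $h$ a predicate; rigid if $h$ is a non-logical constant. An atom $h\,M_1\ldots M_n$ with $h$ a first-order predicate and all $M_i$ guarded full terms is guarded, and so is every atom $=_{\mathit{fix}\beta}$ to it. Logic programs and models. A logic program is a finite set of H-formulae $\forall_\iota x_1\ldots x_m\,(B_1\land\cdots\land B_k\supset B)$ ($m,k\ge0$) over a first-order signature $\Sigma$ (for $P$ itself, with first-order atoms). Tree-terms/tree-atoms: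 maps from a finitely branching prefix-closed (and left-closed) set of finite lists of naturals into $\Sigma\cup\mathit{Var}$ respecting arities (root labelled by a predicate for tree-atoms); $\mathcal{H}^\Sigma$, $\mathcal{B}^\Sigma$ are the sets of all finite and infinite closed tree-terms and tree-atoms. Distance: $d(s,t)=0$ if $s=t$, else $2^{-n}$ with $n$ the least depth at which truncations of $s,t$ at depth $n$ differ. For a first-order atom $A$, $A^T$ is its tree-atom. For a guarded atom $A$, its snapshot $A\diamond$ replaces every non-first-order guarded full term argument by a fresh constant $\diamond:\iota$; $A^T$ is the tree-atom which is the $d$-limit of $(A_k\diamond)^T$ along a fair infinite sequence of one-step $\mathit{fix}\beta$-reductions (each followed by $\beta$-normalisation) of $A$ (it exists, lies in $\mathcal{B}^\Sigma$ for closed $A$, and is shared by $\mathit{fix}\beta$-equivalent guarded atoms). For an H-formula $K=\forall_\iota x_1\ldots x_m(A_1\land\cdots\land A_n\supset A)$: a tree-form ground instance is $(A_1^T\land\cdots\land A_n^T\supset A^T)[x_1:=N_1]\cdots[x_m:=N_m]$ with $N_i\in\mathcal{H}^\Sigma$; a term-form ground instance is $(A_1\land\cdots\land A_n\supset A)[x_1:=N'_1]\cdots[x_m:=N'_m]$ with $N'_i$ closed terms of type $\iota$ in $\mathcal{U}_1^\Sigma$. For a ground instance $A'_1\land\cdots\land A'_n\supset A'$, $\mathit{head}$ is $A'$ and $\mathit{body}$ is $\{A'_1,\dots,A'_n\}$. For a program $Q$, $\mathcal{T}_Q(I)=\{B\in\mathcal{B}^\Sigma\mid\exists F\in Q$ with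 a tree-form ground instance of head $B$ and body $\subseteq I\}$, and its coinductive model is $\mathit{gfp}(\mathcal{T}_Q)=\bigcup\{I\subseteq\mathcal{B}^\Sigma\mid I\subseteq\mathcal{T}_Q(I)\}$. The calculus co-hohh (atoms and rigid atoms taken in $\mathcal{U}_2^\Sigma$). Program clauses $D::=A_r\mid G\supset D\mid D\land D\mid\forall x\,D$; goals $G::=\top\mid A\mid G\land G\mid G\lor G\mid\exists x\,G\mid D\supset G\mid\forall x\,G$. Sequents $\Sigma;P\longrightarrow G$, $\Sigma;P\xrightarrow{D}A$, guarded goals $\langle M\rangle$, and $\Sigma;P\looparrowright M$. Rules (premises $\Rightarrow$ conclusion): $\supset R$: $\Sigma;P,D\longrightarrow G\Rightarrow\Sigma;P\longrightarrow D\supset G$; $\forall R$: $c:\tau,\Sigma;P\longrightarrow G[x:=c]\Rightarrow\Sigma;P\longrightarrow\forall_\tau x\,G$ ($c$ fresh); $\exists R$: $G[x:=N]\Rightarrow\exists_\tau x\,G$; $\lor R$: $G_i\Rightarrow G_1\lor G_2$; $\land R$: $G_1$ and $G_2\Rightarrow G_1\land G_2$; $\top R$ axiom; $\supset L$: $\Sigma;P\xrightarrow{D}A$ and $\Sigma;P\longrightarrow G\Rightarrow\Sigma;P\xrightarrow{G\supset D}A$; $\land L$: $\xrightarrow{D_i}A\Rightarrow\xrightarrow{D_1\land D_2}A$; $\forall L$: $\xrightarrow{D[x:=N]}A\Rightarrow\xrightarrow{\forall_\tau x\,D}A$; decide: $\Sigma;P\xrightarrow{D}A\Rightarrow\Sigma;P\longrightarrow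 A$ for $D\in P$; initial: $\Sigma;P\xrightarrow{A'}A$ when $A=_{\mathit{fix}\beta}A'$. In $\exists R,\forall L$, $N$ is closed of type $\tau$ in $\mathcal{U}_2^\Sigma$. co-fix: $\Sigma;P,M\longrightarrow\langle M\rangle\Rightarrow\Sigma;P\looparrowright M$. Guarded rules: $\supset R\langle\rangle$: $\Sigma;P,M_1\longrightarrow\langle M_2\rangle\Rightarrow\Sigma;P\longrightarrow\langle M_1\supset M_2\rangle$; $\forall R\langle\rangle$: $c:\tau,\Sigma;P\longrightarrow\langle M[x:=c]\rangle\Rightarrow\langle\forall_\tau x\,M\rangle$; $\land R\langle\rangle$: $\langle M_1\rangle,\langle M_2\rangle\Rightarrow\langle M_1\land M_2\rangle$; $\supset L\langle\rangle$: $\Sigma;P\xrightarrow{D}A$ (unguarded) and $\Sigma;P\longrightarrow G\Rightarrow\Sigma;P\xrightarrow{G\supset D}\langle A\rangle$; $\land L\langle\rangle,\forall L\langle\rangle$ as $\land L,\forall L$ with goal $\langle A\rangle$; decide$\langle\rangle$: $\Sigma;P\xrightarrow{D^*}\langle A\rangle\Rightarrow\Sigma;P\longrightarrow\langle A\rangle$ with $D^*$ a clause of the original program (not a coinductive hypothesis or a formula added by $\supset R\langle\rangle$); initial$\langle\rangle$: $\Sigma;P\xrightarrow{A'}\langle A\rangle$ when $A=_{\mathit{fix}\beta}A'$. A proof is a finite tree of these rules with initial sequents as leaves. *)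

theory Defs
  imports Complex_Main
begin

section \<open>Types\<close>

datatype ty = Iota | Omicron | TVar nat | Arr ty ty  (infixr \<open>\<rightarrow>\<close> 200)

primrec ord :: "ty \<Rightarrow> nat" where
  "ord Iota = 0"
| "ord Omicron = 0"
| "ord (TVar a) = 0"
| "ord (\<tau>\<^sub>1 \<rightarrow> \<tau>\<^sub>2) = max (ord \<tau>\<^sub>1 + 1) (ord \<tau>\<^sub>2)"

primrec arg_tys :: "ty \<Rightarrow> ty list" where
  "arg_tys Iota = []"
| "arg_tys Omicron = []"
| "arg_tys (TVar a) = []"
| "arg_tys (\<tau>\<^sub>1 \<rightarrow> \<tau>\<^sub>2) = \<tau>\<^sub>1 # arg_tys \<tau>\<^sub>2"

primrec target :: "ty \<Rightarrow> ty" where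
  "target Iota = Iota"
| "target Omicron = Omicron"
| "target (TVar a) = TVar a"
| "target (\<tau>\<^sub>1 \<rightarrow> \<tau>\<^sub>2) = target \<tau>\<^sub>2"

primrec involves_o :: "ty \<Rightarrow> bool" where
  "involves_o Iota = False"
| "involves_o Omicron = True"
| "involves_o (TVar a) = False"
| "involves_o (\<tau>\<^sub>1 \<rightarrow> \<tau>\<^sub>2) = (involves_o \<tau>\<^sub>1 \<or> involves_o \<tau>\<^sub>2)"

definition iotas :: "nat \<Rightarrow> ty" where
  "iotas n = (((\<rightarrow>) Iota) ^^ n) Iota"


section \<open>Terms\<close>

text \<open>Terms modulo renaming of bound variables: \<open>Var n\<close> is a de Bruijn index, both for bound
  variables and, relative to a context \<open>\<Gamma> :: ty list\<close>, for free ones. Binders carry the type of the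
  variable they bind. \<open>Fix \<tau> M\<close> is the term \<open>fix \<lambda>x. M\<close> with \<open>x : \<tau>\<close>.\<close>

datatype logc = And | Or | Imp | Top | Forall ty | Exists ty

datatype 'c tm =
    Var nat
  | Con 'c
  | Log logc
  | App "'c tm" "'c tm"
  | Lam ty "'c tm"
  | Fix ty "'c tm"

type_synonym 'c sig = "'c \<Rightarrow> ty option"

primrec logc_ty :: "logc \<Rightarrow> ty" where
  "logc_ty And = Omicron \<rightarrow> Omicron \<rightarrow> Omicron"
| "logc_ty Or = Omicron \<rightarrow> Omicron \<rightarrow> Omicron"
| "logc_ty Imp = Omicron \<rightarrow> Omicron \<rightarrow> Omicron"
| "logc_ty Top = Omicron"
| "logc_ty (Forall \<tau>) = (\<tau> \<rightarrow> Omicron) \<rightarrow> Omicron"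
| "logc_ty (Exists \<tau>) = (\<tau> \<rightarrow> Omicron) \<rightarrow> Omicron"

primrec typeof :: "'c sig \<Rightarrow> ty list \<Rightarrow> 'c tm \<Rightarrow> ty option" where
  "typeof \<Sigma> \<Gamma> (Var n) = (if n < length \<Gamma> then Some (\<Gamma> ! n) else None)"
| "typeof \<Sigma> \<Gamma> (Con c) = \<Sigma> c"
| "typeof \<Sigma> \<Gamma> (Log k) = Some (logc_ty k)"
| "typeof \<Sigma> \<Gamma> (App M N) =
     (case (typeof \<Sigma> \<Gamma> M, typeof \<Sigma> \<Gamma> N) of
        (Some (\<tau>\<^sub>1 \<rightarrow> \<tau>\<^sub>2), Some \<tau>) \<Rightarrow> if \<tau> = \<tau>\<^sub>1 then Some \<tau>\<^sub>2 else None
      | _ \<Rightarrow> None)"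
| "typeof \<Sigma> \<Gamma> (Lam \<tau> M) = map_option (\<lambda>\<tau>'. \<tau> \<rightarrow> \<tau>') (typeof \<Sigma> (\<tau> # \<Gamma>) M)"
| "typeof \<Sigma> \<Gamma> (Fix \<tau> M) = (if typeof \<Sigma> (\<tau> # \<Gamma>) M = Some \<tau> then Some \<tau> else None)"

primrec fv :: "'c tm \<Rightarrow> nat set" where
  "fv (Var n) = {n}"
| "fv (Con c) = {}"
| "fv (Log k) = {}"
| "fv (App M N) = fv M \<union> fv N"
| "fv (Lam \<tau> M) = {n. Suc n \<in> fv M}"
| "fv (Fix \<tau> M) = {n. Suc n \<in> fv M}"

primrec logcs :: "'c tm \<Rightarrow> logc set" where
  "logcs (Var n) = {}"
| "logcs (Con c) = {}"
| "logcs (Log k) = {k}"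
| "logcs (App M N) = logcs M \<union> logcs N"
| "logcs (Lam \<tau> M) = logcs M"
| "logcs (Fix \<tau> M) = logcs M"

text \<open>Every subterm occurrence is paired with the context in which it lives.\<close>

primrec subterms :: "ty list \<Rightarrow> 'c tm \<Rightarrow> (ty list \<times> 'c tm) set" where
  "subterms \<Gamma> (Var n) = {(\<Gamma>, Var n)}"
| "subterms \<Gamma> (Con c) = {(\<Gamma>, Con c)}"
| "subterms \<Gamma> (Log k) = {(\<Gamma>, Log k)}"
| "subterms \<Gamma> (App M N) = insert (\<Gamma>, App M N) (subterms \<Gamma> M \<union> subterms \<Gamma> N)"
| "subterms \<Gamma> (Lam \<tau> M) = insert (\<Gamma>, Lam \<tau> M) (subterms (\<tau> # \<Gamma>) M)"
| "subterms \<Gamma> (Fix \<tau> M) = insert (\<Gamma>, Fix \<tau> M) (subterms (\<tau> # \<Gamma>) M)"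

definition apps :: "'c tm \<Rightarrow> 'c tm list \<Rightarrow> 'c tm" where
  "apps h Ms = foldl App h Ms"

primrec head :: "'c tm \<Rightarrow> 'c tm" where
  "head (Var n) = Var n"
| "head (Con c) = Con c"
| "head (Log k) = Log k"
| "head (App M N) = head M"
| "head (Lam \<tau> M) = Lam \<tau> M"
| "head (Fix \<tau> M) = Fix \<tau> M"

primrec args :: "'c tm \<Rightarrow> 'c tm list" where
  "args (Var n) = []"
| "args (Con c) = []"
| "args (Log k) = []"
| "args (App M N) = args M @ [N]"
| "args (Lam \<tau> M) = []"
| "args (Fix \<tau> M) = []"


subsection \<open>Substitution, reduction, conversion\<close>

primrec ren :: "(nat \<Rightarrow> nat) \<Rightarrow> 'c tm \<Rightarrow> 'c tm" where
  "ren f (Var n) = Var (f n)"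
| "ren f (Con c) = Con c"
| "ren f (Log k) = Log k"
| "ren f (App M N) = App (ren f M) (ren f N)"
| "ren f (Lam \<tau> M) = Lam \<tau> (ren (case_nat 0 (\<lambda>n. Suc (f n))) M)"
| "ren f (Fix \<tau> M) = Fix \<tau> (ren (case_nat 0 (\<lambda>n. Suc (f n))) M)"

primrec subst :: "(nat \<Rightarrow> 'c tm) \<Rightarrow> 'c tm \<Rightarrow> 'c tm" where
  "subst \<sigma> (Var n) = \<sigma> n"
| "subst \<sigma> (Con c) = Con c"
| "subst \<sigma> (Log k) = Log k"
| "subst \<sigma> (App M N) = App (subst \<sigma> M) (subst \<sigma> N)"
| "subst \<sigma> (Lam \<tau> M) = Lam \<tau> (subst (case_nat (Var 0) (\<lambda>n. ren Suc (\<sigma> n))) M)"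
| "subst \<sigma> (Fix \<tau> M) = Fix \<tau> (subst (case_nat (Var 0) (\<lambda>n. ren Suc (\<sigma> n))) M)"

definition inst :: "'c tm \<Rightarrow> 'c tm \<Rightarrow> 'c tm" where
  "inst M N = subst (case_nat N Var) M"

inductive beta :: "'c tm \<Rightarrow> 'c tm \<Rightarrow> bool" where
  "beta (App (Lam \<tau> M) N) (inst M N)"
| "beta M M' \<Longrightarrow> beta (App M N) (App M' N)"
| "beta N N' \<Longrightarrow> beta (App M N) (App M N')"
| "beta M M' \<Longrightarrow> beta (Lam \<tau> M) (Lam \<tau> M')"
| "beta M M' \<Longrightarrow> beta (Fix \<tau> M) (Fix \<tau> M')"

definition beta_normal :: "'c tm \<Rightarrow> bool" where
  "beta_normal M \<longleftrightarrow> (\<nexists>N. beta M N)"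

definition beta_nf :: "'c tm \<Rightarrow> 'c tm \<Rightarrow> bool" where
  "beta_nf M N \<longleftrightarrow> beta\<^sup>*\<^sup>* M N \<and> beta_normal N"

text \<open>\<open>fix_at p M N\<close>: contracting the fixed-point subterm of \<open>M\<close> at position \<open>p\<close> gives \<open>N\<close>.\<close>

inductive fix_at :: "nat list \<Rightarrow> 'c tm \<Rightarrow> 'c tm \<Rightarrow> bool" where
  "fix_at [] (Fix \<tau> M) (inst M (Fix \<tau> M))"
| "fix_at p M M' \<Longrightarrow> fix_at (0 # p) (App M N) (App M' N)"
| "fix_at p N N' \<Longrightarrow> fix_at (1 # p) (App M N) (App M N')"
| "fix_at p M M' \<Longrightarrow> fix_at (0 # p) (Lam \<tau> M) (Lam \<tau> M')"
| "fix_at p M M' \<Longrightarrow> fix_at (0 # p) (Fix \<tau> M) (Fix \<tau> M')"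

definition fix_step :: "'c tm \<Rightarrow> 'c tm \<Rightarrow> bool" where
  "fix_step M N \<longleftrightarrow> (\<exists>p. fix_at p M N)"

definition redex_at :: "nat list \<Rightarrow> 'c tm \<Rightarrow> bool" where
  "redex_at p M \<longleftrightarrow> (\<exists>N. fix_at p M N)"

definition fixbeta_eq :: "'c tm \<Rightarrow> 'c tm \<Rightarrow> bool" where
  "fixbeta_eq = equivclp (\<lambda>M N. beta M N \<or> fix_step M N)"


subsection \<open>Classes of terms\<close>

definition wt :: "'c sig \<Rightarrow> ty list \<Rightarrow> 'c tm \<Rightarrow> ty \<Rightarrow> bool" where
  "wt \<Sigma> \<Gamma> M \<tau> \<longleftrightarrow> typeof \<Sigma> \<Gamma> M = Some \<tau> \<and> beta_normal M"

definition U1 :: "'c sig \<Rightarrow> 'c tm set" where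
  "U1 \<Sigma> = {M. (\<exists>\<Gamma> \<tau>. wt \<Sigma> \<Gamma> M \<tau>) \<and> (\<forall>\<tau>. Forall \<tau> \<notin> logcs M) \<and> Imp \<notin> logcs M}"

definition U2 :: "'c sig \<Rightarrow> 'c tm set" where
  "U2 \<Sigma> = {M. (\<exists>\<Gamma> \<tau>. wt \<Sigma> \<Gamma> M \<tau>) \<and> Imp \<notin> logcs M}"

definition fo_term :: "'c sig \<Rightarrow> ty list \<Rightarrow> 'c tm \<Rightarrow> bool" where
  "fo_term \<Sigma> \<Gamma> M \<longleftrightarrow>
     (\<exists>\<tau>. wt \<Sigma> \<Gamma> M \<tau> \<and> ord \<tau> = 0) \<and>
     (\<forall>(\<Delta>, N) \<in> subterms \<Gamma> M. \<forall>\<tau>. typeof \<Sigma> \<Delta> N = Some \<tau> \<longrightarrow>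
        ((\<exists>c. N = Con c) \<or> (\<exists>k. N = Log k) \<longrightarrow> ord \<tau> \<le> 1) \<and>
        ((\<exists>n. N = Var n) \<longrightarrow> ord \<tau> = 0) \<and>
        \<tau> \<noteq> Omicron \<and>
        (\<nexists>\<sigma> K. N = Fix \<sigma> K))"

definition predicate :: "'c sig \<Rightarrow> ty list \<Rightarrow> 'c tm \<Rightarrow> bool" where
  "predicate \<Sigma> \<Gamma> h \<longleftrightarrow>
     ((\<exists>n. h = Var n) \<or> (\<exists>c. h = Con c)) \<and>
     (\<exists>\<tau>. typeof \<Sigma> \<Gamma> h = Some \<tau> \<and> target \<tau> = Omicron)"

definition fo_pred :: "'c sig \<Rightarrow> 'c \<Rightarrow> bool" where
  "fo_pred \<Sigma> c \<longleftrightarrow>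
     (\<exists>\<tau>. \<Sigma> c = Some \<tau> \<and> target \<tau> = Omicron \<and> ord \<tau> \<le> 1 \<and> Omicron \<notin> set (arg_tys \<tau>))"

definition fo_signature :: "'c sig \<Rightarrow> bool" where
  "fo_signature \<Sigma> \<longleftrightarrow>
     (\<forall>c \<tau>. \<Sigma> c = Some \<tau> \<longrightarrow> ord \<tau> \<le> 1 \<and> (involves_o \<tau> \<longrightarrow> fo_pred \<Sigma> c))"

definition atom :: "'c sig \<Rightarrow> ty list \<Rightarrow> 'c tm \<Rightarrow> bool" where
  "atom \<Sigma> \<Gamma> A \<longleftrightarrow> wt \<Sigma> \<Gamma> A Omicron \<and> (\<exists>h Ms. A = apps h Ms \<and> predicate \<Sigma> \<Gamma> h)"

definition rigid_atom :: "'c sig \<Rightarrow> ty list \<Rightarrow> 'c tm \<Rightarrow> bool" where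
  "rigid_atom \<Sigma> \<Gamma> A \<longleftrightarrow>
     wt \<Sigma> \<Gamma> A Omicron \<and> (\<exists>c Ms. A = apps (Con c) Ms \<and> predicate \<Sigma> \<Gamma> (Con c))"

definition fo_atom :: "'c sig \<Rightarrow> ty list \<Rightarrow> 'c tm \<Rightarrow> bool" where
  "fo_atom \<Sigma> \<Gamma> A \<longleftrightarrow>
     atom \<Sigma> \<Gamma> A \<and>
     (\<exists>c Ms. A = apps (Con c) Ms \<and> fo_pred \<Sigma> c \<and> (\<forall>M \<in> set Ms. fo_term \<Sigma> \<Gamma> M))"


section \<open>Guardedness\<close>

text \<open>\<open>guarded_fix \<Sigma> m F\<close>: \<open>F\<close> is a guarded fixed point term with \<open>m\<close> arguments. Below the
  binders, \<open>x\<close> is index \<open>m\<close> and \<open>y\<^sub>1, \<dots>, y\<^sub>m\<close> are the indices \<open>m - 1, \<dots>, 0\<close>; the last conjunct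
  says that the latter are exactly the free variables of the \<open>L\<^sub>i\<close> and \<open>N\<^sub>j\<close>.\<close>

definition guarded_fix :: "'c sig \<Rightarrow> nat \<Rightarrow> 'c tm \<Rightarrow> bool" where
  "guarded_fix \<Sigma> m F \<longleftrightarrow>
     (\<exists>f Ls Ls' Ns.
        F = Fix (iotas m) ((Lam Iota ^^ m) (apps (Con f) (Ls @ [apps (Var m) Ns] @ Ls'))) \<and>
        length Ns = m \<and>
        \<Sigma> f = Some (iotas (length Ls + length Ls' + 1)) \<and>
        (\<forall>M \<in> set Ls \<union> set Ls' \<union> set Ns.
           fo_term \<Sigma> (replicate m Iota @ [iotas m]) M \<and>
           wt \<Sigma> (replicate m Iota @ [iotas m]) M Iota) \<and>
        (\<Union>M \<in> set Ls \<union> set Ls' \<union> set Ns. fv M) = {..<m})"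

definition guarded_full :: "'c sig \<Rightarrow> ty list \<Rightarrow> 'c tm \<Rightarrow> bool" where
  "guarded_full \<Sigma> \<Gamma> M \<longleftrightarrow>
     fo_term \<Sigma> \<Gamma> M \<or>
     (\<exists>F Ms. M = apps F Ms \<and> guarded_fix \<Sigma> (length Ms) F \<and>
        (\<forall>N \<in> set Ms. fo_term \<Sigma> \<Gamma> N \<and> wt \<Sigma> \<Gamma> N Iota))"

definition guarded_atom :: "'c sig \<Rightarrow> ty list \<Rightarrow> 'c tm \<Rightarrow> bool" where
  "guarded_atom \<Sigma> \<Gamma> A \<longleftrightarrow>
     atom \<Sigma> \<Gamma> A \<and>
     (\<exists>h Ms. atom \<Sigma> \<Gamma> (apps (Con h) Ms) \<and> fo_pred \<Sigma> h \<and>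
        (\<forall>M \<in> set Ms. guarded_full \<Sigma> \<Gamma> M) \<and>
        fixbeta_eq A (apps (Con h) Ms))"


section \<open>Trees\<close>

datatype 'c label = LCon 'c | LVar nat

type_synonym 'c tree = "nat list \<Rightarrow> 'c label option"

primrec arity :: "'c sig \<Rightarrow> 'c label \<Rightarrow> nat" where
  "arity \<Sigma> (LCon c) = length (arg_tys (the (\<Sigma> c)))"
| "arity \<Sigma> (LVar n) = 0"

text \<open>The last conjunct makes the domain prefix-closed, left-closed and finitely branching.\<close>

definition is_tree :: "'c sig \<Rightarrow> 'c tree \<Rightarrow> bool" where
  "is_tree \<Sigma> t \<longleftrightarrow>
     t [] \<noteq> None \<and>
     (\<forall>w c. t w = Some (LCon c) \<longrightarrow> c \<in> dom \<Sigma>) \<and>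
     (\<forall>w i. w @ [i] \<in> dom t \<longleftrightarrow> (\<exists>l. t w = Some l \<and> i < arity \<Sigma> l))"

definition closed_tree :: "'c tree \<Rightarrow> bool" where
  "closed_tree t \<longleftrightarrow> (\<forall>w n. t w \<noteq> Some (LVar n))"

definition herbrand_univ :: "'c sig \<Rightarrow> 'c tree set" where
  "herbrand_univ \<Sigma> = {t. is_tree \<Sigma> t \<and> closed_tree t}"

definition herbrand_base :: "'c sig \<Rightarrow> 'c tree set" where
  "herbrand_base \<Sigma> =
     {t. is_tree \<Sigma> t \<and> closed_tree t \<and> (\<exists>c. t [] = Some (LCon c) \<and> predicate \<Sigma> [] (Con c))}"

definition trunc :: "nat \<Rightarrow> 'c tree \<Rightarrow> 'c tree" where
  "trunc n t = t |` {w. length w \<le> n}"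

definition tree_dist :: "'c tree \<Rightarrow> 'c tree \<Rightarrow> real" where
  "tree_dist s t = (if s = t then 0 else (1/2) ^ (LEAST n. trunc n s \<noteq> trunc n t))"

primrec tree_subst :: "(nat \<Rightarrow> 'c tree) \<Rightarrow> 'c tree \<Rightarrow> nat list \<Rightarrow> 'c label option" where
  "tree_subst \<sigma> t [] = (case t [] of Some (LVar n) \<Rightarrow> \<sigma> n [] | l \<Rightarrow> l)"
| "tree_subst \<sigma> t (i # w) =
     (case t [] of Some (LVar n) \<Rightarrow> \<sigma> n (i # w) | _ \<Rightarrow> tree_subst \<sigma> (\<lambda>v. t (i # v)) w)"

fun head_label :: "'c tm \<Rightarrow> 'c label option" where
  "head_label (Con c) = Some (LCon c)"
| "head_label (Var n) = Some (LVar n)"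
| "head_label _ = None"

text \<open>Meaningful for first-order terms and first-order atoms.\<close>

primrec tree_of :: "'c tm \<Rightarrow> nat list \<Rightarrow> 'c label option" where
  "tree_of M [] = head_label (head M)"
| "tree_of M (i # w) = (if i < length (args M) then tree_of (args M ! i) w else None)"


subsection \<open>The tree of a guarded atom\<close>

text \<open>The fresh constant \<open>\<diamond>\<close> is \<open>None\<close> in the signature extended by \<open>\<diamond> : \<iota>\<close>, whose constants are
  those of \<open>\<Sigma>\<close> tagged with \<open>Some\<close>.\<close>

definition sig_diamond :: "'c sig \<Rightarrow> 'c option sig" where
  "sig_diamond \<Sigma> = case_option (Some Iota) \<Sigma>"

definition tree_embed :: "'c tree \<Rightarrow> 'c option tree" where
  "tree_embed t = (\<lambda>w. map_option (map_label Some) (t w))"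

text \<open>Unfolding a guarded full term moves such terms below constants, so the snapshot replaces them
  in argument position at any depth.\<close>

primrec snapshot :: "'c sig \<Rightarrow> ty list \<Rightarrow> 'c tm \<Rightarrow> 'c option tm" where
  "snapshot \<Sigma> \<Gamma> (Var n) = Var n"
| "snapshot \<Sigma> \<Gamma> (Con c) = Con (Some c)"
| "snapshot \<Sigma> \<Gamma> (Log k) = Log k"
| "snapshot \<Sigma> \<Gamma> (App M N) =
     (if guarded_full \<Sigma> \<Gamma> (App M N) \<and> \<not> fo_term \<Sigma> \<Gamma> (App M N) then Con None
      else App (snapshot \<Sigma> \<Gamma> M) (snapshot \<Sigma> \<Gamma> N))"
| "snapshot \<Sigma> \<Gamma> (Lam \<tau> M) = map_tm Some (Lam \<tau> M)"
| "snapshot \<Sigma> \<Gamma> (Fix \<tau> M) =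
     (if guarded_full \<Sigma> \<Gamma> (Fix \<tau> M) then Con None else map_tm Some (Fix \<tau> M))"

text \<open>\<open>fair_run A S\<close>: \<open>S\<close> is a fair sequence of one-step reductions of \<open>A\<close>, each followed by
  \<open>\<beta>\<close>-normalisation; the sequence is constant from a term without fixed-point redexes onwards.
  Fairness: no redex stays in place forever without being contracted. In the unfoldings of an atom
  whose arguments are guarded full terms, the redexes are pairwise disjoint and each keeps its
  position until it is contracted, so there this says that every redex is eventually contracted.\<close>

definition fair_run :: "'c tm \<Rightarrow> (nat \<Rightarrow> 'c tm) \<Rightarrow> bool" where
  "fair_run A S \<longleftrightarrow>
     S 0 = A \<and>
     (\<exists>pos.
        (\<forall>k. (\<exists>M. fix_at (pos k) (S k) M \<and> beta_nf M (S (Suc k))) \<or>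
             ((\<nexists>p. redex_at p (S k)) \<and> S (Suc k) = S k)) \<and>
        (\<forall>p k. (\<forall>j\<ge>k. redex_at p (S j)) \<longrightarrow> (\<exists>j\<ge>k. pos j = p)))"

definition limit_tree :: "'c sig \<Rightarrow> ty list \<Rightarrow> 'c tm \<Rightarrow> 'c tree \<Rightarrow> bool" where
  "limit_tree \<Sigma> \<Gamma> A T \<longleftrightarrow>
     (\<exists>S. fair_run A S \<and>
        (\<forall>\<^sub>F k in sequentially. fo_atom (sig_diamond \<Sigma>) \<Gamma> (snapshot \<Sigma> \<Gamma> (S k))) \<and>
        (\<lambda>k. tree_dist (tree_of (snapshot \<Sigma> \<Gamma> (S k))) (tree_embed T)) \<longlonglongrightarrow> 0)"

definition atom_tree :: "'c sig \<Rightarrow> ty list \<Rightarrow> 'c tm \<Rightarrow> 'c tree" where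
  "atom_tree \<Sigma> \<Gamma> A =
     (if fo_atom \<Sigma> \<Gamma> A then tree_of A else (THE T. limit_tree \<Sigma> \<Gamma> A T))"


section \<open>H-formulae, programs and coinductive models\<close>

text \<open>\<open>HForm m Bs B\<close> is \<open>\<forall>\<^sub>\<iota>x\<^sub>1\<dots>x\<^sub>m (B\<^sub>1 \<and> \<dots> \<and> B\<^sub>k \<supset> B)\<close>; the quantified variables are the indices
  below \<open>m\<close> in the atoms. For \<open>k = 0\<close> the matrix is \<open>B\<close> itself.\<close>

datatype 'c hform = HForm (nvars: nat) (body: "'c tm list") (hd_atom: "'c tm")

definition hctxt :: "'c hform \<Rightarrow> ty list" where
  "hctxt K = replicate (nvars K) Iota"

definition hatoms :: "'c hform \<Rightarrow> 'c tm set" where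
  "hatoms K = insert (hd_atom K) (set (body K))"

definition is_hform :: "'c sig \<Rightarrow> 'c hform \<Rightarrow> bool" where
  "is_hform \<Sigma> K \<longleftrightarrow> (\<forall>A \<in> hatoms K. atom \<Sigma> (hctxt K) A)"

definition logic_program :: "'c sig \<Rightarrow> 'c hform set \<Rightarrow> bool" where
  "logic_program \<Sigma> P \<longleftrightarrow>
     finite P \<and> (\<forall>K \<in> P. is_hform \<Sigma> K \<and> (\<forall>A \<in> hatoms K. fo_atom \<Sigma> (hctxt K) A))"

definition tree_instance :: "'c sig \<Rightarrow> 'c hform \<Rightarrow> 'c tree set \<Rightarrow> 'c tree \<Rightarrow> bool" where
  "tree_instance \<Sigma> K Bs B \<longleftrightarrow>
     (\<exists>\<sigma>. (\<forall>j < nvars K. \<sigma> j \<in> herbrand_univ \<Sigma>) \<and>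
          Bs = (\<lambda>A. tree_subst \<sigma> (atom_tree \<Sigma> (hctxt K) A)) ` set (body K) \<and>
          B = tree_subst \<sigma> (atom_tree \<Sigma> (hctxt K) (hd_atom K)))"

definition term_instance :: "'c sig \<Rightarrow> 'c hform \<Rightarrow> 'c hform \<Rightarrow> bool" where
  "term_instance \<Sigma> K K' \<longleftrightarrow>
     (\<exists>\<sigma>. (\<forall>j < nvars K. wt \<Sigma> [] (\<sigma> j) Iota \<and> \<sigma> j \<in> U1 \<Sigma>) \<and>
          nvars K' = 0 \<and>
          list_all2 (\<lambda>A A'. beta_nf (subst \<sigma> A) A') (body K) (body K') \<and>
          beta_nf (subst \<sigma> (hd_atom K)) (hd_atom K'))"

definition T_op :: "'c sig \<Rightarrow> 'c hform set \<Rightarrow> 'c tree set \<Rightarrow> 'c tree set" where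
  "T_op \<Sigma> Q I = {B \<in> herbrand_base \<Sigma>. \<exists>K \<in> Q. \<exists>Bs. tree_instance \<Sigma> K Bs B \<and> Bs \<subseteq> I}"

definition coind_model :: "'c sig \<Rightarrow> 'c hform set \<Rightarrow> 'c tree set" where
  "coind_model \<Sigma> Q = gfp (T_op \<Sigma> Q)"


section \<open>The calculus co-hohh\<close>

abbreviation tm_imp :: "'c tm \<Rightarrow> 'c tm \<Rightarrow> 'c tm" where
  "tm_imp F G \<equiv> App (App (Log Imp) F) G"

abbreviation tm_and :: "'c tm \<Rightarrow> 'c tm \<Rightarrow> 'c tm" where
  "tm_and F G \<equiv> App (App (Log And) F) G"

abbreviation tm_or :: "'c tm \<Rightarrow> 'c tm \<Rightarrow> 'c tm" where
  "tm_or F G \<equiv> App (App (Log Or) F) G"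

abbreviation tm_all :: "ty \<Rightarrow> 'c tm \<Rightarrow> 'c tm" where
  "tm_all \<tau> F \<equiv> App (Log (Forall \<tau>)) (Lam \<tau> F)"

abbreviation tm_ex :: "ty \<Rightarrow> 'c tm \<Rightarrow> 'c tm" where
  "tm_ex \<tau> F \<equiv> App (Log (Exists \<tau>)) (Lam \<tau> F)"

fun conj :: "'c tm list \<Rightarrow> 'c tm" where
  "conj [] = Log Top"
| "conj [A] = A"
| "conj (A # As) = tm_and A (conj As)"

definition formula :: "'c hform \<Rightarrow> 'c tm" where
  "formula K =
     (tm_all Iota ^^ nvars K)
       (if body K = [] then hd_atom K else tm_imp (conj (body K)) (hd_atom K))"

inductive clause :: "'c sig \<Rightarrow> ty list \<Rightarrow> 'c tm \<Rightarrow> bool"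
  and goal :: "'c sig \<Rightarrow> ty list \<Rightarrow> 'c tm \<Rightarrow> bool"
  for \<Sigma> :: "'c sig" where
  "rigid_atom \<Sigma> \<Gamma> A \<Longrightarrow> A \<in> U2 \<Sigma> \<Longrightarrow> clause \<Sigma> \<Gamma> A"
| "goal \<Sigma> \<Gamma> G \<Longrightarrow> clause \<Sigma> \<Gamma> D \<Longrightarrow> clause \<Sigma> \<Gamma> (tm_imp G D)"
| "clause \<Sigma> \<Gamma> D\<^sub>1 \<Longrightarrow> clause \<Sigma> \<Gamma> D\<^sub>2 \<Longrightarrow> clause \<Sigma> \<Gamma> (tm_and D\<^sub>1 D\<^sub>2)"
| "clause \<Sigma> (\<tau> # \<Gamma>) D \<Longrightarrow> clause \<Sigma> \<Gamma> (tm_all \<tau> D)"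
| "goal \<Sigma> \<Gamma> (Log Top)"
| "atom \<Sigma> \<Gamma> A \<Longrightarrow> A \<in> U2 \<Sigma> \<Longrightarrow> goal \<Sigma> \<Gamma> A"
| "goal \<Sigma> \<Gamma> G\<^sub>1 \<Longrightarrow> goal \<Sigma> \<Gamma> G\<^sub>2 \<Longrightarrow> goal \<Sigma> \<Gamma> (tm_and G\<^sub>1 G\<^sub>2)"
| "goal \<Sigma> \<Gamma> G\<^sub>1 \<Longrightarrow> goal \<Sigma> \<Gamma> G\<^sub>2 \<Longrightarrow> goal \<Sigma> \<Gamma> (tm_or G\<^sub>1 G\<^sub>2)"
| "goal \<Sigma> (\<tau> # \<Gamma>) G \<Longrightarrow> goal \<Sigma> \<Gamma> (tm_ex \<tau> G)"
| "clause \<Sigma> \<Gamma> D \<Longrightarrow> goal \<Sigma> \<Gamma> G \<Longrightarrow> goal \<Sigma> \<Gamma> (tm_imp D G)"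
| "goal \<Sigma> (\<tau> # \<Gamma>) G \<Longrightarrow> goal \<Sigma> \<Gamma> (tm_all \<tau> G)"

text \<open>In this order: \<open>\<Sigma>; P \<longrightarrow> G\<close>, the focused sequent with clause \<open>D\<close> above the arrow and goal \<open>A\<close>,
  the same two with a guarded goal, and the coinductive sequent to which co-fix applies.\<close>

datatype 'c sequent =
    Seq "'c sig" "'c tm set" "'c tm"
  | Foc "'c sig" "'c tm set" "'c tm" "'c tm"
  | GSeq "'c sig" "'c tm set" "'c tm"
  | GFoc "'c sig" "'c tm set" "'c tm" "'c tm"
  | CoSeq "'c sig" "'c tm set" "'c tm"

primrec seq_sig :: "'c sequent \<Rightarrow> 'c sig" where
  "seq_sig (Seq \<Sigma> P G) = \<Sigma>"
| "seq_sig (Foc \<Sigma> P D A) = \<Sigma>"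
| "seq_sig (GSeq \<Sigma> P M) = \<Sigma>"
| "seq_sig (GFoc \<Sigma> P D A) = \<Sigma>"
| "seq_sig (CoSeq \<Sigma> P M) = \<Sigma>"

primrec seq_formulas :: "'c sequent \<Rightarrow> 'c tm set" where
  "seq_formulas (Seq \<Sigma> P G) = insert G P"
| "seq_formulas (Foc \<Sigma> P D A) = insert D (insert A P)"
| "seq_formulas (GSeq \<Sigma> P M) = insert M P"
| "seq_formulas (GFoc \<Sigma> P D A) = insert D (insert A P)"
| "seq_formulas (CoSeq \<Sigma> P M) = insert M P"

text \<open>Formulae proved under guard or by coinduction also serve as hypotheses, hence are both goals
  and clauses.\<close>

primrec wf_sequent :: "'c sequent \<Rightarrow> bool" where
  "wf_sequent (Seq \<Sigma> P G) \<longleftrightarrow> (\<forall>D \<in> P. clause \<Sigma> [] D) \<and> goal \<Sigma> [] G"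
| "wf_sequent (Foc \<Sigma> P D A) \<longleftrightarrow>
     (\<forall>D \<in> P. clause \<Sigma> [] D) \<and> clause \<Sigma> [] D \<and> atom \<Sigma> [] A \<and> A \<in> U2 \<Sigma>"
| "wf_sequent (GSeq \<Sigma> P M) \<longleftrightarrow>
     (\<forall>D \<in> P. clause \<Sigma> [] D) \<and> clause \<Sigma> [] M \<and> goal \<Sigma> [] M"
| "wf_sequent (GFoc \<Sigma> P D A) \<longleftrightarrow>
     (\<forall>D \<in> P. clause \<Sigma> [] D) \<and> clause \<Sigma> [] D \<and> atom \<Sigma> [] A \<and> A \<in> U2 \<Sigma>"
| "wf_sequent (CoSeq \<Sigma> P M) \<longleftrightarrow>
     (\<forall>D \<in> P. clause \<Sigma> [] D) \<and> clause \<Sigma> [] M \<and> goal \<Sigma> [] M"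

text \<open>\<open>P\<^sub>0\<close> is the original program.\<close>

inductive inference :: "'c tm set \<Rightarrow> 'c sequent list \<Rightarrow> 'c sequent \<Rightarrow> bool"
  for P\<^sub>0 :: "'c tm set" where
  impR: "inference P\<^sub>0 [Seq \<Sigma> (insert D P) G] (Seq \<Sigma> P (tm_imp D G))"
| allR: "\<Sigma> c = None \<Longrightarrow>
    inference P\<^sub>0 [Seq (\<Sigma>(c \<mapsto> \<tau>)) P (inst G (Con c))] (Seq \<Sigma> P (tm_all \<tau> G))"
| exR: "wt \<Sigma> [] N \<tau> \<Longrightarrow> N \<in> U2 \<Sigma> \<Longrightarrow> beta_nf (inst G N) G' \<Longrightarrow>
    inference P\<^sub>0 [Seq \<Sigma> P G'] (Seq \<Sigma> P (tm_ex \<tau> G))"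
| orR1: "inference P\<^sub>0 [Seq \<Sigma> P G\<^sub>1] (Seq \<Sigma> P (tm_or G\<^sub>1 G\<^sub>2))"
| orR2: "inference P\<^sub>0 [Seq \<Sigma> P G\<^sub>2] (Seq \<Sigma> P (tm_or G\<^sub>1 G\<^sub>2))"
| andR: "inference P\<^sub>0 [Seq \<Sigma> P G\<^sub>1, Seq \<Sigma> P G\<^sub>2] (Seq \<Sigma> P (tm_and G\<^sub>1 G\<^sub>2))"
| topR: "inference P\<^sub>0 [] (Seq \<Sigma> P (Log Top))"
| impL: "inference P\<^sub>0 [Foc \<Sigma> P D A, Seq \<Sigma> P G] (Foc \<Sigma> P (tm_imp G D) A)"
| andL1: "inference P\<^sub>0 [Foc \<Sigma> P D\<^sub>1 A] (Foc \<Sigma> P (tm_and D\<^sub>1 D\<^sub>2) A)"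
| andL2: "inference P\<^sub>0 [Foc \<Sigma> P D\<^sub>2 A] (Foc \<Sigma> P (tm_and D\<^sub>1 D\<^sub>2) A)"
| allL: "wt \<Sigma> [] N \<tau> \<Longrightarrow> N \<in> U2 \<Sigma> \<Longrightarrow> beta_nf (inst D N) D' \<Longrightarrow>
    inference P\<^sub>0 [Foc \<Sigma> P D' A] (Foc \<Sigma> P (tm_all \<tau> D) A)"
| decide: "D \<in> P \<Longrightarrow> atom \<Sigma> [] A \<Longrightarrow> inference P\<^sub>0 [Foc \<Sigma> P D A] (Seq \<Sigma> P A)"
| initial: "rigid_atom \<Sigma> [] A' \<Longrightarrow> atom \<Sigma> [] A \<Longrightarrow> fixbeta_eq A A' \<Longrightarrow>
    inference P\<^sub>0 [] (Foc \<Sigma> P A' A)"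
| cofix: "inference P\<^sub>0 [GSeq \<Sigma> (insert M P\<^sub>0) M] (CoSeq \<Sigma> P\<^sub>0 M)"
| impR_g: "inference P\<^sub>0 [GSeq \<Sigma> (insert M\<^sub>1 P) M\<^sub>2] (GSeq \<Sigma> P (tm_imp M\<^sub>1 M\<^sub>2))"
| allR_g: "\<Sigma> c = None \<Longrightarrow>
    inference P\<^sub>0 [GSeq (\<Sigma>(c \<mapsto> \<tau>)) P (inst M (Con c))] (GSeq \<Sigma> P (tm_all \<tau> M))"
| andR_g: "inference P\<^sub>0 [GSeq \<Sigma> P M\<^sub>1, GSeq \<Sigma> P M\<^sub>2] (GSeq \<Sigma> P (tm_and M\<^sub>1 M\<^sub>2))"
| impL_g: "inference P\<^sub>0 [Foc \<Sigma> P D A, Seq \<Sigma> P G] (GFoc \<Sigma> P (tm_imp G D) A)"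
| andL1_g: "inference P\<^sub>0 [GFoc \<Sigma> P D\<^sub>1 A] (GFoc \<Sigma> P (tm_and D\<^sub>1 D\<^sub>2) A)"
| andL2_g: "inference P\<^sub>0 [GFoc \<Sigma> P D\<^sub>2 A] (GFoc \<Sigma> P (tm_and D\<^sub>1 D\<^sub>2) A)"
| allL_g: "wt \<Sigma> [] N \<tau> \<Longrightarrow> N \<in> U2 \<Sigma> \<Longrightarrow> beta_nf (inst D N) D' \<Longrightarrow>
    inference P\<^sub>0 [GFoc \<Sigma> P D' A] (GFoc \<Sigma> P (tm_all \<tau> D) A)"
| decide_g: "D \<in> P\<^sub>0 \<Longrightarrow> atom \<Sigma> [] A \<Longrightarrow> inference P\<^sub>0 [GFoc \<Sigma> P D A] (GSeq \<Sigma> P A)"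
| initial_g: "rigid_atom \<Sigma> [] A' \<Longrightarrow> atom \<Sigma> [] A \<Longrightarrow> fixbeta_eq A A' \<Longrightarrow>
    inference P\<^sub>0 [] (GFoc \<Sigma> P A' A)"

datatype (sequents: 's) ptree = Infer (concl: 's) (subproofs: "'s ptree list")

inductive valid :: "'c tm set \<Rightarrow> 'c sequent ptree \<Rightarrow> bool" for P\<^sub>0 :: "'c tm set" where
  "wf_sequent s \<Longrightarrow> inference P\<^sub>0 (map concl \<pi>s) s \<Longrightarrow> (\<And>\<pi>. \<pi> \<in> set \<pi>s \<Longrightarrow> valid P\<^sub>0 \<pi>) \<Longrightarrow>
    valid P\<^sub>0 (Infer s \<pi>s)"

definition is_coproof :: "'c sequent ptree \<Rightarrow> 'c sig \<Rightarrow> 'c tm set \<Rightarrow> 'c tm \<Rightarrow> bool" where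
  "is_coproof \<pi> \<Sigma> P M \<longleftrightarrow> valid P \<pi> \<and> concl \<pi> = CoSeq \<Sigma> P M"

fun atoms_of :: "ty list \<Rightarrow> 'c tm \<Rightarrow> (ty list \<times> 'c tm) set" where
  "atoms_of \<Gamma> (Log k) = {}"
| "atoms_of \<Gamma> (App (App (Log k) F) G) = atoms_of \<Gamma> F \<union> atoms_of \<Gamma> G"
| "atoms_of \<Gamma> (App (Log k) (Lam \<tau> F)) = atoms_of (\<tau> # \<Gamma>) F"
| "atoms_of \<Gamma> A = {(\<Gamma>, A)}"

definition all_atoms_guarded :: "'c sequent ptree \<Rightarrow> bool" where
  "all_atoms_guarded \<pi> \<longleftrightarrow>
     (\<forall>s \<in> sequents \<pi>. \<forall>F \<in> seq_formulas s. \<forall>(\<Gamma>, A) \<in> atoms_of [] F.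
        guarded_atom (seq_sig s) \<Gamma> A)"

end

theory Submission
  imports Defs "HOL-Library.Nat_Bijection"
begin

text \<open>Every term gets a partial tree, read off its rigid head normal forms up to \<open>fix\<beta>\<close>-conversion,
  which is well defined by confluence. For a guarded atom this tree is complete and equals its
  \<open>d\<close>-limit: two limits agree by confluence, and a limit exists because, by normalisation of the simply
  typed \<open>\<beta>\<close>-calculus, an atom can be unfolded to every common reduct it has with an atom whose
  arguments are guarded full terms.

  Let \<open>\<M>\<close> be the model of \<open>P\<close> and \<open>X\<close> the closure of \<open>\<M>\<close> under the clauses of \<open>P\<close> and under
  \<open>H\<close>. The derivation of \<open>\<langle>H\<rangle>\<close>, evaluated with trees for its eigenconstants, ends every branch for the
  head of \<open>H\<close> in a clause of \<open>P\<close> whose body follows from \<open>P\<close>, \<open>H\<close> and the body of \<open>H\<close>. Hence \<open>X\<close> is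
  a post-fixed point of \<open>\<T>\<^sub>P\<close>, so \<open>X = \<M>\<close> is closed under \<open>H\<close>. The ground instances
  \<open>H\<^sub>k\<close> then add nothing to \<open>\<M>\<close>, since their trees are instances of \<open>H\<close> by the trees of the
  substituted terms.\<close>

text \<open>Two features of the definitions shape the work. First, \<open>atom_tree\<close> is a
  definite description over all fair runs and over arbitrary functions \<open>T\<close>, and a
  guarded atom is merely convertible to one of the expected form. So uniqueness can assume nothing
  about the stages of a run, and existence has to reach the good form by genuine run steps, in which
  each contraction is followed by full \<beta>-normalisation. Working with the conversion-invariant
  \<open>BT\<close> confines runs to the equation \<open>atom_tree_eq_BT\<close>.

  Secondly, quantifiers may be instantiated by terms such as \<open>Fix Iota (Var 0)\<close> that
  have no tree, as long as the resulting atoms are guarded. Such a term receives a default tree, so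
  the Herbrand universe must be inhabited.

  Guardedness of the calculus enters through \<open>decide_g\<close>: the head of a focused clause
  is interpreted in a set \<open>Y\<close> of its own, and a guarded decision on an original clause
  takes \<open>Y\<close> to be \<open>T_op \<Sigma> P X\<close>, while bodies and hypotheses are
  read in \<open>X\<close>. Plain and guarded rules then share one soundness argument.\<close>

section \<open>Renaming and substitution on de Bruijn terms\<close>

abbreviation upr :: "(nat \<Rightarrow> nat) \<Rightarrow> nat \<Rightarrow> nat" where
  "upr f \<equiv> case_nat 0 (\<lambda>n. Suc (f n))"

abbreviation ups :: "(nat \<Rightarrow> 'c tm) \<Rightarrow> nat \<Rightarrow> 'c tm" where
  "ups \<sigma> \<equiv> case_nat (Var 0) (\<lambda>n. ren Suc (\<sigma> n))"

lemma upr_upr: "(\<lambda>n. upr f (upr g n)) = upr (\<lambda>n. f (g n))"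
  by (auto split: nat.split)

lemma ren_ren: "ren f (ren g M) = ren (\<lambda>n. f (g n)) M"
  by (induction M arbitrary: f g) (simp_all add: upr_upr)

lemma ups_upr: "(\<lambda>n. ups \<sigma> (upr f n)) = ups (\<lambda>n. \<sigma> (f n))"
  by (auto split: nat.split)

lemma subst_ren: "subst \<sigma> (ren f M) = subst (\<lambda>n. \<sigma> (f n)) M"
  by (induction M arbitrary: f \<sigma>) (simp_all add: ups_upr)

lemma ren_upr_ups: "(\<lambda>n. ren (upr f) (ups \<sigma> n)) = ups (\<lambda>n. ren f (\<sigma> n))"
  by (auto split: nat.split simp: ren_ren)

lemma ren_subst: "ren f (subst \<sigma> M) = subst (\<lambda>n. ren f (\<sigma> n)) M"
  by (induction M arbitrary: f \<sigma>) (simp_all add: ren_upr_ups)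

lemma subst_ups_ups: "(\<lambda>n. subst (ups \<sigma>) (ups \<theta> n)) = ups (\<lambda>n. subst \<sigma> (\<theta> n))"
  by (auto split: nat.split simp: subst_ren ren_subst)

text \<open>The four composition laws come in the order ren-ren, subst-ren, ren-subst, subst-subst,
  because lifting one under a binder uses earlier ones: \<open>subst_ups_ups\<close> needs both
  mixed laws.\<close>

lemma subst_subst: "subst \<sigma> (subst \<theta> M) = subst (\<lambda>n. subst \<sigma> (\<theta> n)) M"
  by (induction M arbitrary: \<sigma> \<theta>) (auto simp: subst_ups_ups)

lemma ups_Var: "case_nat (Var 0) (\<lambda>n. Var (Suc n)) = Var"
  by (auto split: nat.split)

lemma subst_Var [simp]: "subst Var M = M"
  by (induction M) (simp_all add: ups_Var)

lemma ren_eq_subst: "ren f M = subst (\<lambda>n. Var (f n)) M"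
  using ren_subst[of f Var M] by simp

lemma subst_cong_fv: "(\<And>n. n \<in> fv M \<Longrightarrow> \<sigma> n = \<theta> n) \<Longrightarrow> subst \<sigma> M = subst \<theta> M"
proof (induction M arbitrary: \<sigma> \<theta>)
  case (Lam \<tau> M)
  have "subst (ups \<sigma>) M = subst (ups \<theta>) M"
    by (rule Lam.IH) (use Lam.prems in \<open>auto split: nat.split\<close>)
  then show ?case by simp
next
  case (Fix \<tau> M)
  have "subst (ups \<sigma>) M = subst (ups \<theta>) M"
    by (rule Fix.IH) (use Fix.prems in \<open>auto split: nat.split\<close>)
  then show ?case by simp
next
  case (App M N)
  have "subst \<sigma> M = subst \<theta> M" by (rule App.IH) (use App.prems in auto)
  moreover have "subst \<sigma> N = subst \<theta> N" by (rule App.IH) (use App.prems in auto)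
  ultimately show ?case by simp
qed auto

lemma subst_closed: "fv M = {} \<Longrightarrow> subst \<sigma> M = M"
  using subst_cong_fv[of M \<sigma> Var] by simp

lemma ren_closed: "fv M = {} \<Longrightarrow> ren f M = M"
  by (simp add: ren_eq_subst subst_closed)

lemma subst_case_nat_ups: "subst (case_nat N \<theta>) (ups \<sigma> n) = case_nat N (\<lambda>k. subst \<theta> (\<sigma> k)) n"
  by (auto split: nat.split simp: subst_ren)

text \<open>Fuses a lifted substitution and the instantiation of the bound variable into one
  simultaneous substitution, the form to which the induction hypotheses for binders in the
  reducibility argument apply.\<close>

lemma inst_subst_ups: "inst (subst (ups \<sigma>) M) N = subst (case_nat N \<sigma>) M"
  unfolding inst_def subst_subst
  by (rule subst_cong_fv) (auto simp: subst_case_nat_ups split: nat.split)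

lemma subst_inst: "subst \<sigma> (inst M N) = inst (subst (ups \<sigma>) M) (subst \<sigma> N)"
  unfolding inst_subst_ups unfolding inst_def subst_subst
  by (rule subst_cong_fv) (auto split: nat.split)

lemma ren_inst: "ren f (inst M N) = inst (ren (upr f) M) (ren f (N :: 'c tm))"
proof -
  have "ups (\<lambda>n. Var (f n)) = (\<lambda>n. Var (upr f n) :: 'c tm)" by (auto split: nat.split)
  then show ?thesis unfolding ren_eq_subst[of f] ren_eq_subst[of "upr f"] subst_inst by (simp only:)
qed

subsection \<open>Spines\<close>

lemma apps_Nil [simp]: "apps h [] = h"
  and apps_Cons [simp]: "apps h (M # Ms) = apps (App h M) Ms"
  and apps_append [simp]: "apps h (Ms @ Ns) = apps (apps h Ms) Ns"
  by (simp_all add: apps_def)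

lemma subst_apps [simp]: "subst \<sigma> (apps h Ms) = apps (subst \<sigma> h) (map (subst \<sigma>) Ms)"
  by (induction Ms rule: rev_induct) simp_all

lemma head_apps [simp]: "head (apps h Ms) = head h"
  by (induction Ms rule: rev_induct) simp_all

lemma args_apps [simp]: "args (apps h Ms) = args h @ Ms"
  by (induction Ms rule: rev_induct) simp_all

lemma apps_head_args [simp]: "apps (head M) (args M) = M"
  by (induction M) simp_all

lemma fv_apps [simp]: "fv (apps h Ms) = fv h \<union> (\<Union>M\<in>set Ms. fv M)"
  by (induction Ms rule: rev_induct) auto

text \<open>The heads that no reduction can change. Logical constants are included because formulas
  are analysed along their spines too.\<close>

definition rigid_head :: "'c tm \<Rightarrow> bool" where
  "rigid_head h \<longleftrightarrow> (\<exists>n. h = Var n) \<or> (\<exists>c. h = Con c) \<or> (\<exists>k. h = Log k)"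

lemma rigid_head_simps [simp]:
  "rigid_head (Var n)" "rigid_head (Con c)" "rigid_head (Log k)" "\<not> rigid_head (App M N)"
  "\<not> rigid_head (Lam \<tau> M)" "\<not> rigid_head (Fix \<tau> M)"
  by (auto simp: rigid_head_def)

lemma rigid_head_head: "rigid_head h \<Longrightarrow> head h = h"
  and rigid_head_args: "rigid_head h \<Longrightarrow> args h = []"
  by (auto simp: rigid_head_def)

lemma apps_rigid_inject:
  assumes "apps h Ms = apps h' Ms'" "rigid_head h" "rigid_head h'"
  shows "h = h' \<and> Ms = Ms'"
  using assms(2,3) arg_cong[OF assms(1), of head] arg_cong[OF assms(1), of args]
  by (auto simp: rigid_head_head rigid_head_args)

subsection \<open>Parallel reduction\<close>

text \<open>The flags say whether \<open>\<beta>\<close>-redexes and fixed-point redexes may be contracted. A single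
  commutation result then covers confluence of \<open>\<beta>\<close>, confluence of \<open>fix\<beta>\<close>, and the commutation of
  \<open>\<beta>\<close> with developments of fixed points.\<close>

inductive par :: "bool \<Rightarrow> bool \<Rightarrow> 'c tm \<Rightarrow> 'c tm \<Rightarrow> bool" for b f where
  par_Var: "par b f (Var n) (Var n)"
| par_Con: "par b f (Con c) (Con c)"
| par_Log: "par b f (Log k) (Log k)"
| par_App: "par b f M M' \<Longrightarrow> par b f N N' \<Longrightarrow> par b f (App M N) (App M' N')"
| par_Lam: "par b f M M' \<Longrightarrow> par b f (Lam \<tau> M) (Lam \<tau> M')"
| par_Fix: "par b f M M' \<Longrightarrow> par b f (Fix \<tau> M) (Fix \<tau> M')"
| par_beta: "b \<Longrightarrow> par b f M M' \<Longrightarrow> par b f N N' \<Longrightarrow> par b f (App (Lam \<tau> M) N) (inst M' N')"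
| par_fix: "f \<Longrightarrow> par b f M M' \<Longrightarrow> par b f (Fix \<tau> M) (inst M' (Fix \<tau> M'))"

lemma par_refl [simp]: "par b f M M"
  by (induction M) (auto intro: par.intros)

lemma par_ren: "par b f M M' \<Longrightarrow> par b f (ren g M) (ren g M')"
  by (induction arbitrary: g rule: par.induct) (auto simp: ren_inst intro: par.intros)

lemma par_ups: "(\<And>n. par b f (\<sigma> n) (\<sigma>' n)) \<Longrightarrow> par b f (ups \<sigma> n) (ups \<sigma>' n)"
  by (auto split: nat.split intro: par_ren)

lemma par_subst:
  "par b f M M' \<Longrightarrow> (\<And>n. par b f (\<sigma> n) (\<sigma>' n)) \<Longrightarrow> par b f (subst \<sigma> M) (subst \<sigma>' M')"
  by (induction arbitrary: \<sigma> \<sigma>' rule: par.induct)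
    (simp_all add: subst_inst par.intros par_ups)

lemma par_inst: "par b f M M' \<Longrightarrow> par b f N N' \<Longrightarrow> par b f (inst M N) (inst M' N')"
  unfolding inst_def by (rule par_subst) (auto split: nat.split)

inductive_cases par_VarE: "par b f (Var n) N"
inductive_cases par_ConE: "par b f (Con c) N"
inductive_cases par_LogE: "par b f (Log k) N"
inductive_cases par_LamE: "par b f (Lam \<tau> M) N"

lemma par_AppE:
  assumes "par b f (App M N) K"
  obtains (app) M' N' where "K = App M' N'" "par b f M M'" "par b f N N'"
  | (beta) \<tau> M\<^sub>1 M\<^sub>1' N' where "b" "M = Lam \<tau> M\<^sub>1" "K = inst M\<^sub>1' N'"
      "par b f M\<^sub>1 M\<^sub>1'" "par b f N N'"
  using assms by (cases rule: par.cases) auto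

lemma par_FixE:
  assumes "par b f (Fix \<tau> M) K"
  obtains (cong) M' where "K = Fix \<tau> M'" "par b f M M'"
  | (contract) M' where "f" "K = inst M' (Fix \<tau> M')" "par b f M M'"
  using assms by (cases rule: par.cases) auto

text \<open>Contracting a redex leaves residuals of the same kind on the other side, and a
  \<beta>-redex and a fixed-point redex never share their root. So no case relates the flags of the
  two sides, and these can be chosen independently.\<close>

lemma par_commute:
  "par b f M A \<Longrightarrow> par b' f' M B \<Longrightarrow> \<exists>C. par b' f' A C \<and> par b f B C"
proof (induction arbitrary: B rule: par.induct)
  case (par_App M M' N N')
  from par_App.prems show ?case
  proof (cases rule: par_AppE)
    case (app M2 N2)
    then show ?thesis using par_App.IH by (meson par.par_App)
  next
    \<comment> \<open>The induction hypothesis concerns the whole function part, here an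
      abstraction, so the contracted side is first rebuilt as \<open>Lam \<tau> M2\<close>;
      inverting the join recovers the body.\<close>
    case (beta \<tau> M1 M2 N2)
    then obtain C where C: "par b' f' M' C" "par b f (Lam \<tau> M2) C"
      using par_App.IH(1)[of "Lam \<tau> M2"] par.par_Lam by blast
    from \<open>M = Lam \<tau> M1\<close> par_App.hyps(1) obtain M1' where M1': "M' = Lam \<tau> M1'"
      by (auto elim: par_LamE)
    with C obtain C' where C': "C = Lam \<tau> C'" "par b' f' M1' C'" "par b f M2 C'"
      by (auto elim!: par_LamE)
    obtain D where "par b' f' N' D" "par b f N2 D" using par_App.IH(2) beta by blast
    then show ?thesis using beta C' M1' par_inst par.par_beta by blast
  qed
next
  case (par_beta M M' N N' \<tau>)
  from par_beta.prems show ?case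
  proof (cases rule: par_AppE)
    case (app M2 N2)
    then obtain M3 where M3: "M2 = Lam \<tau> M3" "par b' f' M M3" by (auto elim: par_LamE)
    obtain C where C: "par b' f' M' C" "par b f M3 C" using par_beta.IH(1) M3 by blast
    obtain D where D: "par b' f' N' D" "par b f N2 D" using par_beta.IH(2) app by blast
    show ?thesis using app M3 C D par_inst par.par_beta[OF \<open>b\<close>] by blast
  next
    case (beta \<tau>' M1 M2 N2)
    then show ?thesis using par_beta.IH par_inst by (metis tm.inject(5))
  qed
next
  case (par_Fix M M' \<tau>)
  from par_Fix.prems obtain M2 where M2: "par b' f' M M2"
    "B = Fix \<tau> M2 \<or> f' \<and> B = inst M2 (Fix \<tau> M2)" by (auto elim: par_FixE)
  obtain C where "par b' f' M' C" "par b f M2 C" using par_Fix.IH[OF M2(1)] by blast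
  then show ?case using M2(2) by (auto intro: par.par_Fix par.par_fix par_inst)
next
  case (par_fix M M' \<tau>)
  from par_fix.prems obtain M2 where M2: "par b' f' M M2"
    "B = Fix \<tau> M2 \<or> f' \<and> B = inst M2 (Fix \<tau> M2)" by (auto elim: par_FixE)
  obtain C where C: "par b' f' M' C" "par b f M2 C" using par_fix.IH[OF M2(1)] by blast
  then have "par b' f' (inst M' (Fix \<tau> M')) (inst C (Fix \<tau> C))"
    by (intro par_inst par.par_Fix)
  moreover have "par b f B (inst C (Fix \<tau> C))"
    using M2(2) C(2) \<open>f\<close> by (auto intro: par.par_fix par_inst par.par_Fix)
  ultimately show ?case by blast
next
  case (par_Lam M M' \<tau>)
  from par_Lam.prems obtain M2 where M2: "B = Lam \<tau> M2" "par b' f' M M2" by (auto elim: par_LamE)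
  then show ?case using par_Lam.IH[OF M2(2)] by (auto intro: par.par_Lam)
qed (auto elim!: par_VarE par_ConE par_LogE intro: par.intros)

section \<open>One-step reduction, confluence and the Church-Rosser property\<close>

definition step :: "bool \<Rightarrow> bool \<Rightarrow> 'c tm \<Rightarrow> 'c tm \<Rightarrow> bool" where
  "step b f M N \<longleftrightarrow> b \<and> beta M N \<or> f \<and> fix_step M N"

abbreviation steps :: "bool \<Rightarrow> bool \<Rightarrow> 'c tm \<Rightarrow> 'c tm \<Rightarrow> bool" where
  "steps b f \<equiv> (step b f)\<^sup>*\<^sup>*"

abbreviation betas :: "'c tm \<Rightarrow> 'c tm \<Rightarrow> bool" where
  "betas \<equiv> beta\<^sup>*\<^sup>*"

abbreviation red :: "'c tm \<Rightarrow> 'c tm \<Rightarrow> bool" where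
  "red \<equiv> step True True"

abbreviation reds :: "'c tm \<Rightarrow> 'c tm \<Rightarrow> bool" where
  "reds \<equiv> red\<^sup>*\<^sup>*"

lemma red_def: "red = (\<lambda>M N. beta M N \<or> fix_step M N)"
  by (auto simp: step_def fun_eq_iff)

lemma step_beta: "step True False = beta"
  by (auto simp: step_def fun_eq_iff)

lemma fix_stepI:
  "fix_step (Fix \<tau> M) (inst M (Fix \<tau> M))"
  "fix_step M M' \<Longrightarrow> fix_step (App M N) (App M' N)"
  "fix_step N N' \<Longrightarrow> fix_step (App M N) (App M N')"
  "fix_step M M' \<Longrightarrow> fix_step (Lam \<tau> M) (Lam \<tau> M')"
  "fix_step M M' \<Longrightarrow> fix_step (Fix \<tau> M) (Fix \<tau> M')"
  by (auto simp: fix_step_def intro: fix_at.intros)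

lemma stepI:
  "b \<Longrightarrow> step b f (App (Lam \<tau> M) N) (inst M N)"
  "f \<Longrightarrow> step b f (Fix \<tau> M) (inst M (Fix \<tau> M))"
  "step b f M M' \<Longrightarrow> step b f (App M N) (App M' N)"
  "step b f N N' \<Longrightarrow> step b f (App M N) (App M N')"
  "step b f M M' \<Longrightarrow> step b f (Lam \<tau> M) (Lam \<tau> M')"
  "step b f M M' \<Longrightarrow> step b f (Fix \<tau> M) (Fix \<tau> M')"
  by (auto simp: step_def intro: beta.intros fix_stepI)

lemma beta_par: "beta M N \<Longrightarrow> par True f M N"
  by (induction rule: beta.induct) (auto intro: par.intros)

lemma fix_at_par: "fix_at p M N \<Longrightarrow> par b True M N"
  by (induction rule: fix_at.induct) (auto intro: par.intros)

lemma step_par: "step b f M N \<Longrightarrow> par b f M N"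
  by (cases b; cases f) (auto simp: step_def fix_step_def intro: beta_par fix_at_par)

lemma rtranclp_map:
  assumes "\<And>x y. r x y \<Longrightarrow> s (g x) (g y)" "r\<^sup>*\<^sup>* x y"
  shows "s\<^sup>*\<^sup>* (g x) (g y)"
  using assms(2) by induction (auto intro: assms(1) rtranclp.rtrancl_into_rtrancl)

lemma steps_App:
  assumes "steps b f M M'" "steps b f N N'"
  shows "steps b f (App M N) (App M' N')"
proof (rule rtranclp_trans)
  show "steps b f (App M N) (App M' N)"
    by (rule rtranclp_map[of _ _ "\<lambda>M. App M N", OF _ assms(1)]) (rule stepI)
  show "steps b f (App M' N) (App M' N')"
    by (rule rtranclp_map[of _ _ "\<lambda>N. App M' N", OF _ assms(2)]) (rule stepI)
qed

lemma steps_Lam: "steps b f M M' \<Longrightarrow> steps b f (Lam \<tau> M) (Lam \<tau> M')"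
  by (erule rtranclp_map[rotated]) (rule stepI)

lemma steps_Fix: "steps b f M M' \<Longrightarrow> steps b f (Fix \<tau> M) (Fix \<tau> M')"
  by (erule rtranclp_map[rotated]) (rule stepI)

lemma par_steps: "par b f M N \<Longrightarrow> steps b f M N"
proof (induction rule: par.induct)
  case (par_beta M M' N N' \<tau>)
  then have "steps b f (App (Lam \<tau> M) N) (App (Lam \<tau> M') N')" by (intro steps_App steps_Lam)
  then show ?case using stepI(1)[OF \<open>b\<close>] by (rule rtranclp.rtrancl_into_rtrancl)
next
  case (par_fix M M' \<tau>)
  then have "steps b f (Fix \<tau> M) (Fix \<tau> M')" by (intro steps_Fix)
  then show ?case using stepI(2)[OF \<open>f\<close>] by (rule rtranclp.rtrancl_into_rtrancl)
qed (auto intro: steps_App steps_Lam steps_Fix)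

text \<open>Each step is a parallel step and each parallel step is a finite sequence of steps, so
  commutation can be proved for \<open>par\<close> and used for ordinary reduction.\<close>

lemma steps_eq_pars: "steps b f = (par b f)\<^sup>*\<^sup>*"
proof (intro ext iffI)
  show "(par b f)\<^sup>*\<^sup>* M N" if "steps b f M N" for M N :: "'a tm"
    using that by (rule rtranclp_mono[THEN predicate2D, rotated]) (auto dest: step_par)
  show "steps b f M N" if "(par b f)\<^sup>*\<^sup>* M N" for M N :: "'a tm"
    using that by induction (auto dest: par_steps)
qed

lemma par_pars_commute:
  assumes "(par b f)\<^sup>*\<^sup>* M A" "par b' f' M B"
  shows "\<exists>C. par b' f' A C \<and> (par b f)\<^sup>*\<^sup>* B C"
  using assms(1)
proof induction
  case base then show ?case using assms(2) by blast
next
  case (step Y Z)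
  then obtain C where C: "par b' f' Y C" "(par b f)\<^sup>*\<^sup>* B C" by blast
  from par_commute[OF step.hyps(2) C(1)] C(2) show ?case
    by (meson rtranclp.rtrancl_into_rtrancl)
qed

lemma pars_commute:
  assumes "(par b f)\<^sup>*\<^sup>* M A" "(par b' f')\<^sup>*\<^sup>* M B"
  shows "\<exists>C. (par b' f')\<^sup>*\<^sup>* A C \<and> (par b f)\<^sup>*\<^sup>* B C"
  using assms(2)
proof induction
  case base then show ?case using assms(1) by blast
next
  case (step Y Z)
  then obtain C where C: "(par b' f')\<^sup>*\<^sup>* A C" "(par b f)\<^sup>*\<^sup>* Y C" by blast
  from par_pars_commute[OF C(2) step.hyps(2)] C(1) show ?case
    by (meson rtranclp.rtrancl_into_rtrancl)
qed

lemma steps_confluent: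
  "steps b f M A \<Longrightarrow> steps b f M B \<Longrightarrow> \<exists>C. steps b f A C \<and> steps b f B C"
  unfolding steps_eq_pars by (rule pars_commute)

text \<open>Induction along the zigzag: a forward step is absorbed by confluence, a backward step is
  prefixed to the reduction already found.\<close>

lemma church_rosser:
  assumes "fixbeta_eq M N"
  shows "\<exists>Z. reds M Z \<and> reds N Z"
  using assms unfolding fixbeta_eq_def red_def[symmetric]
proof (induction rule: equivclp_induct)
  case base then show ?case by blast
next
  case (step Y Z)
  then obtain C where C: "reds M C" "reds Y C" by blast
  from step(2) show ?case
  proof
    assume "red Y Z"
    then obtain D where "reds C D" "reds Z D"
      using steps_confluent[OF C(2), of Z] by blast
    then show ?thesis using C(1) by (meson rtranclp_trans)
  next
    assume "red Z Y"
    then show ?thesis using C by (meson converse_rtranclp_into_rtranclp)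
  qed
qed

subsection \<open>Convertibility\<close>

lemma conv_refl [simp]: "fixbeta_eq M M"
  and conv_sym: "fixbeta_eq M N \<Longrightarrow> fixbeta_eq N M"
  and conv_trans [trans]: "fixbeta_eq M N \<Longrightarrow> fixbeta_eq N K \<Longrightarrow> fixbeta_eq M K"
  unfolding fixbeta_eq_def by (auto intro: equivclp_sym equivclp_trans)

lemma red_conv: "reds M N \<Longrightarrow> fixbeta_eq M N"
  unfolding fixbeta_eq_def red_def[symmetric]
  by (rule rtranlcp_le_equivclp[THEN predicate2D])

lemma beta_red: "betas M N \<Longrightarrow> reds M N"
  by (rule rtranclp_mono[THEN predicate2D, rotated]) (auto simp: step_def)

lemma beta_conv: "betas M N \<Longrightarrow> fixbeta_eq M N"
  by (intro red_conv beta_red)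

lemma beta_nf_conv: "beta_nf M N \<Longrightarrow> fixbeta_eq M N"
  by (simp add: beta_nf_def beta_conv)

lemma conv_joinI: "reds M Z \<Longrightarrow> reds N Z \<Longrightarrow> fixbeta_eq M N"
  by (blast intro: conv_trans conv_sym red_conv)

lemma steps_subst: "steps b f M N \<Longrightarrow> steps b f (subst \<sigma> M) (subst \<sigma> N)"
  unfolding steps_eq_pars by (erule rtranclp_map[rotated]) (simp add: par_subst)

lemma conv_subst: "fixbeta_eq M N \<Longrightarrow> fixbeta_eq (subst \<sigma> M) (subst \<sigma> N)"
  by (blast dest: church_rosser intro: steps_subst conv_joinI)

lemma steps_apps:
  "steps b f h h' \<Longrightarrow> list_all2 (steps b f) Ms Ms' \<Longrightarrow>
    steps b f (apps h Ms) (apps h' Ms')"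
  by (rotate_tac, induction arbitrary: h h' rule: list_all2_induct) (auto intro: steps_App)

lemma par_rigid_apps:
  assumes "rigid_head h" "par b f (apps h Ms) N"
  shows "\<exists>Ns. N = apps h Ns \<and> list_all2 (par b f) Ms Ns"
  using assms(2)
proof (induction Ms arbitrary: N rule: rev_induct)
  case Nil
  then show ?case using assms(1)
    by (auto simp: rigid_head_def elim: par_VarE par_ConE par_LogE intro: exI[of _ "[]"])
next
  case (snoc M Ms)
  have "apps h Ms \<noteq> Lam \<tau> K" for \<tau> K
    using assms(1) by (metis head_apps head.simps(5) rigid_head_head rigid_head_simps(5))
  with snoc.prems obtain K M' where K: "N = App K M'" "par b f (apps h Ms) K" "par b f M M'"
    by (auto elim!: par_AppE)
  with snoc.IH obtain Ns where "K = apps h Ns" "list_all2 (par b f) Ms Ns" by blast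
  with K show ?case by (intro exI[of _ "Ns @ [M']"]) (auto intro: list_all2_appendI)
qed

lemma steps_rigid_apps:
  assumes "rigid_head h" "steps b f (apps h Ms) N"
  shows "\<exists>Ns. N = apps h Ns \<and> list_all2 (steps b f) Ms Ns"
  using assms(2) unfolding steps_eq_pars
proof induction
  case base then show ?case by (auto intro: list_all2_refl)
next
  case (step Y Z)
  then obtain Ns where Ns: "Y = apps h Ns" "list_all2 (par b f)\<^sup>*\<^sup>* Ms Ns" by blast
  with step.hyps(2) par_rigid_apps[OF assms(1)] obtain Zs
    where Zs: "Z = apps h Zs" "list_all2 (par b f) Ns Zs" by blast
  have "list_all2 (par b f)\<^sup>*\<^sup>* Ms Zs"
    using Ns(2) Zs(2) by (rule list_all2_trans[rotated]) auto
  with Zs show ?case by blast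
qed

text \<open>A common reduct keeps both heads and is reached argument by argument, since a rigid head
  never turns into an abstraction. This makes tree labels independent of the chosen head normal
  form.\<close>

lemma conv_rigid_apps:
  assumes "fixbeta_eq (apps h Ms) (apps h' Ms')" "rigid_head h" "rigid_head h'"
  shows "h = h' \<and> list_all2 fixbeta_eq Ms Ms'"
proof -
  obtain Z where Z: "reds (apps h Ms) Z" "reds (apps h' Ms') Z"
    using church_rosser[OF assms(1)] by blast
  obtain Zs where Zs: "Z = apps h Zs" "list_all2 reds Ms Zs"
    using steps_rigid_apps[OF assms(2) Z(1)] by blast
  obtain Zs' where Zs': "Z = apps h' Zs'" "list_all2 reds Ms' Zs'"
    using steps_rigid_apps[OF assms(3) Z(2)] by blast
  have eq: "h = h'" "Zs = Zs'" using apps_rigid_inject Zs(1) Zs'(1) assms by metis+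
  have "list_all2 fixbeta_eq Ms Ms'"
    unfolding list_all2_conv_all_nth
    using Zs(2) Zs'(2) eq by (auto simp: list_all2_conv_all_nth) (meson conv_trans red_conv conv_sym)
  with eq show ?thesis by simp
qed

subsection \<open>Beta normal forms\<close>

lemma beta_nf_unique_red:
  assumes "betas M A" "beta_nf M R"
  shows "beta_nf A R"
proof -
  obtain C where C: "betas A C" "betas R C"
    using steps_confluent[of True False M A R] assms by (auto simp: step_beta beta_nf_def)
  have "C = R" using C(2) assms(2)
    by (metis beta_nf_def beta_normal_def converse_rtranclpE)
  with C assms(2) show ?thesis by (simp add: beta_nf_def)
qed

lemma beta_nf_trans: "betas M A \<Longrightarrow> beta_nf A R \<Longrightarrow> beta_nf M R"
  by (auto simp: beta_nf_def)

lemma beta_nf_unique: "beta_nf M R \<Longrightarrow> beta_nf M R' \<Longrightarrow> R = R'"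
  by (metis beta_nf_def beta_nf_unique_red beta_normal_def converse_rtranclpE)

lemma beta_nf_normal: "beta_normal M \<Longrightarrow> beta_nf M M"
  by (simp add: beta_nf_def)

subsection \<open>Typing\<close>

lemma typeof_AppE:
  assumes "typeof \<Sigma> \<Gamma> (App M N) = Some \<tau>"
  obtains \<sigma> where "typeof \<Sigma> \<Gamma> M = Some (\<sigma> \<rightarrow> \<tau>)" "typeof \<Sigma> \<Gamma> N = Some \<sigma>"
  using assms by (auto split: option.splits ty.splits if_splits)

lemma typeof_AppI:
  "typeof \<Sigma> \<Gamma> M = Some (\<sigma> \<rightarrow> \<tau>) \<Longrightarrow> typeof \<Sigma> \<Gamma> N = Some \<sigma> \<Longrightarrow> typeof \<Sigma> \<Gamma> (App M N) = Some \<tau>"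
  by simp

lemma typeof_fv: "typeof \<Sigma> \<Gamma> M = Some \<tau> \<Longrightarrow> fv M \<subseteq> {..<length \<Gamma>}"
proof (induction M arbitrary: \<Gamma> \<tau>)
  case (App M N)
  then show ?case by (auto elim!: typeof_AppE simp del: typeof.simps dest!: App.IH)
next
  case (Lam \<sigma> M)
  then show ?case by fastforce
next
  case (Fix \<sigma> M)
  then have "fv M \<subseteq> {..<length (\<sigma> # \<Gamma>)}" by (metis option.simps(3) typeof.simps(6))
  then show ?case by auto
qed (auto split: if_splits)

lemma typeof_ren:
  "typeof \<Sigma> \<Gamma> M = Some \<tau> \<Longrightarrow> (\<And>n. n < length \<Gamma> \<Longrightarrow> f n < length \<Delta> \<and> \<Delta> ! f n = \<Gamma> ! n) \<Longrightarrow>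
    typeof \<Sigma> \<Delta> (ren f M) = Some \<tau>"
proof (induction M arbitrary: \<Gamma> \<Delta> \<tau> f)
  case (App M N)
  from App.prems(1) obtain \<sigma>
    where "typeof \<Sigma> \<Gamma> M = Some (\<sigma> \<rightarrow> \<tau>)" "typeof \<Sigma> \<Gamma> N = Some \<sigma>" by (rule typeof_AppE)
  with App show ?case by (auto intro!: typeof_AppI simp del: typeof.simps)
next
  case (Lam \<sigma> M)
  have "upr f n < length (\<sigma> # \<Delta>) \<and> (\<sigma> # \<Delta>) ! upr f n = (\<sigma> # \<Gamma>) ! n" if "n < length (\<sigma> # \<Gamma>)" for n
    using that Lam.prems(2) by (cases n) auto
  with Lam show ?case by fastforce
next
  case (Fix \<sigma> M)
  have "upr f n < length (\<sigma> # \<Delta>) \<and> (\<sigma> # \<Delta>) ! upr f n = (\<sigma> # \<Gamma>) ! n" if "n < length (\<sigma> # \<Gamma>)" for n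
    using that Fix.prems(2) by (cases n) auto
  with Fix show ?case by (fastforce split: if_splits)
qed (auto split: if_splits)

lemma typeof_subst:
  "typeof \<Sigma> \<Gamma> M = Some \<tau> \<Longrightarrow> (\<And>n. n < length \<Gamma> \<Longrightarrow> typeof \<Sigma> \<Delta> (\<sigma> n) = Some (\<Gamma> ! n)) \<Longrightarrow>
    typeof \<Sigma> \<Delta> (subst \<sigma> M) = Some \<tau>"
proof (induction M arbitrary: \<Gamma> \<Delta> \<tau> \<sigma>)
  case (App M N)
  from App.prems(1) obtain \<rho>
    where "typeof \<Sigma> \<Gamma> M = Some (\<rho> \<rightarrow> \<tau>)" "typeof \<Sigma> \<Gamma> N = Some \<rho>" by (rule typeof_AppE)
  with App show ?case by (auto intro!: typeof_AppI simp del: typeof.simps)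
next
  case (Lam \<rho> M)
  have "typeof \<Sigma> (\<rho> # \<Delta>) (ups \<sigma> n) = Some ((\<rho> # \<Gamma>) ! n)" if "n < length (\<rho> # \<Gamma>)" for n
    using that Lam.prems(2) by (cases n) (auto intro!: typeof_ren)
  with Lam show ?case by fastforce
next
  case (Fix \<rho> M)
  have "typeof \<Sigma> (\<rho> # \<Delta>) (ups \<sigma> n) = Some ((\<rho> # \<Gamma>) ! n)" if "n < length (\<rho> # \<Gamma>)" for n
    using that Fix.prems(2) by (cases n) (auto intro!: typeof_ren)
  with Fix show ?case by (fastforce split: if_splits)
qed (auto split: if_splits)

lemma typeof_inst:
  assumes "typeof \<Sigma> (\<sigma> # \<Gamma>) M = Some \<tau>" "typeof \<Sigma> \<Gamma> N = Some \<sigma>"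
  shows "typeof \<Sigma> \<Gamma> (inst M N) = Some \<tau>"
  unfolding inst_def
proof (rule typeof_subst[OF assms(1)])
  fix n assume "n < length (\<sigma> # \<Gamma>)"
  then show "typeof \<Sigma> \<Gamma> (case_nat N Var n) = Some ((\<sigma> # \<Gamma>) ! n)" using assms(2) by (cases n) auto
qed

lemma beta_typeof: "beta M N \<Longrightarrow> typeof \<Sigma> \<Gamma> M = Some \<tau> \<Longrightarrow> typeof \<Sigma> \<Gamma> N = Some \<tau>"
proof (induction arbitrary: \<Gamma> \<tau> rule: beta.induct)
  case (1 \<rho> M N)
  then show ?case by (auto elim!: typeof_AppE intro: typeof_inst simp del: typeof.simps(4))
next
  case (2 M M' N)
  then show ?case by (auto elim!: typeof_AppE intro!: typeof_AppI simp del: typeof.simps(4))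
next
  case (3 N N' M)
  then show ?case by (auto elim!: typeof_AppE intro!: typeof_AppI simp del: typeof.simps(4))
qed (auto split: if_splits)

lemma fix_at_typeof: "fix_at p M N \<Longrightarrow> typeof \<Sigma> \<Gamma> M = Some \<tau> \<Longrightarrow> typeof \<Sigma> \<Gamma> N = Some \<tau>"
proof (induction arbitrary: \<Gamma> \<tau> rule: fix_at.induct)
  case (1 \<rho> M)
  then show ?case by (auto intro: typeof_inst split: if_splits)
next
  case (2 p M M' N)
  then show ?case by (auto elim!: typeof_AppE intro!: typeof_AppI simp del: typeof.simps(4))
next
  case (3 p N N' M)
  then show ?case by (auto elim!: typeof_AppE intro!: typeof_AppI simp del: typeof.simps(4))
qed (auto split: if_splits)

lemma betas_typeof: "betas M N \<Longrightarrow> typeof \<Sigma> \<Gamma> M = Some \<tau> \<Longrightarrow> typeof \<Sigma> \<Gamma> N = Some \<tau>"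
  by (induction rule: rtranclp_induct) (auto intro: beta_typeof)

lemma typeof_apps:
  "typeof \<Sigma> \<Gamma> (apps h Ms) = Some \<tau> \<longleftrightarrow>
    (\<exists>ts. typeof \<Sigma> \<Gamma> h = Some (foldr (\<rightarrow>) ts \<tau>) \<and>
      list_all2 (\<lambda>M \<sigma>. typeof \<Sigma> \<Gamma> M = Some \<sigma>) Ms ts)"
proof (induction Ms arbitrary: h)
  case (Cons M Ms)
  show ?case
    unfolding apps_Cons Cons.IH
    by (auto simp: list_all2_Cons1 simp del: typeof.simps elim!: typeof_AppE intro!: typeof_AppI)
      (metis foldr_Cons comp_apply)
qed auto

subsection \<open>Strong normalisation of beta reduction\<close>

abbreviation SN :: "'c tm \<Rightarrow> bool" where
  "SN \<equiv> Wellfounded.accp (\<lambda>N M. beta M N)"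

text \<open>Tait's reducibility predicate on untyped open terms. Variables are reducible at every
  type, so neither contexts nor matching binder annotations have to be tracked.\<close>

primrec RED :: "ty \<Rightarrow> 'c tm \<Rightarrow> bool" where
  "RED Iota M = SN M"
| "RED Omicron M = SN M"
| "RED (TVar a) M = SN M"
| "RED (\<sigma> \<rightarrow> \<tau>) M = (\<forall>N. RED \<sigma> N \<longrightarrow> RED \<tau> (App M N))"

text \<open>Girard's neutral terms: applying one creates no \<beta>-redex at the root. A fixed point
  is neutral because it acts as a constant for \<beta>.\<close>

definition neutral :: "'c tm \<Rightarrow> bool" where
  "neutral M \<longleftrightarrow> (\<nexists>\<tau> K. M = Lam \<tau> K)"

lemma neutral_simps [simp]:
  "neutral (Var n)" "neutral (Con c)" "neutral (Log k)" "neutral (App M N)" "neutral (Fix \<tau> M)"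
  "\<not> neutral (Lam \<tau> M)"
  by (auto simp: neutral_def)

inductive_cases beta_VarE [elim!]: "beta (Var n) N"
inductive_cases beta_ConE [elim!]: "beta (Con c) N"
inductive_cases beta_LogE [elim!]: "beta (Log k) N"
inductive_cases beta_LamE [elim!]: "beta (Lam \<tau> M) N"
inductive_cases beta_FixE [elim!]: "beta (Fix \<tau> M) N"

lemma beta_AppE:
  assumes "beta (App M N) K"
  obtains (contract) \<tau> M' where "M = Lam \<tau> M'" "K = inst M' N"
  | (left) M' where "beta M M'" "K = App M' N"
  | (right) N' where "beta N N'" "K = App M N'"
  using assms by (cases rule: beta.cases) auto

text \<open>An infinite reduction from \<open>M\<close> would be mapped to one from
  \<open>g M\<close>. Used to strip applications and instantiations.\<close>

lemma SN_map:
  assumes "\<And>M N. beta M N \<Longrightarrow> beta (g M) (g N)" "SN (g M)"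
  shows "SN M"
proof -
  have "\<forall>M. K = g M \<longrightarrow> SN M" if "SN K" for K
    using that by (induction rule: accp.induct) (blast intro: accp.intros assms(1))
  with assms(2) show ?thesis by blast
qed

lemma beta_subst: "beta M N \<Longrightarrow> beta (subst \<sigma> M) (subst \<sigma> N)"
proof (induction arbitrary: \<sigma> rule: beta.induct)
  case (1 \<tau> M N)
  show ?case by (simp add: subst_inst beta.intros)
qed (auto intro: beta.intros)

text \<open>The three conditions need each other in the induction on the type. At an arrow type,
  strong normalisation comes from applying the term to a variable, which is reducible by the third
  condition at the argument type; the third condition in turn inducts on the strong normalisation of
  the argument.\<close>

lemma RED_properties:
  "(RED \<tau> M \<longrightarrow> SN M) \<and> (RED \<tau> M \<longrightarrow> beta M N \<longrightarrow> RED \<tau> N) \<and>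
   (neutral M \<longrightarrow> (\<forall>N. beta M N \<longrightarrow> RED \<tau> N) \<longrightarrow> RED \<tau> M)"
proof (induction \<tau> arbitrary: M N)
  case (Arr \<sigma> \<tau>)
  have var: "RED \<sigma> (Var 0 :: 'a tm)" using Arr(1)[of "Var 0"] neutral_simps(1) by blast
  have 1: "SN M" if "RED (\<sigma> \<rightarrow> \<tau>) M" for M :: "'a tm"
  proof -
    have "SN (App M (Var 0))" using that var Arr(2) by auto
    then show ?thesis by (rule SN_map[rotated]) (rule beta.intros)
  qed
  have 3: "RED (\<sigma> \<rightarrow> \<tau>) M" if M: "neutral M" "\<forall>N. beta M N \<longrightarrow> RED (\<sigma> \<rightarrow> \<tau>) N" for M :: "'a tm"
  proof -
    have "RED \<tau> (App M N)" if "RED \<sigma> N" for N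
    proof -
      have "SN N" using that Arr(1) by blast
      then show ?thesis using that
      proof (induction rule: accp.induct)
        case (accI N)
        have "RED \<tau> K" if "beta (App M N) K" for K
          using that
        proof (cases rule: beta_AppE)
          case (right N')
          then show ?thesis using accI Arr(1) by blast
        qed (use M accI in auto)
        then show ?case using Arr(2)[of "App M N"] neutral_simps(4) by blast
      qed
    qed
    then show ?thesis by simp
  qed
  have 2: "RED (\<sigma> \<rightarrow> \<tau>) N" if "RED (\<sigma> \<rightarrow> \<tau>) M" "beta M N" for M N :: "'a tm"
    using that Arr(2) by (auto intro: beta.intros)
  show ?case using 1 2 3 by blast
qed (auto intro: accp.intros dest: accp_downward)

lemmas RED_SN = RED_properties[THEN conjunct1, rule_format]
  and RED_beta = RED_properties[THEN conjunct2, THEN conjunct1, rule_format]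
  and RED_neutral = RED_properties[THEN conjunct2, THEN conjunct2, rule_format]

lemma RED_Var: "RED \<tau> (Var n)"
  by (rule RED_neutral) auto

lemma SN_inst: "SN (inst M N) \<Longrightarrow> SN M"
  by (erule SN_map[rotated]) (simp add: inst_def beta_subst)

lemma betas_inst: "betas N N' \<Longrightarrow> betas (inst M N) (inst M N')"
proof (induction rule: rtranclp_induct)
  case (step Y Z)
  have "par True False (inst M Y) (inst M Z)" using step(2) by (intro par_inst beta_par par_refl)
  then have "betas (inst M Y) (inst M Z)" using par_steps[of True False] by (simp add: step_beta)
  with step show ?case by auto
qed auto

text \<open>The application is neutral, so only its one-step reducts matter. Nested inductions on
  the strong normalisation of \<open>M\<close> and of \<open>N\<close> handle reductions inside
  either part; the premise handles the contraction itself.\<close>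

lemma RED_App_Lam:
  assumes "SN M" "\<And>N. RED \<sigma> N \<Longrightarrow> RED \<tau> (inst M N)" "RED \<sigma> N"
  shows "RED \<tau> (App (Lam \<rho> M) N)"
  using assms
proof (induction arbitrary: N rule: accp.induct)
  case (accI M)
  note outer_prems = accI.prems and outer_IH = accI.IH
  have "SN N" using accI.prems(2) by (rule RED_SN)
  then show ?case using accI.prems(2)
  proof (induction rule: accp.induct)
    case (accI N)
    show ?case
    proof (rule RED_neutral)
      fix K assume "beta (App (Lam \<rho> M) N) K"
      then show "RED \<tau> K"
      proof (cases rule: beta_AppE)
        case (contract \<tau>' M1)
        then show ?thesis using outer_prems(1) accI.prems by auto
      next
        case (left L)
        then obtain M' where M': "L = Lam \<rho> M'" "beta M M'" by auto
        have "RED \<tau> (inst M' N)" if "RED \<sigma> N" for N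
          using outer_prems(1)[OF that] M'(2) by (auto intro: RED_beta simp: inst_def beta_subst)
        then show ?thesis using left M' outer_IH accI.prems by blast
      next
        case (right N')
        then show ?thesis using accI RED_beta by blast
      qed
    qed simp
  qed
qed

lemma RED_Lam:
  assumes "\<And>N. RED \<sigma> N \<Longrightarrow> RED \<tau> (inst M N)"
  shows "RED (\<sigma> \<rightarrow> \<tau>) (Lam \<rho> M)"
  using RED_App_Lam[OF SN_inst[OF RED_SN[OF assms[OF RED_Var]]] assms] by simp

text \<open>A fixed point is neutral and its \<beta>-reducts all come from its body, so the third
  reducibility condition gives membership at any type without an induction on types.\<close>

lemma SN_Fix: "SN M \<Longrightarrow> RED \<tau> (Fix \<rho> M)"
proof (induction rule: accp.induct)
  case (accI M)
  show ?case by (rule RED_neutral) (use accI in auto)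
qed

lemma RED_subst:
  "typeof \<Sigma> \<Gamma> M = Some \<tau> \<Longrightarrow> (\<And>n. n < length \<Gamma> \<Longrightarrow> RED (\<Gamma> ! n) (\<sigma> n)) \<Longrightarrow> RED \<tau> (subst \<sigma> M)"
proof (induction M arbitrary: \<Gamma> \<tau> \<sigma>)
  case (App M N)
  from App.prems(1) obtain \<rho>
    where "typeof \<Sigma> \<Gamma> M = Some (\<rho> \<rightarrow> \<tau>)" "typeof \<Sigma> \<Gamma> N = Some \<rho>" by (rule typeof_AppE)
  then have "RED (\<rho> \<rightarrow> \<tau>) (subst \<sigma> M)" "RED \<rho> (subst \<sigma> N)" using App.IH App.prems(2) by blast+
  then show ?case by simp
next
  case (Lam \<rho> M)
  then obtain \<tau>' where t: "\<tau> = \<rho> \<rightarrow> \<tau>'" "typeof \<Sigma> (\<rho> # \<Gamma>) M = Some \<tau>'" by auto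
  have "RED \<tau>' (inst (subst (ups \<sigma>) M) N)" if "RED \<rho> N" for N
    unfolding inst_subst_ups
  proof (rule Lam.IH[OF t(2)])
    fix n assume "n < length (\<rho> # \<Gamma>)"
    then show "RED ((\<rho> # \<Gamma>) ! n) (case_nat N \<sigma> n)" using that Lam.prems by (cases n) auto
  qed
  then show ?case unfolding t subst.simps by (rule RED_Lam)
next
  case (Fix \<rho> M)
  then have t: "typeof \<Sigma> (\<rho> # \<Gamma>) M = Some \<rho>" "\<tau> = \<rho>" by (auto split: if_splits)
  \<comment> \<open>By \<open>SN_Fix\<close> strong normalisation of the body is enough, so a plain
    variable can stand for the recursive call.\<close>
  have "RED \<rho> (inst (subst (ups \<sigma>) M) (Var 0))"
    unfolding inst_subst_ups
  proof (rule Fix.IH[OF t(1)])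
    fix n assume "n < length (\<rho> # \<Gamma>)"
    then show "RED ((\<rho> # \<Gamma>) ! n) (case_nat (Var 0) \<sigma> n)"
      using RED_Var Fix.prems by (cases n) auto
  qed
  then show ?case unfolding subst.simps by (intro SN_Fix SN_inst[OF RED_SN])
qed (auto intro: RED_neutral split: if_splits)

theorem typed_SN: "typeof \<Sigma> \<Gamma> M = Some \<tau> \<Longrightarrow> SN M"
  using RED_subst[of \<Sigma> \<Gamma> M \<tau> Var] RED_Var RED_SN by fastforce

lemma SN_beta_nf: "SN M \<Longrightarrow> \<exists>N. beta_nf M N"
proof (induction rule: accp.induct)
  case (accI M)
  show ?case
  proof (cases "beta_normal M")
    case True
    then show ?thesis using beta_nf_normal by blast
  next
    case False
    then obtain N where "beta M N" by (auto simp: beta_normal_def)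
    then show ?thesis using accI(2)[of N] by (meson beta_nf_trans r_into_rtranclp)
  qed
qed

lemma typed_beta_nf: "typeof \<Sigma> \<Gamma> M = Some \<tau> \<Longrightarrow> \<exists>N. beta_nf M N"
  by (intro SN_beta_nf typed_SN)

subsection \<open>Unfolding runs\<close>

text \<open>One step of a run with its position forgotten. Because of the full normalisation it is
  not closed under arbitrary contexts.\<close>

definition rstep :: "'c tm \<Rightarrow> 'c tm \<Rightarrow> bool" where
  "rstep M N \<longleftrightarrow> (\<exists>p K. fix_at p M K \<and> beta_nf K N)"

abbreviation rsteps :: "'c tm \<Rightarrow> 'c tm \<Rightarrow> bool" where
  "rsteps \<equiv> rstep\<^sup>*\<^sup>*"

lemma beta_normal_simps [simp]:
  "beta_normal (Var n)" "beta_normal (Con c)" "beta_normal (Log k)"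
  "beta_normal (Lam \<tau> M) \<longleftrightarrow> beta_normal M" "beta_normal (Fix \<tau> M) \<longleftrightarrow> beta_normal M"
  "beta_normal (App M N) \<longleftrightarrow> neutral M \<and> beta_normal M \<and> beta_normal N"
  by (auto simp: beta_normal_def neutral_def intro: beta.intros elim!: beta_AppE)

lemma beta_normal_apps:
  "beta_normal (apps h Ms) \<longleftrightarrow> beta_normal h \<and> (Ms \<noteq> [] \<longrightarrow> neutral h) \<and> (\<forall>M\<in>set Ms. beta_normal M)"
  by (induction Ms arbitrary: h) auto

lemmas betas_App = steps_App[of True False, unfolded step_beta]
  and betas_apps = steps_apps[of True False, unfolded step_beta]
  and betas_Lam = steps_Lam[of True False, unfolded step_beta]
  and betas_Fix = steps_Fix[of True False, unfolded step_beta]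

lemma betas_apps_head: "betas h h' \<Longrightarrow> betas (apps h Ms) (apps h' Ms)"
  by (auto intro: betas_apps list_all2_refl)

lemma fix_at_apps_head: "fix_at p h h' \<Longrightarrow> fix_at (replicate (length Ms) 0 @ p) (apps h Ms) (apps h' Ms)"
proof (induction Ms rule: rev_induct)
  case (snoc M Ms)
  then show ?case using fix_at.intros(2) by auto
qed auto

lemma rstep_normal: "rstep M N \<Longrightarrow> beta_normal N"
  by (auto simp: rstep_def beta_nf_def)

lemma rsteps_normal: "rsteps M N \<Longrightarrow> beta_normal M \<Longrightarrow> beta_normal N"
  by (induction rule: rtranclp_induct) (auto intro: rstep_normal)

lemma rstep_typeof: "rstep M N \<Longrightarrow> typeof \<Sigma> \<Gamma> M = Some \<tau> \<Longrightarrow> typeof \<Sigma> \<Gamma> N = Some \<tau>"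
  by (auto simp: rstep_def beta_nf_def intro: fix_at_typeof betas_typeof)

lemma rsteps_typeof: "rsteps M N \<Longrightarrow> typeof \<Sigma> \<Gamma> M = Some \<tau> \<Longrightarrow> typeof \<Sigma> \<Gamma> N = Some \<tau>"
  by (induction rule: rtranclp_induct) (auto intro: rstep_typeof)

text \<open>The context must keep normal terms normal, for then normalising the hole normalises the
  whole term.\<close>

lemma rsteps_context:
  assumes "rsteps M N" "beta_normal M"
    and "\<And>p X Y. fix_at p X Y \<Longrightarrow> \<exists>q. fix_at q (C X) (C Y)"
    and "\<And>X Y. betas X Y \<Longrightarrow> betas (C X) (C Y)"
    and "\<And>X. beta_normal X \<Longrightarrow> beta_normal (C X)"
  shows "rsteps (C M) (C N)"
  using assms(1)
proof induction
  case (step Y Z)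
  obtain p K where K: "fix_at p Y K" "beta_nf K Z" using step(2) by (auto simp: rstep_def)
  then have "beta_nf (C K) (C Z)" using assms(4,5) by (auto simp: beta_nf_def)
  then have "rstep (C Y) (C Z)" using assms(3)[OF K(1)] unfolding rstep_def by blast
  with step.IH show ?case by simp
qed auto

text \<open>Redexes are contracted inside out, arguments before heads: then the interleaved
  \<open>\<beta>\<close>-normalisations duplicate no redex that is still to be contracted.\<close>

lemma development_rsteps_apps:
  "par False True M Q \<Longrightarrow> beta_normal (apps M Ms) \<Longrightarrow> typeof \<Sigma> \<Gamma> (apps M Ms) = Some \<tau> \<Longrightarrow>
    \<exists>R. rsteps (apps M Ms) R \<and> beta_nf (apps Q Ms) R"
proof (induction M arbitrary: Q Ms \<Gamma> \<tau>)
  case (App M N)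
  from App.prems(1) obtain M' N' where Q: "Q = App M' N'" "par False True M M'" "par False True N N'"
    by (auto elim: par_AppE)
  from App.prems(3) obtain \<tau>M \<tau>N where t: "typeof \<Sigma> \<Gamma> M = Some (\<tau>N \<rightarrow> \<tau>M)" "typeof \<Sigma> \<Gamma> N = Some \<tau>N"
    unfolding typeof_apps by (auto elim!: typeof_AppE simp del: typeof.simps)
  have "beta_normal N" using App.prems(2) by (simp add: beta_normal_apps)
  then obtain R where R: "rsteps N R" "beta_nf N' R"
    using App.IH(2)[OF Q(3), of "[]" \<Gamma> \<tau>N] t by auto
  have 1: "rsteps (apps (App M N) Ms) (apps (App M R) Ms)"
    by (rule rsteps_context[OF R(1) \<open>beta_normal N\<close>, of "\<lambda>X. apps (App M X) Ms"])
      (use App.prems(2) in \<open>auto simp: beta_normal_apps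
        intro: fix_at_apps_head fix_at.intros betas_apps_head betas_App\<close>)
  \<comment> \<open>The unfolded argument joins the spine. This is why the statement carries
    \<open>Ms\<close>: once the head is contracted, normalisation lets it consume these
    arguments.\<close>
  obtain R' where R': "rsteps (apps M (R # Ms)) R'" "beta_nf (apps M' (R # Ms)) R'"
    using App.IH(1)[OF Q(2), of "R # Ms" \<Gamma> \<tau>] rsteps_normal[OF 1 App.prems(2)]
      rsteps_typeof[OF 1 App.prems(3)] by auto
  have "betas (apps (App M' N') Ms) (apps (App M' R) Ms)"
    using R(2) by (auto simp: beta_nf_def intro: betas_apps_head betas_App)
  with R' 1 Q(1) show ?case by (metis apps_Cons beta_nf_trans rtranclp_trans)
next
  case (Lam \<sigma> M)
  then have [simp]: "Ms = []" by (auto simp: beta_normal_apps)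
  from Lam.prems(1) obtain M' where Q: "Q = Lam \<sigma> M'" "par False True M M'" by (auto elim: par_LamE)
  obtain R where R: "rsteps M R" "beta_nf M' R"
    using Lam.IH[OF Q(2), of "[]" "\<sigma> # \<Gamma>"] Lam.prems by auto
  have "rsteps (Lam \<sigma> M) (Lam \<sigma> R)"
    by (rule rsteps_context[OF R(1)]) (use Lam.prems(2) in \<open>auto intro: fix_at.intros betas_Lam\<close>)
  moreover have "beta_nf (Lam \<sigma> M') (Lam \<sigma> R)" using R(2) by (auto simp: beta_nf_def betas_Lam)
  ultimately show ?case using Q by auto
next
  case (Fix \<sigma> M)
  from Fix.prems(1) obtain M' where Q: "par False True M M'" "Q = Fix \<sigma> M' \<or> Q = inst M' (Fix \<sigma> M')"
    by (auto elim: par_FixE)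
  from Fix.prems(3) have t: "typeof \<Sigma> (\<sigma> # \<Gamma>) M = Some \<sigma>"
    unfolding typeof_apps by (auto split: if_splits)
  obtain R where R: "rsteps M R" "beta_nf M' R"
    using Fix.IH[OF Q(1), of "[]" "\<sigma> # \<Gamma>"] t Fix.prems(2) by (auto simp: beta_normal_apps)
  have 1: "rsteps (apps (Fix \<sigma> M) Ms) (apps (Fix \<sigma> R) Ms)"
    by (rule rsteps_context[OF R(1), of "\<lambda>X. apps (Fix \<sigma> X) Ms"])
      (use Fix.prems(2) in \<open>auto simp: beta_normal_apps
        intro: fix_at_apps_head fix_at.intros betas_apps_head betas_Fix\<close>)
  from Q(2) show ?case
  proof
    assume "Q = Fix \<sigma> M'"
    then have "beta_nf (apps Q Ms) (apps (Fix \<sigma> R) Ms)"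
      using R(2) rsteps_normal[OF 1 Fix.prems(2)]
      by (auto simp: beta_nf_def intro: betas_apps_head betas_Fix)
    with 1 show ?thesis by blast
  next
    assume Q: "Q = inst M' (Fix \<sigma> M')"
    have f: "fix_at (replicate (length Ms) 0 @ []) (apps (Fix \<sigma> R) Ms) (apps (inst R (Fix \<sigma> R)) Ms)"
      by (intro fix_at_apps_head fix_at.intros)
    have "typeof \<Sigma> \<Gamma> (apps (inst R (Fix \<sigma> R)) Ms) = Some \<tau>"
      by (rule fix_at_typeof[OF f]) (rule rsteps_typeof[OF 1 Fix.prems(3)])
    then obtain S where S: "beta_nf (apps (inst R (Fix \<sigma> R)) Ms) S" using typed_beta_nf by blast
    have "rstep (apps (Fix \<sigma> R) Ms) S" using f S unfolding rstep_def by blast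
    \<comment> \<open>\<open>Q\<close> contracts the fixed point with body \<open>M'\<close>, the
      run contracts the one with the normal form \<open>R\<close> of \<open>M'\<close>; reducing
      every copy of \<open>M'\<close> in \<open>Q\<close> leads from the first contractum to the
      second.\<close>
    moreover have "beta_nf (apps Q Ms) S"
    proof (rule beta_nf_trans[OF _ S])
      have "betas M' R" using R(2) by (simp add: beta_nf_def)
      then have "betas (inst M' (Fix \<sigma> M')) (inst R (Fix \<sigma> M'))"
        unfolding inst_def by (rule rtranclp_map[rotated]) (rule beta_subst)
      moreover have "betas (inst R (Fix \<sigma> M')) (inst R (Fix \<sigma> R))"
        using \<open>betas M' R\<close> by (intro betas_inst betas_Fix)
      ultimately show "betas (apps Q Ms) (apps (inst R (Fix \<sigma> R)) Ms)"
        unfolding Q by (auto intro: betas_apps_head)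
    qed
    ultimately show ?thesis using 1 by (meson rtranclp.rtrancl_into_rtrancl)
  qed
qed (auto elim!: par_VarE par_ConE par_LogE intro: beta_nf_normal)

text \<open>Invariant: the run has reached the \<beta>-normal form \<open>R\<close> of the current
  term. A \<beta>-step leaves \<open>R\<close> as it is. A fixed-point step commutes with the
  normalisation into a parallel development of \<open>R\<close>, which
  \<open>development_rsteps_apps\<close> replays as a run.\<close>

lemma red_rsteps:
  assumes "reds M Z" "typeof \<Sigma> \<Gamma> M = Some \<tau>" "beta_normal M"
  shows "\<exists>R. rsteps M R \<and> beta_nf Z R"
  using assms(1)
proof induction
  case base
  then show ?case using assms(3) by (auto intro: beta_nf_normal)
next
  case (step Y Z)
  then obtain R where R: "rsteps M R" "beta_nf Y R" by blast
  from step(2) consider "beta Y Z" | "fix_step Y Z" by (auto simp: step_def)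
  then show ?case
  proof cases
    case 1
    then show ?thesis using R beta_nf_unique_red by blast
  next
    case 2
    \<comment> \<open>A single contraction is treated as a parallel one, since the reduction to
      \<open>R\<close> may copy or erase the redex.\<close>
    then have "par False True Y Z" by (auto simp: fix_step_def intro: fix_at_par)
    moreover have "(par True False)\<^sup>*\<^sup>* Y R"
      using R(2) by (simp add: beta_nf_def flip: steps_eq_pars step_beta)
    ultimately obtain Q where Q: "par False True R Q" "(par True False)\<^sup>*\<^sup>* Z Q"
      using par_pars_commute by blast
    have "beta_normal R" using R(2) by (simp add: beta_nf_def)
    then obtain S where "rsteps R S" "beta_nf Q S"
      using development_rsteps_apps[OF Q(1), of "[]"] rsteps_typeof[OF R(1) assms(2)] by force
    moreover have "betas Z Q" using Q(2) by (simp flip: steps_eq_pars step_beta)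
    ultimately show ?thesis using R(1) by (meson beta_nf_trans rtranclp_trans)
  qed
qed

subsection \<open>Trees of arbitrary terms\<close>

text \<open>The heads are those that have a label in a tree.\<close>

definition rhnf :: "'c tm \<Rightarrow> 'c tm \<Rightarrow> bool" where
  "rhnf M N \<longleftrightarrow> fixbeta_eq M N \<and> (\<exists>h Ms. N = apps h Ms \<and> ((\<exists>c. h = Con c) \<or> (\<exists>n. h = Var n)))"

definition some_rhnf :: "'c tm \<Rightarrow> 'c tm" where
  "some_rhnf M = (SOME N. rhnf M N)"

text \<open>The analogue of a Boehm tree, undefined at and below subterms that have no rigid head normal
  form.\<close>

primrec BT :: "'c tm \<Rightarrow> nat list \<Rightarrow> 'c label option" where
  "BT M [] = (if \<exists>N. rhnf M N then head_label (head (some_rhnf M)) else None)"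
| "BT M (i # w) =
     (if (\<exists>N. rhnf M N) \<and> i < length (args (some_rhnf M)) then BT (args (some_rhnf M) ! i) w else None)"

text \<open>Convertible terms have literally the same rigid head normal forms, so the choice
  operator returns the same one for both.\<close>

lemma BT_conv:
  assumes "fixbeta_eq M N"
  shows "BT M = BT N"
proof
  have *: "rhnf M = rhnf N" unfolding rhnf_def using assms by (blast intro: conv_trans conv_sym)
  show "BT M w = BT N w" for w
    by (cases w) (simp_all only: BT.simps some_rhnf_def *)
qed

text \<open>The chosen normal form may differ from \<open>apps h Ms\<close>, but only in its
  arguments, and these are pairwise convertible.\<close>

lemma BT_rigid:
  assumes "(\<exists>c. h = Con c) \<or> (\<exists>n. h = Var n)"
  shows "BT (apps h Ms) [] = head_label h"
    and "BT (apps h Ms) (i # w) = (if i < length Ms then BT (Ms ! i) w else None)"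
proof -
  have rigid: "rigid_head h" using assms by auto
  have ex: "rhnf (apps h Ms) (apps h Ms)" unfolding rhnf_def using assms by auto
  then have "rhnf (apps h Ms) (some_rhnf (apps h Ms))" unfolding some_rhnf_def by (rule someI)
  then obtain h' Ms' where N: "some_rhnf (apps h Ms) = apps h' Ms'" "rigid_head h'"
      "fixbeta_eq (apps h Ms) (apps h' Ms')"
    unfolding rhnf_def by auto
  then have eq: "h' = h" "list_all2 fixbeta_eq Ms Ms'" using conv_rigid_apps rigid by blast+
  then have len: "length Ms = length Ms'" by (simp add: list_all2_lengthD)
  have BT_nth: "BT (Ms ! i) = BT (Ms' ! i)" if "i < length Ms" for i
    using eq(2) that by (auto simp: list_all2_conv_all_nth intro: BT_conv)
  show "BT (apps h Ms) [] = head_label h" using ex N eq rigid by (auto simp: rigid_head_head)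
  show "BT (apps h Ms) (i # w) = (if i < length Ms then BT (Ms ! i) w else None)"
    using ex N eq(1) rigid len BT_nth[of i] by (auto simp: rigid_head_args)
qed

declare BT.simps [simp del]

lemma BT_Con [simp]:
  "BT (apps (Con c) Ms) [] = Some (LCon c)"
  "BT (apps (Con c) Ms) (i # w) = (if i < length Ms then BT (Ms ! i) w else None)"
  by (simp_all add: BT_rigid)

lemma BT_Var: "BT (Var n) w = (if w = [] then Some (LVar n) else None)"
  using BT_rigid[of "Var n" "[]"] by (cases w) auto

lemma BT_Con_leaf: "BT (Con c) w = (if w = [] then Some (LCon c) else None)"
  using BT_Con[of c "[]"] by (cases w) auto

subsection \<open>Terms with a complete tree\<close>

text \<open>Coinductive because a guarded fixed point unfolds forever. Of the context only its
  length \<open>n\<close> is kept; it bounds the labels \<open>LVar k\<close>.\<close>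

coinductive ct :: "'c sig \<Rightarrow> nat \<Rightarrow> 'c tm \<Rightarrow> bool" for \<Sigma> n where
  ct_Var: "fixbeta_eq M (Var k) \<Longrightarrow> k < n \<Longrightarrow> ct \<Sigma> n M"
| ct_Con: "fixbeta_eq M (apps (Con c) Ms) \<Longrightarrow> \<Sigma> c = Some \<tau> \<Longrightarrow> length Ms = length (arg_tys \<tau>) \<Longrightarrow>
    \<forall>N\<in>set Ms. ct \<Sigma> n N \<Longrightarrow> ct \<Sigma> n M"

lemma ct_BT_cases:
  assumes "ct \<Sigma> n M"
  obtains (Var) k where "BT M = BT (Var k)" "k < n" "fixbeta_eq M (Var k)"
  | (Con) c Ms \<tau> where "BT M = BT (apps (Con c) Ms)" "fixbeta_eq M (apps (Con c) Ms)"
      "\<Sigma> c = Some \<tau>" "length Ms = length (arg_tys \<tau>)" "\<forall>N\<in>set Ms. ct \<Sigma> n N"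
  using assms
proof (cases rule: ct.cases)
  case (ct_Var k)
  with BT_conv[OF this(1)] show ?thesis by (intro Var)
next
  case (ct_Con c Ms \<tau>)
  with BT_conv[OF this(1)] show ?thesis by (intro Con)
qed

lemma ct_conv: "fixbeta_eq M N \<Longrightarrow> ct \<Sigma> n N \<Longrightarrow> ct \<Sigma> n M"
  by (erule ct.cases) (auto intro: ct.intros conv_trans)

lemma ct_apps:
  assumes "ct \<Sigma> n (apps (Con c) Ms)"
  shows "(\<exists>\<tau>. \<Sigma> c = Some \<tau> \<and> length Ms = length (arg_tys \<tau>)) \<and> (\<forall>N\<in>set Ms. ct \<Sigma> n N)"
  using assms
proof (cases rule: ct.cases)
  case (ct_Var k)
  then show ?thesis using conv_rigid_apps[of "Con c" Ms "Var k" "[]"] by simp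
next
  case (ct_Con c' Ns \<tau>)
  then have eq: "c' = c" "list_all2 fixbeta_eq Ms Ns" using conv_rigid_apps by fastforce+
  then have "\<forall>N\<in>set Ms. ct \<Sigma> n N"
    using ct_Con(4) by (auto simp: list_all2_conv_all_nth in_set_conv_nth) (metis ct_conv nth_mem)
  then show ?thesis using ct_Con eq by (auto dest: list_all2_lengthD)
qed

lemma ct_BT_dom:
  "ct \<Sigma> n M \<Longrightarrow> w @ [i] \<in> dom (BT M) \<longleftrightarrow> (\<exists>l. BT M w = Some l \<and> i < arity \<Sigma> l)"
proof (induction w arbitrary: M)
  case Nil
  then show ?case
  proof (cases rule: ct_BT_cases)
    case (Var k)
    then show ?thesis by (simp add: Var(1) BT_Var domIff)
  next
    case (Con c Ms \<tau>)
    have "BT N [] \<noteq> None" if "ct \<Sigma> n N" for N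
      using that by (cases rule: ct_BT_cases) (simp_all add: BT_Var)
    then show ?thesis using Con by (auto simp: Con(1) domIff)
  qed
next
  case (Cons j w)
  from Cons.prems show ?case
  proof (cases rule: ct_BT_cases)
    case (Var k)
    then show ?thesis by (simp add: Var(1) BT_Var domIff)
  next
    case (Con c Ms \<tau>)
    then show ?thesis using Cons.IH[of "Ms ! j"] by (auto simp: Con(1) domIff)
  qed
qed

lemma ct_BT_label:
  "ct \<Sigma> n M \<Longrightarrow> BT M w = Some l \<Longrightarrow> (case l of LCon c \<Rightarrow> c \<in> dom \<Sigma> | LVar k \<Rightarrow> k < n)"
proof (induction w arbitrary: M)
  case Nil
  then show ?case
    by (cases rule: ct_BT_cases) (auto simp: BT_Var)
next
  case (Cons j w)
  from Cons.prems(1) show ?case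
  proof (cases rule: ct_BT_cases)
    case (Var k)
    then show ?thesis using Cons.prems by (simp add: Var(1) BT_Var)
  next
    case (Con c Ms \<tau>)
    then show ?thesis
      using Cons.IH[of "Ms ! j"] Cons.prems(2) by (auto simp: Con(1) split: if_splits)
  qed
qed

lemma ct_is_tree:
  assumes "ct \<Sigma> n M"
  shows "is_tree \<Sigma> (BT M)"
proof -
  have "BT M [] \<noteq> None"
    using assms by (cases rule: ct_BT_cases) (simp_all add: BT_Var)
  then show ?thesis
    unfolding is_tree_def using ct_BT_dom[OF assms] ct_BT_label[OF assms] by fastforce
qed

text \<open>Prepares for closed terms: conversion does not preserve the set of free variables, so
  closedness of a tree is derived from its behaviour under a shift instead.\<close>

lemma ct_BT_shift:
  "ct \<Sigma> n M \<Longrightarrow> BT M w = Some (LVar k) \<Longrightarrow> BT (subst (\<lambda>k. Var (Suc k)) M) w = Some (LVar (Suc k))"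
proof (induction w arbitrary: M)
  case Nil
  from Nil.prems(1) show ?case
  proof (cases rule: ct_BT_cases)
    case (Var j)
    then show ?thesis
      using Nil.prems(2) BT_conv[OF conv_subst[OF Var(3), of "\<lambda>k. Var (Suc k)"]] by (simp add: BT_Var)
  next
    case (Con c Ms \<tau>)
    then show ?thesis using Nil.prems(2) by simp
  qed
next
  case (Cons i w)
  from Cons.prems(1) show ?case
  proof (cases rule: ct_BT_cases)
    case (Var j)
    then show ?thesis using Cons.prems(2) by (simp add: BT_Var)
  next
    case (Con c Ms \<tau>)
    then have "i < length Ms" "BT (Ms ! i) w = Some (LVar k)"
      using Cons.prems(2) by (auto split: if_splits)
    then show ?thesis
      using Cons.IH[of "Ms ! i"] Con(5) BT_conv[OF conv_subst[OF Con(2), of "\<lambda>k. Var (Suc k)"]] by simp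
  qed
qed

text \<open>A closed term is invariant under shifting its variables, hence so is its tree.\<close>

lemma ct_closed:
  assumes "ct \<Sigma> n N" "fv N = {}"
  shows "BT N w \<noteq> Some (LVar k)"
  using ct_BT_shift[OF assms(1), of w k] subst_closed[OF assms(2)] by auto

subsection \<open>First-order terms\<close>

text \<open>Spine form of first-order terms, see \<open>fo_term_iff\<close>. The type is an index so
  that arguments can be matched with the argument types of their constant.\<close>

inductive fot :: "'c sig \<Rightarrow> ty list \<Rightarrow> 'c tm \<Rightarrow> ty \<Rightarrow> bool" for \<Sigma> \<Gamma> where
  fot_Var: "n < length \<Gamma> \<Longrightarrow> \<Gamma> ! n = \<tau> \<Longrightarrow> ord \<tau> = 0 \<Longrightarrow> \<tau> \<noteq> Omicron \<Longrightarrow> fot \<Sigma> \<Gamma> (Var n) \<tau>"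
| fot_Con: "\<Sigma> c = Some (foldr (\<rightarrow>) ts \<tau>) \<Longrightarrow> ord \<tau> = 0 \<Longrightarrow> \<tau> \<noteq> Omicron \<Longrightarrow>
    list_all2 (fot \<Sigma> \<Gamma>) Ms ts \<Longrightarrow> fot \<Sigma> \<Gamma> (apps (Con c) Ms) \<tau>"

lemma arg_tys_foldr: "ord \<tau> = 0 \<Longrightarrow> arg_tys (foldr (\<rightarrow>) ts \<tau>) = ts"
  by (induction ts) (cases \<tau>, auto)

lemma target_foldr: "target (foldr (\<rightarrow>) ts \<tau>) = target \<tau>"
  by (induction ts) auto

lemma ord_foldr: "\<forall>\<sigma>\<in>set ts. ord \<sigma> = 0 \<Longrightarrow> ord \<tau> = 0 \<Longrightarrow> ord (foldr (\<rightarrow>) ts \<tau>) \<le> 1"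
  by (induction ts) auto

lemma ord_foldr_le: "ord (foldr (\<rightarrow>) ts \<tau>) \<le> 1 \<Longrightarrow> (\<forall>\<sigma>\<in>set ts. ord \<sigma> = 0) \<and> ord \<tau> \<le> 1"
  by (induction ts) auto

lemma fot_type: "fot \<Sigma> \<Gamma> M \<tau> \<Longrightarrow> ord \<tau> = 0 \<and> \<tau> \<noteq> Omicron \<and> typeof \<Sigma> \<Gamma> M = Some \<tau> \<and> beta_normal M"
proof (induction rule: fot.induct)
  case (fot_Con c ts \<tau> Ms)
  then have "list_all2 (\<lambda>M \<sigma>. typeof \<Sigma> \<Gamma> M = Some \<sigma>) Ms ts" by (auto elim: list_all2_mono)
  then have "typeof \<Sigma> \<Gamma> (apps (Con c) Ms) = Some \<tau>" unfolding typeof_apps using fot_Con(1) by auto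
  moreover have "beta_normal (apps (Con c) Ms)"
    using fot_Con(4) by (auto simp: beta_normal_apps list_all2_conv_all_nth in_set_conv_nth)
  ultimately show ?case using fot_Con by simp
qed simp_all

text \<open>The subterm condition of \<open>fo_term\<close> without the requirement that the whole
  term has order 0, so that it passes to partial applications inside a spine.\<close>

definition fo_cond :: "'c sig \<Rightarrow> ty list \<Rightarrow> 'c tm \<Rightarrow> bool" where
  "fo_cond \<Sigma> \<Gamma> M \<longleftrightarrow> (\<forall>(\<Delta>, N) \<in> subterms \<Gamma> M. \<forall>\<tau>. typeof \<Sigma> \<Delta> N = Some \<tau> \<longrightarrow>
        ((\<exists>c. N = Con c) \<or> (\<exists>k. N = Log k) \<longrightarrow> ord \<tau> \<le> 1) \<and>
        ((\<exists>n. N = Var n) \<longrightarrow> ord \<tau> = 0) \<and>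
        \<tau> \<noteq> Omicron \<and>
        (\<nexists>\<sigma> K. N = Fix \<sigma> K))"

lemma subterms_self: "(\<Gamma>, M) \<in> subterms \<Gamma> M"
  by (cases M) auto

lemma fo_cond_self: "fo_cond \<Sigma> \<Gamma> M \<Longrightarrow> typeof \<Sigma> \<Gamma> M = Some \<tau> \<Longrightarrow> \<tau> \<noteq> Omicron"
  unfolding fo_cond_def using subterms_self by fastforce

lemma fo_cond_App: "fo_cond \<Sigma> \<Gamma> (App M N) \<Longrightarrow> fo_cond \<Sigma> \<Gamma> M \<and> fo_cond \<Sigma> \<Gamma> N"
  unfolding fo_cond_def by auto

lemma fo_cond_AppI:
  "fo_cond \<Sigma> \<Gamma> M \<Longrightarrow> fo_cond \<Sigma> \<Gamma> N \<Longrightarrow> (\<And>\<tau>. typeof \<Sigma> \<Gamma> (App M N) = Some \<tau> \<Longrightarrow> \<tau> \<noteq> Omicron) \<Longrightarrow>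
    fo_cond \<Sigma> \<Gamma> (App M N)"
  unfolding fo_cond_def by (auto simp del: typeof.simps)

text \<open>Logical constants survive only unapplied: a binary connective would take an argument of
  type \<open>o\<close>, and a quantifier has order at least 2. A variable has order 0 and cannot be
  applied either. So every application is headed by a non-logical constant.\<close>

lemma fo_cond_spine:
  "fo_cond \<Sigma> \<Gamma> M \<Longrightarrow> beta_normal M \<Longrightarrow> neutral M \<Longrightarrow> typeof \<Sigma> \<Gamma> M = Some \<tau> \<Longrightarrow>
    (\<exists>n. M = Var n \<and> n < length \<Gamma> \<and> \<Gamma> ! n = \<tau> \<and> ord \<tau> = 0) \<or>
    (\<exists>k. M = Log k \<and> \<tau> = logc_ty k \<and> ord \<tau> \<le> 1) \<or>
    (\<exists>c Ms ts. M = apps (Con c) Ms \<and> \<Sigma> c = Some (foldr (\<rightarrow>) ts \<tau>) \<and>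
       ord (foldr (\<rightarrow>) ts \<tau>) \<le> 1 \<and> list_all2 (fot \<Sigma> \<Gamma>) Ms ts)"
proof (induction M arbitrary: \<tau>)
  case (App M N)
  obtain \<sigma> where t: "typeof \<Sigma> \<Gamma> M = Some (\<sigma> \<rightarrow> \<tau>)" "typeof \<Sigma> \<Gamma> N = Some \<sigma>"
    using App.prems(4) by (rule typeof_AppE)
  have c: "fo_cond \<Sigma> \<Gamma> M" "fo_cond \<Sigma> \<Gamma> N" using fo_cond_App[OF App.prems(1)] by auto
  have no: "\<sigma> \<noteq> Omicron" using fo_cond_self[OF c(2) t(2)] .
  from App.IH(1)[OF c(1) _ _ t(1)] App.prems(2)
  consider "ord (\<sigma> \<rightarrow> \<tau>) = 0" | k where "M = Log k" "\<sigma> \<rightarrow> \<tau> = logc_ty k" "ord (\<sigma> \<rightarrow> \<tau>) \<le> 1"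
    | d Ms ts where "M = apps (Con d) Ms" "\<Sigma> d = Some (foldr (\<rightarrow>) ts (\<sigma> \<rightarrow> \<tau>))"
       "ord (foldr (\<rightarrow>) ts (\<sigma> \<rightarrow> \<tau>)) \<le> 1" "list_all2 (fot \<Sigma> \<Gamma>) Ms ts"
    by fastforce
  then show ?case
  proof cases
    case 1
    then show ?thesis by simp
  next
    case 2
    then show ?thesis using no by (cases k) auto
  next
    case 3
    from ord_foldr_le[OF 3(3)] have o: "ord \<sigma> = 0" by auto
    \<comment> \<open>An argument of order 0 is not an abstraction, so the induction hypothesis
      applies to it.\<close>
    have "neutral N" using t(2) o by (cases N) auto
    with App.IH(2)[OF c(2) _ _ t(2)] App.prems(2)
    consider n where "N = Var n" "n < length \<Gamma>" "\<Gamma> ! n = \<sigma>" | k where "N = Log k" "\<sigma> = logc_ty k"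
      | d' Ns us where "N = apps (Con d') Ns" "\<Sigma> d' = Some (foldr (\<rightarrow>) us \<sigma>)" "list_all2 (fot \<Sigma> \<Gamma>) Ns us"
      by fastforce
    then have "fot \<Sigma> \<Gamma> N \<sigma>"
    proof cases
      case 1
      then show ?thesis using o no by (auto intro: fot.intros)
    next
      case (2 k)
      then show ?thesis using o no by (cases k) auto
    next
      case 3
      then show ?thesis using o no by (auto intro: fot.intros)
    qed
    then have "App M N = apps (Con d) (Ms @ [N])" "list_all2 (fot \<Sigma> \<Gamma>) (Ms @ [N]) (ts @ [\<sigma>])"
      using 3 by (auto intro: list_all2_appendI)
    moreover have "foldr (\<rightarrow>) (ts @ [\<sigma>]) \<tau> = foldr (\<rightarrow>) ts (\<sigma> \<rightarrow> \<tau>)" by simp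
    ultimately show ?thesis using 3(2,3) by (metis (no_types))
  qed
next
  case (Con c)
  then have "Con c = apps (Con c) [] \<and> \<Sigma> c = Some (foldr (\<rightarrow>) [] \<tau>) \<and> ord (foldr (\<rightarrow>) [] \<tau>) \<le> 1 \<and>
    list_all2 (fot \<Sigma> \<Gamma>) [] []"
    unfolding fo_cond_def by auto
  then show ?case by blast
qed (auto simp: fo_cond_def split: if_splits)

lemma fot_fo_cond: "fot \<Sigma> \<Gamma> M \<tau> \<Longrightarrow> fo_cond \<Sigma> \<Gamma> M"
proof (induction rule: fot.induct)
  case (fot_Var n \<tau>)
  then show ?case by (auto simp: fo_cond_def)
next
  case (fot_Con c ts \<tau> Ms)
  have ords: "\<forall>\<sigma>\<in>set ts. ord \<sigma> = 0"
    using fot_Con(4) by (auto simp: list_all2_conv_all_nth in_set_conv_nth) (metis fot_type)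
  \<comment> \<open>Generalised to initial segments of the spine, because the subterm condition also
    speaks of partial applications.\<close>
  have "list_all2 (\<lambda>M \<sigma>. fot \<Sigma> \<Gamma> M \<sigma> \<and> fo_cond \<Sigma> \<Gamma> M) Ms' ts' \<Longrightarrow>
    \<Sigma> c = Some (foldr (\<rightarrow>) ts' \<tau>') \<Longrightarrow> ord (foldr (\<rightarrow>) ts' \<tau>') \<le> 1 \<Longrightarrow> \<tau>' \<noteq> Omicron \<Longrightarrow>
    fo_cond \<Sigma> \<Gamma> (apps (Con c) Ms') \<and> typeof \<Sigma> \<Gamma> (apps (Con c) Ms') = Some \<tau>'" for Ms' ts' \<tau>'
  proof (induction Ms' arbitrary: ts' \<tau>' rule: rev_induct)
    case Nil
    then show ?case by (auto simp: fo_cond_def)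
  next
    case (snoc M Ms')
    then obtain us \<rho> where s: "ts' = us @ [\<rho>]" "list_all2 (\<lambda>M \<sigma>. fot \<Sigma> \<Gamma> M \<sigma> \<and> fo_cond \<Sigma> \<Gamma> M) Ms' us"
      "fot \<Sigma> \<Gamma> M \<rho>" "fo_cond \<Sigma> \<Gamma> M"
      by (auto simp: list_all2_append1 list_all2_Cons1)
    have IH: "fo_cond \<Sigma> \<Gamma> (apps (Con c) Ms')" "typeof \<Sigma> \<Gamma> (apps (Con c) Ms') = Some (\<rho> \<rightarrow> \<tau>')"
      using snoc.IH[of us "\<rho> \<rightarrow> \<tau>'"] s snoc.prems by auto
    have t: "typeof \<Sigma> \<Gamma> (App (apps (Con c) Ms') M) = Some \<tau>'"
      using IH(2) fot_type[OF s(3)] by (auto intro: typeof_AppI simp del: typeof.simps)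
    show ?case using t IH(1) s(4) snoc.prems(4) by (auto intro!: fo_cond_AppI simp del: typeof.simps)
  qed
  then show ?case using fot_Con ords ord_foldr by blast
qed

lemma fo_term_iff: "fo_term \<Sigma> \<Gamma> M \<longleftrightarrow> (\<exists>\<tau>. fot \<Sigma> \<Gamma> M \<tau>)"
proof
  assume "fo_term \<Sigma> \<Gamma> M"
  then obtain \<tau> where M: "typeof \<Sigma> \<Gamma> M = Some \<tau>" "beta_normal M" "ord \<tau> = 0" "fo_cond \<Sigma> \<Gamma> M"
    unfolding fo_term_def fo_cond_def wt_def by blast
  have o: "\<tau> \<noteq> Omicron" using fo_cond_self[OF M(4,1)] .
  have "neutral M" using M(1,3) by (cases M) auto
  from fo_cond_spine[OF M(4,2) this M(1)]
  consider n where "M = Var n" "n < length \<Gamma>" "\<Gamma> ! n = \<tau>" | k where "\<tau> = logc_ty k"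
    | d Ms ts where "M = apps (Con d) Ms" "\<Sigma> d = Some (foldr (\<rightarrow>) ts \<tau>)" "list_all2 (fot \<Sigma> \<Gamma>) Ms ts"
    by fastforce
  then show "\<exists>\<tau>. fot \<Sigma> \<Gamma> M \<tau>"
  proof cases
    case (2 k)
    then show ?thesis using o M(3) by (cases k) auto
  qed (use o M(3) in \<open>auto intro: fot.intros\<close>)
next
  assume "\<exists>\<tau>. fot \<Sigma> \<Gamma> M \<tau>"
  then show "fo_term \<Sigma> \<Gamma> M"
    unfolding fo_term_def wt_def fo_cond_def[symmetric] using fot_type fot_fo_cond by blast
qed

lemma fo_term_wt_fot: "fo_term \<Sigma> \<Gamma> M \<Longrightarrow> typeof \<Sigma> \<Gamma> M = Some \<tau> \<Longrightarrow> fot \<Sigma> \<Gamma> M \<tau>"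
  unfolding fo_term_iff using fot_type by fastforce

text \<open>The substitution is constrained on free variables only: in the body of a guarded fixed
  point the context also lists the recursion variable, which may have functional type but does not
  occur in the first-order parts.\<close>

lemma fot_subst:
  "fot \<Sigma> \<Gamma> M \<tau> \<Longrightarrow> (\<And>n. n \<in> fv M \<Longrightarrow> n < length \<Gamma> \<Longrightarrow> fot \<Sigma> \<Delta> (\<sigma> n) (\<Gamma> ! n)) \<Longrightarrow>
    fot \<Sigma> \<Delta> (subst \<sigma> M) \<tau>"
proof (induction rule: fot.induct)
  case (fot_Con c ts \<tau> Ms)
  have "fot \<Sigma> \<Delta> (subst \<sigma> (Ms ! i)) (ts ! i)" if "i < length Ms" for i
  proof -
    have "n \<in> fv (apps (Con c) Ms)" if "n \<in> fv (Ms ! i)" for n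
      using that \<open>i < length Ms\<close> by (auto intro: bexI[of _ "Ms ! i"])
    then show ?thesis using fot_Con(4) that fot_Con.prems by (auto simp: list_all2_conv_all_nth)
  qed
  then have "list_all2 (fot \<Sigma> \<Delta>) (map (subst \<sigma>) Ms) ts"
    using fot_Con(4) by (auto simp: list_all2_conv_all_nth)
  then show ?case using fot_Con by (auto intro: fot.intros)
qed auto

lemma list_all2_set1: "list_all2 P xs ys \<Longrightarrow> x \<in> set xs \<Longrightarrow> \<exists>y\<in>set ys. P x y"
  by (auto simp: list_all2_conv_all_nth in_set_conv_nth) (metis nth_mem)

lemma fot_ct: "fot \<Sigma> \<Gamma> M \<tau> \<Longrightarrow> ct \<Sigma> (length \<Gamma>) M"
proof (induction rule: fot.induct)
  case (fot_Var n \<tau>)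
  then show ?case by (intro ct_Var[of _ n]) auto
next
  case (fot_Con c ts \<tau> Ms)
  then have "length Ms = length (arg_tys (foldr (\<rightarrow>) ts \<tau>))"
    by (simp add: arg_tys_foldr list_all2_lengthD)
  then show ?case using fot_Con(1) list_all2_set1[OF fot_Con(4)] by (intro ct_Con[OF conv_refl]) auto
qed

lemma fot_tree_of: "fot \<Sigma> \<Gamma> M \<tau> \<Longrightarrow> tree_of M w = BT M w"
proof (induction arbitrary: w rule: fot.induct)
  case (fot_Var n \<tau>)
  then show ?case by (cases w) (auto simp: BT_Var)
next
  case (fot_Con c ts \<tau> Ms)
  have "\<forall>M\<in>set Ms. \<forall>w. tree_of M w = BT M w" using list_all2_set1[OF fot_Con(4)] by blast
  then show ?case by (cases w) auto
qed

subsection \<open>Unfolding guarded full terms\<close>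

lemma iotas_foldr: "iotas n = foldr (\<rightarrow>) (replicate n Iota) Iota"
  by (induction n) (simp_all add: iotas_def)

lemma length_arg_tys_iotas: "length (arg_tys (iotas n)) = n"
  by (induction n) (simp_all add: iotas_def)

lemma ups_funpow: "(ups ^^ m) \<sigma> i = (if i < m then Var i else ren (\<lambda>k. k + m) (\<sigma> (i - m)))"
proof (induction m arbitrary: i)
  case 0
  then show ?case by (simp add: ren_eq_subst)
next
  case (Suc m)
  then show ?case by (cases i) (auto simp: ren_ren)
qed

lemma subst_Lams: "subst \<sigma> ((Lam \<tau> ^^ m) K) = (Lam \<tau> ^^ m) (subst ((ups ^^ m) \<sigma>) K)"
proof (induction m arbitrary: \<sigma>)
  case (Suc m)
  have *: "(ups ^^ Suc m) \<sigma> = (ups ^^ m) (ups \<sigma>)" by (simp only: funpow_Suc_right o_apply)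
  show ?case unfolding * using Suc by simp
qed simp

lemma fv_Lams: "fv ((Lam \<tau> ^^ m) K) = {n. n + m \<in> fv K}"
  by (induction m) auto

text \<open>Reversed because the first argument is bound by the outermost abstraction, whose
  variable has the highest index.\<close>

definition rev_subst :: "'c tm list \<Rightarrow> nat \<Rightarrow> 'c tm" where
  "rev_subst Ms i = (if i < length Ms then rev Ms ! i else Var (i - length Ms))"

lemma subst_rev_subst_Cons:
  "subst (rev_subst Ms) ((ups ^^ length Ms) (case_nat M Var) i) = rev_subst (M # Ms) i"
proof (cases i "length Ms" rule: linorder_cases)
  case less
  then show ?thesis by (simp add: ups_funpow nth_append rev_subst_def)
next
  case equal
  have "(\<lambda>k. rev_subst Ms (k + length Ms)) = Var" by (auto simp: rev_subst_def)
  moreover have "(ups ^^ length Ms) (case_nat M Var) i = ren (\<lambda>k. k + length Ms) M"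
    using equal by (simp add: ups_funpow)
  ultimately show ?thesis using equal by (simp add: subst_ren rev_subst_def nth_append)
next
  case greater
  then obtain k where "i = Suc (length Ms + k)" using less_imp_Suc_add by blast
  then show ?thesis by (simp add: ups_funpow rev_subst_def)
qed

lemma betas_Lams: "betas (apps ((Lam \<tau> ^^ length Ms) K) Ms) (subst (rev_subst Ms) K)"
proof (induction Ms arbitrary: K)
  case Nil
  have "rev_subst [] = (Var :: nat \<Rightarrow> 'a tm)" by (auto simp: rev_subst_def)
  then show ?case by simp
next
  case (Cons M Ms)
  let ?K = "subst ((ups ^^ length Ms) (case_nat M Var)) K"
  have "beta (App ((Lam \<tau> ^^ length (M # Ms)) K) M) (inst ((Lam \<tau> ^^ length Ms) K) M)"
    by (simp add: beta.intros)
  then have "beta (App ((Lam \<tau> ^^ length (M # Ms)) K) M) ((Lam \<tau> ^^ length Ms) ?K)"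
    by (simp only: inst_def subst_Lams)
  then have "betas (apps ((Lam \<tau> ^^ length (M # Ms)) K) (M # Ms)) (apps ((Lam \<tau> ^^ length Ms) ?K) Ms)"
    unfolding apps_Cons by (intro betas_apps_head r_into_rtranclp)
  moreover have "subst (rev_subst Ms) ?K = subst (rev_subst (M # Ms)) K"
    by (simp only: subst_subst subst_rev_subst_Cons)
  ultimately show ?case using Cons.IH[of ?K] by (metis rtranclp_trans)
qed

lemma guarded_fixE:
  assumes "guarded_fix \<Sigma> m F"
  obtains f Ls Ls' Ns where
    "F = Fix (iotas m) ((Lam Iota ^^ m) (apps (Con f) (Ls @ [apps (Var m) Ns] @ Ls')))"
    "length Ns = m" "\<Sigma> f = Some (iotas (length Ls + length Ls' + 1))"
    "\<forall>M \<in> set Ls \<union> set Ls' \<union> set Ns. fot \<Sigma> (replicate m Iota @ [iotas m]) M Iota \<and> fv M \<subseteq> {..<m}"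
proof -
  obtain f Ls Ls' Ns where F:
    "F = Fix (iotas m) ((Lam Iota ^^ m) (apps (Con f) (Ls @ [apps (Var m) Ns] @ Ls')))"
    "length Ns = m" "\<Sigma> f = Some (iotas (length Ls + length Ls' + 1))"
    "\<forall>M \<in> set Ls \<union> set Ls' \<union> set Ns. fo_term \<Sigma> (replicate m Iota @ [iotas m]) M \<and>
       wt \<Sigma> (replicate m Iota @ [iotas m]) M Iota"
    "(\<Union>M \<in> set Ls \<union> set Ls' \<union> set Ns. fv M) = {..<m}"
    using assms unfolding guarded_fix_def by blast
  have "fot \<Sigma> (replicate m Iota @ [iotas m]) M Iota \<and> fv M \<subseteq> {..<m}" if "M \<in> set Ls \<union> set Ls' \<union> set Ns" for M
    using F(4,5) that fo_term_wt_fot unfolding wt_def by blast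
  then show thesis using F(1-3) that by blast
qed

lemma guarded_fix_closed:
  assumes "guarded_fix \<Sigma> m F"
  shows "fv F = {}"
proof -
  obtain f Ls Ls' Ns where F: "F = Fix (iotas m) ((Lam Iota ^^ m) (apps (Con f) (Ls @ [apps (Var m) Ns] @ Ls')))"
    and "\<forall>M \<in> set Ls \<union> set Ls' \<union> set Ns. fot \<Sigma> (replicate m Iota @ [iotas m]) M Iota \<and> fv M \<subseteq> {..<m}"
    using assms by (rule guarded_fixE)
  then have "fv (apps (Con f) (Ls @ [apps (Var m) Ns] @ Ls')) \<subseteq> {..m}" by fastforce
  then show ?thesis unfolding F by (auto simp: fv_Lams)
qed

definition nofix :: "'c tm \<Rightarrow> bool" where
  "nofix M \<longleftrightarrow> (\<forall>p N. \<not> fix_at p M N)"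

inductive_cases fix_at_VarE [elim!]: "fix_at p (Var n) N"
inductive_cases fix_at_ConE [elim!]: "fix_at p (Con c) N"
inductive_cases fix_at_LogE [elim!]: "fix_at p (Log k) N"
inductive_cases fix_at_LamE [elim!]: "fix_at p (Lam \<tau> M) N"

lemma fix_at_AppE:
  assumes "fix_at p (App M N) K"
  obtains (left) q M' where "p = 0 # q" "fix_at q M M'" "K = App M' N"
  | (right) q N' where "p = 1 # q" "fix_at q N N'" "K = App M N'"
  using assms by (cases rule: fix_at.cases) auto

lemma fix_at_FixE:
  assumes "fix_at p (Fix \<tau> M) K"
  obtains (contract) "p = []" "K = inst M (Fix \<tau> M)"
  | (inside) q M' where "p = 0 # q" "fix_at q M M'" "K = Fix \<tau> M'"
  using assms by (cases rule: fix_at.cases) auto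

text \<open>Applications nest to the left, so argument \<open>i\<close> of a spine of length
  \<open>n\<close> sits below \<open>n - Suc i\<close> left branches and one right branch.\<close>

lemma fix_at_apps:
  "fix_at p (apps h Ms) N \<Longrightarrow>
    (\<exists>q h'. p = replicate (length Ms) 0 @ q \<and> fix_at q h h' \<and> N = apps h' Ms) \<or>
    (\<exists>i<length Ms. \<exists>q K. p = replicate (length Ms - Suc i) 0 @ 1 # q \<and> fix_at q (Ms ! i) K \<and>
       N = apps h (Ms[i := K]))"
proof (induction Ms arbitrary: p N rule: rev_induct)
  case (snoc M Ms)
  from snoc.prems have "fix_at p (App (apps h Ms) M) N" by simp
  then show ?case
  proof (cases rule: fix_at_AppE)
    case (left q M')
    from snoc.IH[OF left(2)] show ?thesis
    proof (elim disjE exE conjE)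
      fix r h' assume "q = replicate (length Ms) 0 @ r" "fix_at r h h'" "M' = apps h' Ms"
      then show ?thesis using left by (intro disjI1 exI[of _ r] exI[of _ h']) simp
    next
      fix i r K assume i: "i < length Ms" "q = replicate (length Ms - Suc i) 0 @ 1 # r"
        "fix_at r (Ms ! i) K" "M' = apps h (Ms[i := K])"
      then have "length Ms - i = Suc (length Ms - Suc i)" by simp
      then show ?thesis
        using left i by (intro disjI2 exI[of _ i] conjI exI[of _ r] exI[of _ K])
          (simp_all add: nth_append list_update_append)
    qed
  next
    case (right q N')
    then show ?thesis by (intro disjI2 exI[of _ "length Ms"] conjI exI[of _ q] exI[of _ N']) simp_all
  qed
qed simp

lemma fix_at_apps_arg:
  assumes "i < length Ms" "fix_at q (Ms ! i) K"
  shows "fix_at (replicate (length Ms - Suc i) 0 @ 1 # q) (apps h Ms) (apps h (Ms[i := K]))"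
proof -
  have Ms: "Ms = take i Ms @ [Ms ! i] @ drop (Suc i) Ms" using assms(1) by (simp add: id_take_nth_drop)
  have "fix_at (1 # q) (App (apps h (take i Ms)) (Ms ! i)) (App (apps h (take i Ms)) K)"
    using assms(2) by (rule fix_at.intros)
  from fix_at_apps_head[OF this, of "drop (Suc i) Ms"]
  have "fix_at (replicate (length Ms - Suc i) 0 @ 1 # q) (apps h (take i Ms @ [Ms ! i] @ drop (Suc i) Ms))
    (apps h (take i Ms @ [K] @ drop (Suc i) Ms))"
    using assms(1) by simp
  then show ?thesis
    unfolding upd_conv_take_nth_drop[OF assms(1)] using arg_cong[OF Ms, of "apps h"] by simp
qed

lemma nofix_apps: "nofix h \<Longrightarrow> \<forall>M\<in>set Ms. nofix M \<Longrightarrow> nofix (apps h Ms)"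
  unfolding nofix_def by (metis fix_at_apps nth_mem)

lemma nofix_simps [simp]: "nofix (Var n)" "nofix (Con c)" "nofix (Log k)"
  by (auto simp: nofix_def)

lemma nofix_Lams: "nofix K \<Longrightarrow> nofix ((Lam \<tau> ^^ m) K)"
  by (induction m) (auto simp: nofix_def)

lemma fot_nofix: "fot \<Sigma> \<Gamma> M \<tau> \<Longrightarrow> nofix M"
proof (induction rule: fot.induct)
  case (fot_Con c ts \<tau> Ms)
  then show ?case by (auto intro!: nofix_apps dest: list_all2_set1)
qed simp

text \<open>The arguments and the first-order parts of the body contain no redex, so the fixed point
  at the head is the only one. Its contractum \<beta>-reduces to a constant-headed term with
  \<open>F\<close> again at the head of one argument.\<close>

lemma guarded_unfold:
  assumes F: "guarded_fix \<Sigma> (length Ms) F" and Ms: "\<forall>M\<in>set Ms. fot \<Sigma> \<Gamma> M Iota"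
  obtains K f Ls Ls' Ns where
    "fix_at (replicate (length Ms) 0) (apps F Ms) K"
    "\<forall>p K'. fix_at p (apps F Ms) K' \<longrightarrow> p = replicate (length Ms) 0 \<and> K' = K"
    "betas K (apps (Con f) (Ls @ [apps F Ns] @ Ls'))" "length Ns = length Ms"
    "\<Sigma> f = Some (iotas (length Ls + length Ls' + 1))"
    "\<forall>M \<in> set Ls \<union> set Ls' \<union> set Ns. fot \<Sigma> \<Gamma> M Iota"
proof -
  let ?m = "length Ms"
  obtain f Ls Ls' Ns where
    Fdef: "F = Fix (iotas ?m) ((Lam Iota ^^ ?m) (apps (Con f) (Ls @ [apps (Var ?m) Ns] @ Ls')))"
      (is "F = Fix _ ((Lam Iota ^^ ?m) ?B)")
    and len: "length Ns = ?m" and f: "\<Sigma> f = Some (iotas (length Ls + length Ls' + 1))"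
    and args: "\<forall>M \<in> set Ls \<union> set Ls' \<union> set Ns. fot \<Sigma> (replicate ?m Iota @ [iotas ?m]) M Iota \<and> fv M \<subseteq> {..<?m}"
    using F by (rule guarded_fixE)
  have fot: "fot \<Sigma> (replicate ?m Iota @ [iotas ?m]) M Iota" if "M \<in> set Ls \<union> set Ls' \<union> set Ns" for M
    using args that by blast
  have vm: "n < ?m" if "n \<in> fv M" "M \<in> set Ls \<union> set Ls' \<union> set Ns" for n M using args that by blast
  have Fcl: "fv F = {}" using F by (rule guarded_fix_closed)
  let ?\<theta> = "rev_subst Ms"
  let ?K = "apps (inst ((Lam Iota ^^ ?m) ?B) F) Ms"
  have K: "fix_at (replicate ?m 0) (apps F Ms) ?K"
    using fix_at_apps_head[OF fix_at.intros(1), of Ms] by (simp add: Fdef)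
  have nofix: "nofix ((Lam Iota ^^ ?m) ?B)"
    by (intro nofix_Lams nofix_apps) (auto intro!: nofix_apps intro: fot_nofix[OF fot])
  have uniq: "p = replicate ?m 0 \<and> K' = ?K" if p: "fix_at p (apps F Ms) K'" for p K'
  proof -
    have "nofix (Ms ! i)" if "i < ?m" for i using Ms that by (auto intro: fot_nofix)
    with fix_at_apps[OF p] obtain q h' where q: "p = replicate ?m 0 @ q" "fix_at q F h'" "K' = apps h' Ms"
      unfolding nofix_def by blast
    from q(2) have "q = [] \<and> h' = inst ((Lam Iota ^^ ?m) ?B) F"
      unfolding Fdef by (rule fix_at_FixE) (use nofix in \<open>auto simp: nofix_def\<close>)
    with q show ?thesis by simp
  qed
  \<comment> \<open>The first-order parts do not mention the recursion variable, index
    \<open>?m\<close>, so putting the closed \<open>F\<close> in its place changes only the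
    recursive call.\<close>
  have "subst ((ups ^^ ?m) (case_nat F Var)) M = M" if "M \<in> set Ls \<union> set Ls' \<union> set Ns" for M
  proof -
    have "subst ((ups ^^ ?m) (case_nat F Var)) M = subst Var M"
      by (rule subst_cong_fv) (use vm that in \<open>auto simp: ups_funpow\<close>)
    then show ?thesis by simp
  qed
  then have "subst ((ups ^^ ?m) (case_nat F Var)) ?B = apps (Con f) (Ls @ [apps F Ns] @ Ls')"
    using Fcl by (auto simp: ups_funpow ren_closed map_idI)
  then have "inst ((Lam Iota ^^ ?m) ?B) F = (Lam Iota ^^ ?m) (apps (Con f) (Ls @ [apps F Ns] @ Ls'))"
    unfolding inst_def subst_Lams by simp
  then have "betas ?K (subst ?\<theta> (apps (Con f) (Ls @ [apps F Ns] @ Ls')))"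
    using betas_Lams[where \<tau> = Iota and Ms = Ms and K = "apps (Con f) (Ls @ [apps F Ns] @ Ls')"] by (simp only:)
  then have red: "betas ?K (apps (Con f) (map (subst ?\<theta>) Ls @ [apps F (map (subst ?\<theta>) Ns)] @ map (subst ?\<theta>) Ls'))"
    using Fcl by (simp add: subst_closed)
  have "fot \<Sigma> \<Gamma> (subst ?\<theta> M) Iota" if M: "M \<in> set Ls \<union> set Ls' \<union> set Ns" for M
  proof (rule fot_subst[OF fot[OF M]])
    fix n assume "n \<in> fv M"
    then have n: "n < ?m" using vm M by blast
    then have "rev Ms ! n \<in> set Ms" by (metis length_rev nth_mem set_rev)
    then show "fot \<Sigma> \<Gamma> (?\<theta> n) ((replicate ?m Iota @ [iotas ?m]) ! n)"
      using n Ms by (simp add: nth_append rev_subst_def)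
  qed
  then show thesis
    using that[OF K _ red] uniq len f by auto
qed

text \<open>A guarded full term that is not first-order, unfolded \<open>n\<close> times.\<close>

inductive ug :: "'c sig \<Rightarrow> ty list \<Rightarrow> nat \<Rightarrow> 'c tm \<Rightarrow> bool" for \<Sigma> \<Gamma> where
  ug_Fix: "guarded_fix \<Sigma> (length Ms) F \<Longrightarrow> \<forall>M\<in>set Ms. fot \<Sigma> \<Gamma> M Iota \<Longrightarrow> ug \<Sigma> \<Gamma> 0 (apps F Ms)"
| ug_Con: "\<Sigma> f = Some (iotas (length Ls + length Ls' + 1)) \<Longrightarrow>
    \<forall>M \<in> set Ls \<union> set Ls'. fot \<Sigma> \<Gamma> M Iota \<Longrightarrow> ug \<Sigma> \<Gamma> n X \<Longrightarrow>
    ug \<Sigma> \<Gamma> (Suc n) (apps (Con f) (Ls @ [X] @ Ls'))"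

lemma typeof_apps_iotas:
  assumes "typeof \<Sigma> \<Gamma> h = Some (iotas (length Ms))" "\<forall>M\<in>set Ms. typeof \<Sigma> \<Gamma> M = Some Iota"
  shows "typeof \<Sigma> \<Gamma> (apps h Ms) = Some Iota"
  unfolding typeof_apps
  by (rule exI[of _ "replicate (length Ms) Iota"])
    (use assms in \<open>auto simp: iotas_foldr list_all2_conv_all_nth\<close>)

lemma typeof_Lams:
  "typeof \<Sigma> (replicate k Iota @ \<Delta>) K = Some Iota \<Longrightarrow> typeof \<Sigma> \<Delta> ((Lam Iota ^^ k) K) = Some (iotas k)"
proof (induction k arbitrary: \<Delta>)
  case (Suc k)
  then have "typeof \<Sigma> (Iota # \<Delta>) ((Lam Iota ^^ k) K) = Some (iotas k)"
    by (simp add: replicate_app_Cons_same)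
  then show ?case by (simp add: iotas_def)
qed (simp add: iotas_def)

lemma beta_normal_Lams: "beta_normal ((Lam \<tau> ^^ m) K) = beta_normal K"
  by (induction m) auto

lemma neutral_apps: "neutral h \<Longrightarrow> neutral (apps h Ms)"
  by (induction Ms rule: rev_induct) auto

lemma guarded_fix_type:
  assumes "guarded_fix \<Sigma> m F"
  shows "typeof \<Sigma> \<Gamma> F = Some (iotas m) \<and> beta_normal F \<and> (\<exists>\<tau> B. F = Fix \<tau> B)"
proof -
  obtain f Ls Ls' Ns where
    Fdef: "F = Fix (iotas m) ((Lam Iota ^^ m) (apps (Con f) (Ls @ [apps (Var m) Ns] @ Ls')))"
      (is "F = Fix _ ((Lam Iota ^^ m) ?B)")
    and len: "length Ns = m" and f: "\<Sigma> f = Some (iotas (length Ls + length Ls' + 1))"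
    and fo: "\<forall>M \<in> set Ls \<union> set Ls' \<union> set Ns. fot \<Sigma> (replicate m Iota @ [iotas m]) M Iota \<and> fv M \<subseteq> {..<m}"
    using assms by (rule guarded_fixE)
  let ?\<Delta> = "replicate m Iota @ iotas m # \<Gamma>"
  have args: "typeof \<Sigma> ?\<Delta> M = Some Iota" if "M \<in> set Ls \<union> set Ls' \<union> set Ns" for M
  proof -
    \<comment> \<open>The identity renaming serves as weakening to the longer context.\<close>
    have "typeof \<Sigma> ?\<Delta> (ren (\<lambda>n. n) M) = Some Iota"
      by (rule typeof_ren[of _ "replicate m Iota @ [iotas m]"])
        (use fo that in \<open>auto simp: nth_append dest: fot_type\<close>)
    then show ?thesis by (simp add: ren_eq_subst)
  qed
  have "typeof \<Sigma> ?\<Delta> (apps (Var m) Ns) = Some Iota"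
    by (rule typeof_apps_iotas) (use len args in \<open>auto simp: nth_append\<close>)
  then have "typeof \<Sigma> ?\<Delta> ?B = Some Iota"
    by (intro typeof_apps_iotas) (use f args in auto)
  then have "typeof \<Sigma> \<Gamma> F = Some (iotas m)"
    unfolding Fdef using typeof_Lams[of \<Sigma> m "iotas m # \<Gamma>" ?B] by simp
  moreover have "beta_normal ?B" using fo by (auto simp: beta_normal_apps neutral_apps dest: fot_type)
  ultimately show ?thesis unfolding Fdef by (simp add: beta_normal_Lams)
qed

lemma ug_type: "ug \<Sigma> \<Gamma> n M \<Longrightarrow> typeof \<Sigma> \<Gamma> M = Some Iota \<and> beta_normal M"
proof (induction rule: ug.induct)
  case (ug_Fix Ms F)
  have "typeof \<Sigma> \<Gamma> (apps F Ms) = Some Iota"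
    using guarded_fix_type[OF ug_Fix(1), of \<Gamma>] ug_Fix(2)
    by (intro typeof_apps_iotas) (auto dest: fot_type)
  moreover obtain \<tau> B where "F = Fix \<tau> B" "beta_normal F"
    using guarded_fix_type[OF ug_Fix(1)] by blast
  then have "beta_normal (apps F Ms)"
    using ug_Fix(2) by (auto simp: beta_normal_apps dest: fot_type)
  ultimately show ?case by simp
next
  case (ug_Con f Ls Ls' n X)
  have "typeof \<Sigma> \<Gamma> (apps (Con f) (Ls @ [X] @ Ls')) = Some Iota"
    using ug_Con by (intro typeof_apps_iotas) (auto dest: fot_type)
  moreover have "beta_normal (apps (Con f) (Ls @ [X] @ Ls'))"
    using ug_Con by (auto simp: beta_normal_apps neutral_apps dest: fot_type)
  ultimately show ?case by simp
qed

lemma beta_nf_rigid_apps: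
  assumes "rigid_head h" "beta_nf (apps h Ms) N"
  obtains Ns where "N = apps h Ns" "list_all2 beta_nf Ms Ns"
proof -
  obtain Ns where "N = apps h Ns" "list_all2 betas Ms Ns"
    using steps_rigid_apps[OF assms(1), of True False Ms N] assms(2) by (auto simp: step_beta beta_nf_def)
  moreover have "beta_normal (apps h Ns)" using calculation(1) assms(2) by (simp add: beta_nf_def)
  then have "\<forall>N\<in>set Ns. beta_normal N" by (simp add: beta_normal_apps)
  ultimately show ?thesis using that by (auto simp: list_all2_conv_all_nth beta_nf_def)
qed

text \<open>A rigid head offers no redex, so the step works inside one argument. The other arguments
  are normal already, and uniqueness of normal forms leaves them alone.\<close>

lemma rigid_apps_rstep:
  assumes "rigid_head h" "\<forall>M\<in>set Ms. beta_normal M" "fix_at p (apps h Ms) K" "beta_nf K N"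
  obtains i q K' N' where "i < length Ms" "p = replicate (length Ms - Suc i) 0 @ 1 # q"
    "fix_at q (Ms ! i) K'" "beta_nf K' N'" "N = apps h (Ms[i := N'])"
proof -
  have "\<not> fix_at q h h'" for q h' using assms(1) by (auto simp: rigid_head_def)
  with fix_at_apps[OF assms(3)] obtain i q K' where i: "i < length Ms"
    "p = replicate (length Ms - Suc i) 0 @ 1 # q" "fix_at q (Ms ! i) K'" "K = apps h (Ms[i := K'])"
    by blast
  obtain Ns where Ns: "N = apps h Ns" "list_all2 beta_nf (Ms[i := K']) Ns"
    using beta_nf_rigid_apps[OF assms(1)] assms(4) i(4) by blast
  have "Ns ! j = Ms ! j" if "j < length Ms" "j \<noteq> i" for j
  proof -
    have "beta_nf (Ms ! j) (Ns ! j)" using Ns(2) that by (auto simp: list_all2_conv_all_nth)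
    moreover have "beta_nf (Ms ! j) (Ms ! j)" using assms(2) that by (simp add: beta_nf_normal)
    ultimately show ?thesis using beta_nf_unique by blast
  qed
  moreover have len: "length Ns = length Ms" using list_all2_lengthD[OF Ns(2)] by simp
  ultimately have "Ns = Ms[i := Ns ! i]"
    using i(1) by (intro nth_equalityI) (auto simp: nth_list_update)
  moreover have "beta_nf K' (Ns ! i)" using Ns(2) i(1) by (auto simp: list_all2_conv_all_nth)
  ultimately show ?thesis using that i Ns(1) by metis
qed

text \<open>The first-order arguments contain no redex, so the step happens at the fixed point below
  the chain of constants and lengthens this chain by one.\<close>

lemma ug_step: "ug \<Sigma> \<Gamma> n M \<Longrightarrow> fix_at p M K \<Longrightarrow> beta_nf K N \<Longrightarrow> ug \<Sigma> \<Gamma> (Suc n) N"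
proof (induction arbitrary: p K N rule: ug.induct)
  case (ug_Fix Ms F)
  obtain K0 f Ls Ls' Ns where "fix_at (replicate (length Ms) 0) (apps F Ms) K0" and *:
    "\<forall>p K'. fix_at p (apps F Ms) K' \<longrightarrow> p = replicate (length Ms) 0 \<and> K' = K0"
    "betas K0 (apps (Con f) (Ls @ [apps F Ns] @ Ls'))" "length Ns = length Ms"
    "\<Sigma> f = Some (iotas (length Ls + length Ls' + 1))"
    "\<forall>M \<in> set Ls \<union> set Ls' \<union> set Ns. fot \<Sigma> \<Gamma> M Iota"
    by (rule guarded_unfold[OF ug_Fix(1,2)]) blast
  have "ug \<Sigma> \<Gamma> (Suc 0) (apps (Con f) (Ls @ [apps F Ns] @ Ls'))"
    using * ug_Fix(1) by (intro ug.intros) auto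
  moreover from ug_type[OF this] have "beta_nf K0 (apps (Con f) (Ls @ [apps F Ns] @ Ls'))"
    using *(2) by (simp add: beta_nf_def)
  moreover have "K = K0" using *(1) ug_Fix(3) by blast
  ultimately show ?case using beta_nf_unique[OF ug_Fix(4)] by simp
next
  case (ug_Con f Ls Ls' n X)
  let ?Ms = "Ls @ [X] @ Ls'"
  have normal: "\<forall>M\<in>set ?Ms. beta_normal M" using ug_Con(2,3) by (auto dest: fot_type ug_type)
  obtain i q K' N' where "p = replicate (length ?Ms - Suc i) 0 @ 1 # q" and
    i: "i < length ?Ms" "fix_at q (?Ms ! i) K'" "beta_nf K' N'" "N = apps (Con f) (?Ms[i := N'])"
    by (rule rigid_apps_rstep[OF rigid_head_simps(2) normal ug_Con.prems]) blast
  have "i = length Ls"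
  proof (rule ccontr)
    assume "i \<noteq> length Ls"
    then have "?Ms ! i \<in> set Ls \<union> set Ls'" using i(1) by (auto simp: nth_append nth_Cons')
    then show False using ug_Con(2) fot_nofix i(2) unfolding nofix_def by blast
  qed
  then have "ug \<Sigma> \<Gamma> (Suc n) N'" "N = apps (Con f) (Ls @ [N'] @ Ls')"
    using i ug_Con.IH[of q K' N'] by auto
  then show ?case using ug.ug_Con[OF ug_Con(1,2)] by blast
qed

lemma ug_redex: "ug \<Sigma> \<Gamma> n M \<Longrightarrow> \<exists>p. redex_at p M"
proof (induction rule: ug.induct)
  case (ug_Fix Ms F)
  show ?case unfolding redex_at_def by (rule guarded_unfold[OF ug_Fix(1,2)]) blast
next
  case (ug_Con f Ls Ls' n X)
  then obtain q K where "fix_at q X K" unfolding redex_at_def by blast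
  then have "fix_at q ((Ls @ [X] @ Ls') ! length Ls) K" by simp
  from fix_at_apps_arg[OF _ this, of "Con f"] show ?case unfolding redex_at_def by auto
qed

text \<open>Coinduction on the union of unfolded guarded terms and first-order terms: at most one
  further unfolding exposes a constant whose arguments are again of these two kinds.\<close>

lemma ug_ct:
  assumes "ug \<Sigma> \<Gamma> n M"
  shows "ct \<Sigma> (length \<Gamma>) M"
proof -
  have "ct \<Sigma> (length \<Gamma>) M" if "(\<exists>n. ug \<Sigma> \<Gamma> n M) \<or> (\<exists>\<tau>. fot \<Sigma> \<Gamma> M \<tau>)" for M
    using that
  proof (coinduction arbitrary: M)
    case ct
    then show ?case
    proof (elim disjE exE)
      fix n assume "ug \<Sigma> \<Gamma> n M"
      then obtain f Ls Ls' m X where M: "fixbeta_eq M (apps (Con f) (Ls @ [X] @ Ls'))" "ug \<Sigma> \<Gamma> m X"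
        "\<Sigma> f = Some (iotas (length Ls + length Ls' + 1))" "\<forall>M \<in> set Ls \<union> set Ls'. fot \<Sigma> \<Gamma> M Iota"
      proof (cases rule: ug.cases)
        case (ug_Fix Ms F)
        obtain K f Ls Ls' Ns where
          "\<forall>p K'. fix_at p (apps F Ms) K' \<longrightarrow> p = replicate (length Ms) 0 \<and> K' = K" and
          *: "fix_at (replicate (length Ms) 0) (apps F Ms) K"
          "betas K (apps (Con f) (Ls @ [apps F Ns] @ Ls'))" "length Ns = length Ms"
          "\<Sigma> f = Some (iotas (length Ls + length Ls' + 1))"
          "\<forall>M \<in> set Ls \<union> set Ls' \<union> set Ns. fot \<Sigma> \<Gamma> M Iota"
          by (rule guarded_unfold[OF ug_Fix(3,4)]) blast
        have "red (apps F Ms) K" using *(1) by (auto simp: step_def fix_step_def)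
        then have "reds M (apps (Con f) (Ls @ [apps F Ns] @ Ls'))"
          using beta_red[OF *(2)] ug_Fix(2) by (meson converse_rtranclp_into_rtranclp)
        moreover have "ug \<Sigma> \<Gamma> 0 (apps F Ns)" using *(3,5) ug_Fix(3) by (intro ug.intros) auto
        ultimately show ?thesis using that * by (blast intro: red_conv)
      next
        case (ug_Con f Ls Ls' m X)
        then show ?thesis using that[of f Ls X Ls' m] by simp
      qed
      then have "length (Ls @ [X] @ Ls') = length (arg_tys (iotas (length Ls + length Ls' + 1)))"
        by (simp add: length_arg_tys_iotas)
      moreover have "(\<exists>n. ug \<Sigma> \<Gamma> n N) \<or> (\<exists>\<tau>. fot \<Sigma> \<Gamma> N \<tau>)" if "N \<in> set (Ls @ [X] @ Ls')" for N
        using that M(2,4) by auto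
      ultimately show ?thesis using M(1,3) by blast
    next
      fix \<tau> assume "fot \<Sigma> \<Gamma> M \<tau>"
      then have "ct \<Sigma> (length \<Gamma>) M" by (rule fot_ct)
      then show ?thesis by (cases rule: ct.cases) blast+
    qed
  qed
  then show ?thesis using assms by blast
qed

subsection \<open>Snapshots\<close>

lemma map_tm_apps: "map_tm g (apps h Ms) = apps (map_tm g h) (map (map_tm g) Ms)"
  by (induction Ms rule: rev_induct) auto

lemma fot_map:
  "fot \<Sigma> \<Gamma> M \<tau> \<Longrightarrow> fot (sig_diamond \<Sigma>) \<Gamma> (map_tm Some M) \<tau>"
proof (induction rule: fot.induct)
  case (fot_Con c ts \<tau> Ms)
  then have "list_all2 (fot (sig_diamond \<Sigma>) \<Gamma>) (map (map_tm Some) Ms) ts"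
    by (auto simp: list_all2_conv_all_nth)
  then show ?case using fot_Con by (auto simp: map_tm_apps sig_diamond_def intro: fot.intros)
qed (auto intro: fot.intros)

lemma guarded_full_head:
  assumes "guarded_full \<Sigma> \<Gamma> M" "\<not> fo_term \<Sigma> \<Gamma> M"
  shows "\<exists>\<tau> K. head M = Fix \<tau> K"
proof -
  obtain F Ms where "M = apps F Ms" "guarded_fix \<Sigma> (length Ms) F"
    using assms unfolding guarded_full_def by blast
  moreover from this obtain \<tau> B where "F = Fix \<tau> B" using guarded_fix_type by blast
  ultimately show ?thesis by simp
qed

text \<open>A guarded full term that is not first-order is headed by a fixed point, so a
  constant-headed application is never replaced by \<diamond>.\<close>

lemma snapshot_apps: "snapshot \<Sigma> \<Gamma> (apps (Con c) Ms) = apps (Con (Some c)) (map (snapshot \<Sigma> \<Gamma>) Ms)"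
proof (induction Ms rule: rev_induct)
  case (snoc M Ms)
  have "\<not> (guarded_full \<Sigma> \<Gamma> (App (apps (Con c) Ms) M) \<and> \<not> fo_term \<Sigma> \<Gamma> (App (apps (Con c) Ms) M))"
    using guarded_full_head[of \<Sigma> \<Gamma> "App (apps (Con c) Ms) M"] by auto
  then show ?case using snoc by auto
qed simp

lemma fot_snapshot: "fot \<Sigma> \<Gamma> M \<tau> \<Longrightarrow> snapshot \<Sigma> \<Gamma> M = map_tm Some M"
proof (induction rule: fot.induct)
  case (fot_Con c ts \<tau> Ms)
  have "map (snapshot \<Sigma> \<Gamma>) Ms = map (map_tm Some) Ms"
    using list_all2_set1[OF fot_Con(4)] by auto
  then show ?case by (simp only: snapshot_apps map_tm_apps tm.map)
qed simp

lemma ug_Fix_snapshot: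
  assumes "guarded_fix \<Sigma> (length Ms) F" "\<forall>M\<in>set Ms. fot \<Sigma> \<Gamma> M Iota"
  shows "snapshot \<Sigma> \<Gamma> (apps F Ms) = Con None"
proof -
  have "guarded_full \<Sigma> \<Gamma> (apps F Ms)"
    unfolding guarded_full_def using assms
    by (intro disjI2 exI[of _ F] exI[of _ Ms]) (auto simp: fo_term_iff wt_def dest: fot_type)
  moreover have "\<not> fo_term \<Sigma> \<Gamma> (apps F Ms)"
    using fot_nofix ug_redex[OF ug_Fix[OF assms]] unfolding fo_term_iff nofix_def redex_at_def by blast
  moreover obtain \<tau> B where "F = Fix \<tau> B" using guarded_fix_type[OF assms(1)] by blast
  ultimately show ?thesis by (cases Ms rule: rev_cases) auto
qed

lemma ug_snapshot: "ug \<Sigma> \<Gamma> n M \<Longrightarrow> fot (sig_diamond \<Sigma>) \<Gamma> (snapshot \<Sigma> \<Gamma> M) Iota"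
proof (induction rule: ug.induct)
  case (ug_Fix Ms F)
  have "fot (sig_diamond \<Sigma>) \<Gamma> (apps (Con None) []) Iota"
    by (rule fot_Con[of _ _ "[]"]) (auto simp: sig_diamond_def)
  then show ?case using ug_Fix by (simp add: ug_Fix_snapshot)
next
  case (ug_Con f Ls Ls' n X)
  have "fot (sig_diamond \<Sigma>) \<Gamma> (snapshot \<Sigma> \<Gamma> L) Iota" if "L \<in> set Ls \<union> set Ls'" for L
    using ug_Con(2) that fot_snapshot fot_map by metis
  then have "list_all2 (fot (sig_diamond \<Sigma>) \<Gamma>) (map (snapshot \<Sigma> \<Gamma>) (Ls @ [X] @ Ls'))
      (replicate (length Ls + length Ls' + 1) Iota)"
    using ug_Con.IH
    by (auto simp: list_all2_conv_all_nth nth_append nth_Cons' simp del: replicate.simps)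
  then show ?case
    using ug_Con(1) unfolding snapshot_apps
    by (intro fot_Con[of _ _ "replicate (length Ls + length Ls' + 1) Iota"])
      (auto simp: sig_diamond_def iotas_foldr)
qed

lemma tree_of_apps:
  "tree_of (apps (Con c) Ms) [] = Some (LCon c)"
  "tree_of (apps (Con c) Ms) (i # w) = (if i < length Ms then tree_of (Ms ! i) w else None)"
  by auto

lemma tree_of_map: "fot \<Sigma> \<Gamma> M \<tau> \<Longrightarrow> tree_of (map_tm Some M) w = tree_embed (BT M) w"
proof (induction arbitrary: w rule: fot.induct)
  case (fot_Var n \<tau>)
  then show ?case by (cases w) (auto simp: BT_Var tree_embed_def)
next
  case (fot_Con c ts \<tau> Ms)
  then have "\<forall>M\<in>set Ms. \<forall>w. tree_of (map_tm Some M) w = tree_embed (BT M) w"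
    by (auto dest: list_all2_set1)
  then show ?case by (cases w) (auto simp: map_tm_apps tree_embed_def)
qed

text \<open>After \<open>n\<close> unfoldings the \<diamond> sits at depth exactly \<open>n\<close>,
  whence the strict bound.\<close>

lemma ug_tree: "ug \<Sigma> \<Gamma> n M \<Longrightarrow> length w < n \<Longrightarrow> tree_of (snapshot \<Sigma> \<Gamma> M) w = tree_embed (BT M) w"
proof (induction arbitrary: w rule: ug.induct)
  case (ug_Con f Ls Ls' n X)
  show ?case
  proof (cases w)
    case Nil
    then show ?thesis unfolding snapshot_apps tree_of_apps Nil tree_embed_def BT_Con by simp
  next
    case (Cons i v)
    let ?Ms = "Ls @ [X] @ Ls'"
    have "tree_of (snapshot \<Sigma> \<Gamma> (?Ms ! i)) v = tree_embed (BT (?Ms ! i)) v" if "i < length ?Ms"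
    proof (cases "i = length Ls")
      case True
      then show ?thesis using ug_Con.IH[of v] ug_Con.prems Cons by simp
    next
      case False
      then have "?Ms ! i \<in> set Ls \<union> set Ls'" using that by (auto simp: nth_append nth_Cons')
      then show ?thesis using ug_Con(2) fot_snapshot tree_of_map by metis
    qed
    then show ?thesis
      unfolding snapshot_apps tree_of_apps Cons tree_embed_def BT_Con length_map
      by (cases "i < length ?Ms") (simp_all only: if_True if_False nth_map option.map tree_embed_def)
  qed
qed simp

subsection \<open>Unfoldings of guarded atoms\<close>

definition sarg :: "'c sig \<Rightarrow> ty list \<Rightarrow> 'c tm \<Rightarrow> ty \<Rightarrow> bool" where
  "sarg \<Sigma> \<Gamma> M \<sigma> \<longleftrightarrow> fot \<Sigma> \<Gamma> M \<sigma> \<or> \<sigma> = Iota \<and> (\<exists>n. ug \<Sigma> \<Gamma> n M)"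

text \<open>The form of all stages of a run from an atom with guarded full arguments. It is
  preserved by \<open>rstep\<close>, whereas guardedness of the arguments is lost once a fixed point
  moves below a constant.\<close>

definition satom :: "'c sig \<Rightarrow> ty list \<Rightarrow> 'c \<Rightarrow> ty list \<Rightarrow> 'c tm \<Rightarrow> bool" where
  "satom \<Sigma> \<Gamma> h ts A \<longleftrightarrow>
     A = apps (Con h) (args A) \<and> \<Sigma> h = Some (foldr (\<rightarrow>) ts Omicron) \<and> list_all2 (sarg \<Sigma> \<Gamma>) (args A) ts"

lemma satomD:
  assumes "satom \<Sigma> \<Gamma> h ts A"
  shows "A = apps (Con h) (args A)" "\<Sigma> h = Some (foldr (\<rightarrow>) ts Omicron)"
    "list_all2 (sarg \<Sigma> \<Gamma>) (args A) ts"
  using assms unfolding satom_def by auto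

lemma sarg_type: "sarg \<Sigma> \<Gamma> M \<sigma> \<Longrightarrow> typeof \<Sigma> \<Gamma> M = Some \<sigma> \<and> beta_normal M \<and> ord \<sigma> = 0 \<and> \<sigma> \<noteq> Omicron"
  unfolding sarg_def using fot_type ug_type by fastforce

lemma sarg_ct: "sarg \<Sigma> \<Gamma> M \<sigma> \<Longrightarrow> ct \<Sigma> (length \<Gamma>) M"
  unfolding sarg_def using fot_ct ug_ct by blast

lemma satom_normal: "satom \<Sigma> \<Gamma> h ts A \<Longrightarrow> \<forall>M\<in>set (args A). beta_normal M"
  unfolding satom_def by (blast dest: list_all2_set1 sarg_type)

lemma satom_type:
  assumes "satom \<Sigma> \<Gamma> h ts A"
  shows "typeof \<Sigma> \<Gamma> A = Some Omicron"
proof -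
  have "typeof \<Sigma> \<Gamma> (apps (Con h) (args A)) = Some Omicron"
    unfolding typeof_apps using assms unfolding satom_def
    by (intro exI[of _ ts]) (auto elim!: list_all2_mono dest: sarg_type)
  then show ?thesis using assms unfolding satom_def by simp
qed

lemma satom_ct:
  assumes "satom \<Sigma> \<Gamma> h ts A"
  shows "ct \<Sigma> (length \<Gamma>) A"
proof -
  note A = satomD[OF assms]
  have "fixbeta_eq A (apps (Con h) (args A))" using A(1) by simp
  moreover have "length (args A) = length (arg_tys (foldr (\<rightarrow>) ts Omicron))"
    using A(3) by (simp add: arg_tys_foldr list_all2_lengthD)
  moreover have "\<forall>M\<in>set (args A). ct \<Sigma> (length \<Gamma>) M" using A(3) by (blast dest: list_all2_set1 sarg_ct)
  ultimately show ?thesis using A(2) by (intro ct_Con)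
qed

lemma satom_predicate: "satom \<Sigma> \<Gamma> h ts A \<Longrightarrow> BT A [] = Some (LCon h) \<and> predicate \<Sigma> \<Delta> (Con h)"
  unfolding satom_def predicate_def using BT_Con(1)[of h "args A"] by (auto simp: target_foldr)

lemma guarded_full_satom:
  assumes "typeof \<Sigma> \<Gamma> (apps (Con h) Ms) = Some Omicron" "\<forall>M\<in>set Ms. guarded_full \<Sigma> \<Gamma> M"
  shows "\<exists>ts. satom \<Sigma> \<Gamma> h ts (apps (Con h) Ms)"
proof -
  obtain ts where s: "\<Sigma> h = Some (foldr (\<rightarrow>) ts Omicron)"
    "list_all2 (\<lambda>M \<sigma>. typeof \<Sigma> \<Gamma> M = Some \<sigma>) Ms ts"
    using assms(1) unfolding typeof_apps by auto
  have "sarg \<Sigma> \<Gamma> M \<sigma>" if M: "typeof \<Sigma> \<Gamma> M = Some \<sigma>" "guarded_full \<Sigma> \<Gamma> M" for M \<sigma>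
  proof (cases "fo_term \<Sigma> \<Gamma> M")
    case True
    then show ?thesis using M fo_term_wt_fot unfolding sarg_def by blast
  next
    case False
    then obtain F Ns where N: "M = apps F Ns" "guarded_fix \<Sigma> (length Ns) F"
      "\<forall>N \<in> set Ns. fo_term \<Sigma> \<Gamma> N \<and> wt \<Sigma> \<Gamma> N Iota"
      using M(2) unfolding guarded_full_def by blast
    then have "\<forall>N\<in>set Ns. fot \<Sigma> \<Gamma> N Iota" unfolding wt_def using fo_term_wt_fot by blast
    then have "ug \<Sigma> \<Gamma> 0 M" using N ug_Fix by blast
    then show ?thesis using M(1) ug_type unfolding sarg_def by fastforce
  qed
  then have "list_all2 (sarg \<Sigma> \<Gamma>) Ms ts"
    using s(2) assms(2) by (auto simp: list_all2_conv_all_nth)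
  then show ?thesis using s(1) unfolding satom_def by auto
qed

lemma fo_atom_satom:
  assumes "fo_atom \<Sigma> \<Gamma> A"
  shows "\<exists>h ts. satom \<Sigma> \<Gamma> h ts A"
proof -
  obtain c Ms where "A = apps (Con c) Ms" "\<forall>M \<in> set Ms. fo_term \<Sigma> \<Gamma> M" "typeof \<Sigma> \<Gamma> A = Some Omicron"
    using assms unfolding fo_atom_def atom_def wt_def by blast
  then show ?thesis using guarded_full_satom[of \<Sigma> \<Gamma> c Ms] unfolding guarded_full_def by blast
qed

lemma fo_atom_ct: "fo_atom \<Sigma> \<Gamma> A \<Longrightarrow> ct \<Sigma> (length \<Gamma>) A"
  by (blast dest: fo_atom_satom intro: satom_ct)

lemma fo_atom_tree_of:
  assumes "fo_atom \<Sigma> \<Gamma> A"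
  shows "tree_of A = BT A"
proof
  fix w
  obtain c Ms where A: "A = apps (Con c) Ms" "\<forall>M \<in> set Ms. fo_term \<Sigma> \<Gamma> M"
    using assms unfolding fo_atom_def by blast
  then have "tree_of M w = BT M w" if "M \<in> set Ms" for M w
    using that fot_tree_of unfolding fo_term_iff by blast
  then show "tree_of A w = BT A w" using A(1) by (cases w) auto
qed

lemma guarded_atomE:
  assumes "guarded_atom \<Sigma> \<Gamma> A"
  obtains h ts A' where "satom \<Sigma> \<Gamma> h ts A'" "fixbeta_eq A A'" "beta_normal A'"
proof -
  obtain h Ms where "atom \<Sigma> \<Gamma> (apps (Con h) Ms)" "\<forall>M \<in> set Ms. guarded_full \<Sigma> \<Gamma> M"
      "fixbeta_eq A (apps (Con h) Ms)"
    using assms unfolding guarded_atom_def by blast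
  then show ?thesis using that guarded_full_satom[of \<Sigma> \<Gamma> h Ms] unfolding atom_def wt_def by blast
qed

lemma guarded_atom_ct: "guarded_atom \<Sigma> \<Gamma> A \<Longrightarrow> ct \<Sigma> (length \<Gamma>) A"
  by (erule guarded_atomE) (blast intro: ct_conv satom_ct)

lemma satom_step:
  assumes "satom \<Sigma> \<Gamma> h ts A" "fix_at p A K" "beta_nf K B"
  obtains i q K' N' where "i < length ts" "p = replicate (length ts - Suc i) 0 @ 1 # q"
    "fix_at q (args A ! i) K'" "beta_nf K' N'" "args B = (args A)[i := N']" "satom \<Sigma> \<Gamma> h ts B"
    "\<And>n. ug \<Sigma> \<Gamma> n (args A ! i) \<Longrightarrow> ug \<Sigma> \<Gamma> (Suc n) N'" "\<exists>n. ug \<Sigma> \<Gamma> n (args A ! i)"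
proof -
  note A = satomD[OF assms(1)]
  have len: "length (args A) = length ts" using A(3) by (rule list_all2_lengthD)
  have "fix_at p (apps (Con h) (args A)) K" using assms(2) A(1) by simp
  then obtain i q K' N' where i: "i < length (args A)" "p = replicate (length (args A) - Suc i) 0 @ 1 # q"
    "fix_at q (args A ! i) K'" "beta_nf K' N'" "B = apps (Con h) ((args A)[i := N'])"
    by (rule rigid_apps_rstep[OF rigid_head_simps(2) satom_normal[OF assms(1)] _ assms(3)]) blast
  have s: "sarg \<Sigma> \<Gamma> (args A ! i) (ts ! i)" using A(3) i(1) by (auto simp: list_all2_conv_all_nth)
  moreover have "\<not> fot \<Sigma> \<Gamma> (args A ! i) \<tau>" for \<tau> using i(3) fot_nofix unfolding nofix_def by blast
  ultimately have u: "\<exists>n. ug \<Sigma> \<Gamma> n (args A ! i)" "ts ! i = Iota" unfolding sarg_def by auto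
  have st: "ug \<Sigma> \<Gamma> (Suc n) N'" if "ug \<Sigma> \<Gamma> n (args A ! i)" for n using ug_step[OF that i(3,4)] .
  have "sarg \<Sigma> \<Gamma> N' (ts ! i)" using u st unfolding sarg_def by blast
  then have "list_all2 (sarg \<Sigma> \<Gamma>) ((args A)[i := N']) ts"
    using A(3) i(1) by (auto simp: list_all2_conv_all_nth nth_list_update)
  then have "satom \<Sigma> \<Gamma> h ts B" using A(2) i(5) unfolding satom_def by simp
  then show ?thesis using that[of i q K' N'] i u(1) st len by simp
qed

lemma satom_rstep: "satom \<Sigma> \<Gamma> h ts A \<Longrightarrow> rstep A B \<Longrightarrow> satom \<Sigma> \<Gamma> h ts B"
  unfolding rstep_def using satom_step by metis

lemma satom_rsteps: "rsteps A B \<Longrightarrow> satom \<Sigma> \<Gamma> h ts A \<Longrightarrow> satom \<Sigma> \<Gamma> h ts B"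
  by (induction rule: rtranclp_induct) (auto intro: satom_rstep)

text \<open>Both atoms run to the normal form of a common reduct. The run from \<open>A'\<close>
  stays within \<open>satom\<close>, so the shared end point has this form.\<close>

lemma guarded_atom_rsteps:
  assumes "guarded_atom \<Sigma> \<Gamma> A"
  shows "\<exists>B h ts. rsteps A B \<and> satom \<Sigma> \<Gamma> h ts B"
proof -
  obtain h ts A' where A': "satom \<Sigma> \<Gamma> h ts A'" "fixbeta_eq A A'" "beta_normal A'"
    using assms by (rule guarded_atomE)
  have A: "typeof \<Sigma> \<Gamma> A = Some Omicron" "beta_normal A"
    using assms unfolding guarded_atom_def atom_def wt_def by auto
  obtain Z where Z: "reds A Z" "reds A' Z" using church_rosser[OF A'(2)] by blast
  obtain R R' where "rsteps A R" "beta_nf Z R" "rsteps A' R'" "beta_nf Z R'"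
    using red_rsteps[OF Z(1) A] red_rsteps[OF Z(2) satom_type[OF A'(1)] A'(3)] by blast
  moreover from this have "R = R'" using beta_nf_unique by blast
  ultimately have "rsteps A R" "satom \<Sigma> \<Gamma> h ts R" using satom_rsteps[OF _ A'(1)] by auto
  then show ?thesis by (intro exI conjI)
qed

subsection \<open>Fair runs\<close>

lemma rstep_conv: "rstep A B \<Longrightarrow> fixbeta_eq A B"
proof -
  assume "rstep A B"
  then obtain p K where K: "fix_at p A K" "beta_nf K B" unfolding rstep_def by blast
  then have "red A K" by (auto simp: step_def fix_step_def)
  then have "fixbeta_eq A K" by (intro red_conv r_into_rtranclp)
  then show ?thesis using beta_nf_conv[OF K(2)] by (rule conv_trans)
qed

lemma rsteps_conv: "rsteps A B \<Longrightarrow> fixbeta_eq A B"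
  by (induction rule: rtranclp_induct) (auto intro: conv_trans rstep_conv)

lemma fair_run_exists:
  assumes "typeof \<Sigma> \<Gamma> A = Some \<tau>"
  shows "\<exists>S. fair_run A S"
proof -
  \<comment> \<open>Taking the first component of a decoded pair lists every position infinitely
    often.\<close>
  define en :: "nat \<Rightarrow> nat list" where "en k = list_decode (fst (prod_decode k))" for k
  have en: "\<exists>j\<ge>k. en j = p" for p k
    by (rule exI[of _ "prod_encode (list_encode p, k)"]) (simp add: en_def le_prod_encode_2)
  \<comment> \<open>Stage \<open>k\<close> contracts the scheduled position if it is a redex and
    otherwise any redex, since a run may stand still only when none is left.\<close>
  define ps where "ps k M = (if redex_at (en k) M then en k else SOME p. redex_at p M)" for k and M :: "'a tm"
  define nx where "nx k M = (if \<exists>p. redex_at p M then SOME N. \<exists>K. fix_at (ps k M) M K \<and> beta_nf K N else M)"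
    for k and M :: "'a tm"
  define S where "S = rec_nat A nx"
  have S: "S 0 = A" "S (Suc k) = nx k (S k)" for k by (simp_all add: S_def)
  have nx: "\<exists>K. fix_at (ps k M) M K \<and> beta_nf K (nx k M)"
    if M: "typeof \<Sigma> \<Gamma> M = Some \<tau>" "\<exists>p. redex_at p M" for k and M :: "'a tm"
  proof -
    have "redex_at (ps k M) M" using M(2) by (auto simp: ps_def intro: someI_ex)
    then obtain K where K: "fix_at (ps k M) M K" by (auto simp: redex_at_def)
    then obtain N where "beta_nf K N" using typed_beta_nf[OF fix_at_typeof[OF K M(1)]] by blast
    then have "\<exists>N K. fix_at (ps k M) M K \<and> beta_nf K N" using K by blast
    from someI_ex[OF this] show ?thesis using M(2) by (simp add: nx_def)
  qed
  have ty: "typeof \<Sigma> \<Gamma> (S k) = Some \<tau>" for k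
  proof (induction k)
    case (Suc k)
    show ?case
    proof (cases "\<exists>p. redex_at p (S k)")
      case True
      from nx[OF Suc True, of k] Suc show ?thesis
        by (auto simp: S(2) beta_nf_def intro: betas_typeof fix_at_typeof)
    next
      case False
      then show ?thesis using Suc by (simp add: S(2) nx_def)
    qed
  qed (simp add: S assms)
  have "fair_run A S"
    unfolding fair_run_def
  proof (intro conjI exI[of _ "\<lambda>k. ps k (S k)"] allI impI)
    show "(\<exists>M. fix_at (ps k (S k)) (S k) M \<and> beta_nf M (S (Suc k))) \<or>
      ((\<nexists>p. redex_at p (S k)) \<and> S (Suc k) = S k)" for k
    proof (cases "\<exists>p. redex_at p (S k)")
      case True
      then show ?thesis using nx[OF ty True, of k] by (simp add: S(2))
    next
      case False
      then show ?thesis by (simp add: S(2) nx_def)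
    qed
  next
    fix p k assume p: "\<forall>j\<ge>k. redex_at p (S j)"
    obtain j where "j \<ge> k" "en j = p" using en by blast
    then show "\<exists>j\<ge>k. ps j (S j) = p" using p by (auto simp: ps_def)
  qed (simp add: S)
  then show ?thesis by blast
qed

lemma fair_run_Cons:
  assumes "rstep A B" "fair_run B S"
  shows "fair_run A (case_nat A S)"
proof -
  obtain p0 K0 where 0: "fix_at p0 A K0" "beta_nf K0 B" using assms(1) unfolding rstep_def by blast
  obtain pos where S: "S 0 = B" and
    pos: "\<forall>k. (\<exists>M. fix_at (pos k) (S k) M \<and> beta_nf M (S (Suc k))) \<or>
             ((\<nexists>p. redex_at p (S k)) \<and> S (Suc k) = S k)" and
    fair: "\<forall>p k. (\<forall>j\<ge>k. redex_at p (S j)) \<longrightarrow> (\<exists>j\<ge>k. pos j = p)"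
    using assms(2) unfolding fair_run_def by blast
  show ?thesis
    unfolding fair_run_def
  proof (intro conjI exI[of _ "case_nat p0 pos"] allI impI)
    show "(\<exists>M. fix_at (case_nat p0 pos k) (case_nat A S k) M \<and> beta_nf M (case_nat A S (Suc k))) \<or>
      ((\<nexists>p. redex_at p (case_nat A S k)) \<and> case_nat A S (Suc k) = case_nat A S k)" for k
      using 0 S pos by (cases k) auto
  next
    fix p k assume p: "\<forall>j\<ge>k. redex_at p (case_nat A S j)"
    have "redex_at p (S j)" if "j \<ge> k" for j using p[rule_format, of "Suc j"] that by simp
    then obtain j where "j \<ge> k" "pos j = p" using fair by blast
    then show "\<exists>j\<ge>k. case_nat p0 pos j = p" by (intro exI[of _ "Suc j"]) simp
  qed simp
qed

lemma fair_run_conv: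
  assumes "fair_run A S"
  shows "fixbeta_eq A (S k)"
proof (induction k)
  case 0
  then show ?case using assms unfolding fair_run_def by auto
next
  case (Suc k)
  have "fixbeta_eq (S k) (S (Suc k))"
  proof -
    consider "rstep (S k) (S (Suc k))" | "S (Suc k) = S k"
      using assms unfolding fair_run_def rstep_def by blast
    then show ?thesis by cases (auto intro: rstep_conv)
  qed
  with Suc show ?case by (rule conv_trans)
qed

lemma replicate_1_inject:
  "replicate a 0 @ 1 # xs = replicate b (0::nat) @ 1 # ys \<Longrightarrow> a = b"
proof (induction a arbitrary: b)
  case 0
  then show ?case by (cases b) auto
next
  case (Suc a)
  then show ?case by (cases b) auto
qed

text \<open>Each contraction inside an argument increases its unfolding depth by one. If the depth
  stopped growing, the argument would stay constant and its redex would keep its position forever,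
  against fairness.\<close>

lemma fair_run_satom_progress:
  assumes run: "fair_run A S" and A: "satom \<Sigma> \<Gamma> h ts A"
  shows "\<forall>k. satom \<Sigma> \<Gamma> h ts (S k)"
    and "i < length ts \<Longrightarrow>
      \<forall>\<^sub>F k in sequentially. fot \<Sigma> \<Gamma> (args (S k) ! i) (ts ! i) \<or> (\<exists>m\<ge>n. ug \<Sigma> \<Gamma> m (args (S k) ! i))"
proof -
  obtain pos where S: "S 0 = A" and
    pos: "\<forall>k. (\<exists>M. fix_at (pos k) (S k) M \<and> beta_nf M (S (Suc k))) \<or>
             ((\<nexists>p. redex_at p (S k)) \<and> S (Suc k) = S k)" and
    fair: "\<forall>p k. (\<forall>j\<ge>k. redex_at p (S j)) \<longrightarrow> (\<exists>j\<ge>k. pos j = p)"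
    using run unfolding fair_run_def by blast
  show sat: "\<forall>k. satom \<Sigma> \<Gamma> h ts (S k)"
  proof
    show "satom \<Sigma> \<Gamma> h ts (S k)" for k
    proof (induction k)
      case (Suc k)
      then show ?case using pos[rule_format, of k] satom_rstep[OF Suc] unfolding rstep_def by auto
    qed (simp add: S A)
  qed
  assume i: "i < length ts"
  \<comment> \<open>Depth at least \<open>n\<close>, rather than exactly \<open>n\<close>, makes the
    property persist along the run.\<close>
  define G where "G n k \<longleftrightarrow> fot \<Sigma> \<Gamma> (args (S k) ! i) (ts ! i) \<or> (\<exists>m\<ge>n. ug \<Sigma> \<Gamma> m (args (S k) ! i))" for n k
  have len: "length (args (S k)) = length ts" for k
    using sat[rule_format, of k] unfolding satom_def by (auto dest: list_all2_lengthD)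
  have step: "args (S (Suc k)) ! i = args (S k) ! i \<and>
      (\<forall>q. redex_at (pos k) (S k) \<longrightarrow> pos k \<noteq> replicate (length ts - Suc i) 0 @ 1 # q) \<or>
      (\<exists>m. ug \<Sigma> \<Gamma> m (args (S k) ! i)) \<and>
      (\<forall>m. ug \<Sigma> \<Gamma> m (args (S k) ! i) \<longrightarrow> ug \<Sigma> \<Gamma> (Suc m) (args (S (Suc k)) ! i))" for k
  proof -
    from pos consider M where "fix_at (pos k) (S k) M" "beta_nf M (S (Suc k))"
      | "\<not> redex_at (pos k) (S k)" "S (Suc k) = S k" by blast
    then show ?thesis
    proof cases
      case 1
      obtain i' q K' N' where *: "i' < length ts" "pos k = replicate (length ts - Suc i') 0 @ 1 # q"
        "args (S (Suc k)) = (args (S k))[i' := N']"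
        "\<And>n. ug \<Sigma> \<Gamma> n (args (S k) ! i') \<Longrightarrow> ug \<Sigma> \<Gamma> (Suc n) N'" "\<exists>n. ug \<Sigma> \<Gamma> n (args (S k) ! i')"
        by (rule satom_step[OF sat[rule_format] 1]) blast
      show ?thesis
      proof (cases "i' = i")
        case True
        then show ?thesis using * i len by simp
      next
        case False
        then have "length ts - Suc i' \<noteq> length ts - Suc i" using *(1) i by linarith
        then show ?thesis using * False replicate_1_inject by (metis nth_list_update_neq)
      qed
    qed simp
  qed
  have stable: "G n (Suc k)" if "G n k" for n k
    using step[of k] that unfolding G_def
  proof (elim disjE conjE exE)
    fix m m' assume "fot \<Sigma> \<Gamma> (args (S k) ! i) (ts ! i)" "ug \<Sigma> \<Gamma> m (args (S k) ! i)"
    then have False using fot_nofix ug_redex unfolding nofix_def redex_at_def by blast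
    then show "fot \<Sigma> \<Gamma> (args (S (Suc k)) ! i) (ts ! i) \<or> (\<exists>m\<ge>n. ug \<Sigma> \<Gamma> m (args (S (Suc k)) ! i))" ..
  next
    fix m m' assume "m' \<ge> n" "ug \<Sigma> \<Gamma> m' (args (S k) ! i)"
      "\<forall>m. ug \<Sigma> \<Gamma> m (args (S k) ! i) \<longrightarrow> ug \<Sigma> \<Gamma> (Suc m) (args (S (Suc k)) ! i)"
    then show "fot \<Sigma> \<Gamma> (args (S (Suc k)) ! i) (ts ! i) \<or> (\<exists>m\<ge>n. ug \<Sigma> \<Gamma> m (args (S (Suc k)) ! i))"
      by (meson le_SucI)
  qed auto
  have stable_le: "G n j" if "G n k" "k \<le> j" for n k j
    using that(2,1) by (induction rule: dec_induct) (auto intro: stable)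
  have "\<exists>k. G n k"
  proof (induction n)
    case 0
    have "sarg \<Sigma> \<Gamma> (args (S 0) ! i) (ts ! i)"
      using sat[rule_format, of 0] i unfolding satom_def by (auto simp: list_all2_conv_all_nth)
    then show ?case unfolding G_def sarg_def by blast
  next
    case (Suc n)
    then obtain k where k: "G n k" by blast
    show ?case
    proof (rule ccontr)
      assume "\<nexists>k. G (Suc n) k"
      then have no: "\<not> G (Suc n) k" for k by blast
      \<comment> \<open>Depth at least \<open>n\<close> but not \<open>Suc n\<close> leaves exactly
        \<open>n\<close>.\<close>
      have un: "ug \<Sigma> \<Gamma> n (args (S j) ! i)" if "j \<ge> k" for j
        using stable_le[OF k that] no[of j] unfolding G_def by (metis le_antisym not_less_eq_eq)
      have const: "args (S (Suc j)) ! i = args (S j) ! i \<and>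
        (\<forall>q. redex_at (pos j) (S j) \<longrightarrow> pos j \<noteq> replicate (length ts - Suc i) 0 @ 1 # q)" if "j \<ge> k" for j
        using step[of j] un[OF that] no[of "Suc j"] unfolding G_def by blast
      have eq: "args (S j) ! i = args (S k) ! i" if "j \<ge> k" for j
        using that by (induction rule: dec_induct) (use const in auto)
      obtain q K where q: "fix_at q (args (S k) ! i) K"
        using ug_redex[OF un[of k]] unfolding redex_at_def by blast
      let ?p = "replicate (length ts - Suc i) 0 @ 1 # q"
      have "redex_at ?p (S j)" if "j \<ge> k" for j
      proof -
        have "fix_at ?p (apps (Con h) (args (S j))) (apps (Con h) ((args (S j))[i := K]))"
          using fix_at_apps_arg[of i "args (S j)" q K "Con h"] i len eq[OF that] q by simp
        moreover have "S j = apps (Con h) (args (S j))" using sat unfolding satom_def by blast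
        ultimately show ?thesis unfolding redex_at_def by metis
      qed
      then obtain j where "j \<ge> k" "pos j = ?p" "redex_at ?p (S j)" using fair by metis
      then show False using const[of j] by auto
    qed
  qed
  then obtain k where "G n k" by blast
  then show "\<forall>\<^sub>F k in sequentially. fot \<Sigma> \<Gamma> (args (S k) ! i) (ts ! i) \<or> (\<exists>m\<ge>n. ug \<Sigma> \<Gamma> m (args (S k) ! i))"
    unfolding eventually_sequentially using stable_le unfolding G_def by blast
qed

subsection \<open>The tree of a guarded atom\<close>

lemma satom_snapshot:
  assumes "satom \<Sigma> \<Gamma> h ts A"
  shows "fo_atom (sig_diamond \<Sigma>) \<Gamma> (snapshot \<Sigma> \<Gamma> A)"
proof -
  note A = satomD[OF assms]
  let ?Ms = "map (snapshot \<Sigma> \<Gamma>) (args A)"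
  have snap: "snapshot \<Sigma> \<Gamma> A = apps (Con (Some h)) ?Ms" by (subst A(1)) (rule snapshot_apps)
  have "fot (sig_diamond \<Sigma>) \<Gamma> (snapshot \<Sigma> \<Gamma> M) \<sigma>" if "sarg \<Sigma> \<Gamma> M \<sigma>" for M \<sigma>
    using that unfolding sarg_def using fot_snapshot fot_map ug_snapshot by metis
  then have fot: "list_all2 (fot (sig_diamond \<Sigma>) \<Gamma>) ?Ms ts"
    using A(3) by (auto simp: list_all2_conv_all_nth)
  have h: "sig_diamond \<Sigma> (Some h) = Some (foldr (\<rightarrow>) ts Omicron)" using A(2) by (simp add: sig_diamond_def)
  have "typeof (sig_diamond \<Sigma>) \<Gamma> (apps (Con (Some h)) ?Ms) = Some Omicron"
    unfolding typeof_apps using h fot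
    by (intro exI[of _ ts]) (auto simp: list_all2_conv_all_nth dest: fot_type)
  moreover have "beta_normal (apps (Con (Some h)) ?Ms)"
    using fot by (auto simp: beta_normal_apps dest!: list_all2_set1 fot_type)
  moreover have "predicate (sig_diamond \<Sigma>) \<Gamma> (Con (Some h))"
    using h by (simp add: predicate_def target_foldr)
  ultimately have atom: "atom (sig_diamond \<Sigma>) \<Gamma> (apps (Con (Some h)) ?Ms)"
    unfolding atom_def wt_def by blast
  have "\<forall>\<sigma>\<in>set ts. ord \<sigma> = 0 \<and> \<sigma> \<noteq> Omicron"
    using A(3) by (auto simp: list_all2_conv_all_nth in_set_conv_nth) (metis sarg_type)+
  then have "fo_pred (sig_diamond \<Sigma>) (Some h)"
    using h ord_foldr[of ts Omicron] by (auto simp: fo_pred_def target_foldr arg_tys_foldr)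
  moreover have "\<forall>M\<in>set ?Ms. fo_term (sig_diamond \<Sigma>) \<Gamma> M"
    unfolding fo_term_iff using fot by (blast dest: list_all2_set1)
  ultimately show ?thesis unfolding fo_atom_def snap using atom by blast
qed

text \<open>One level better than \<open>ug_tree\<close>: the arguments lie below the predicate
  symbol, so \<open>n\<close> unfoldings settle the labels up to and including depth
  \<open>n\<close>.\<close>

lemma satom_snapshot_tree:
  assumes "satom \<Sigma> \<Gamma> h ts A"
    and n: "\<And>i. i < length ts \<Longrightarrow> fot \<Sigma> \<Gamma> (args A ! i) (ts ! i) \<or> (\<exists>m\<ge>n. ug \<Sigma> \<Gamma> m (args A ! i))"
    and "length w \<le> n"
  shows "tree_of (snapshot \<Sigma> \<Gamma> A) w = tree_embed (BT A) w"
proof -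
  have A: "A = apps (Con h) (args A)" and len: "length (args A) = length ts"
    using assms(1) unfolding satom_def by (auto dest: list_all2_lengthD)
  have "tree_of (apps (Con (Some h)) (map (snapshot \<Sigma> \<Gamma>) (args A))) w = tree_embed (BT (apps (Con h) (args A))) w"
  proof (cases w)
    case Nil
    then show ?thesis by (simp add: tree_embed_def)
  next
    case (Cons i v)
    have "tree_of (snapshot \<Sigma> \<Gamma> (args A ! i)) v = tree_embed (BT (args A ! i)) v" if "i < length ts"
      using n[OF that]
    proof (elim disjE exE conjE)
      assume "fot \<Sigma> \<Gamma> (args A ! i) (ts ! i)"
      then show ?thesis using fot_snapshot tree_of_map by metis
    next
      fix m assume "m \<ge> n" "ug \<Sigma> \<Gamma> m (args A ! i)"
      then show ?thesis using ug_tree assms(3) Cons by fastforce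
    qed
    then show ?thesis using Cons len by (simp add: tree_embed_def)
  qed
  then show ?thesis using A snapshot_apps by metis
qed

section \<open>Distance of trees versus agreement up to a depth\<close>

lemma tree_dist_le:
  assumes "\<And>w. length w \<le> n \<Longrightarrow> s w = t w"
  shows "tree_dist s t \<le> (1/2) ^ n"
proof (cases "s = t")
  case False
  have "trunc m s = trunc m t" if "m \<le> n" for m
    using assms that by (auto simp: trunc_def restrict_map_def)
  moreover have "\<exists>m. trunc m s \<noteq> trunc m t"
  proof -
    obtain w where "s w \<noteq> t w" using False by blast
    then have "trunc (length w) s w \<noteq> trunc (length w) t w" by (simp add: trunc_def)
    then show ?thesis by metis
  qed
  ultimately have "n < (LEAST m. trunc m s \<noteq> trunc m t)"
    by (metis (mono_tags, lifting) LeastI not_le)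
  then show ?thesis using False by (simp add: tree_dist_def power_decreasing)
qed (simp add: tree_dist_def)

lemma tree_dist_nonneg: "tree_dist s t \<ge> 0"
  by (simp add: tree_dist_def)

lemma tree_dist_less:
  assumes "tree_dist s t < (1/2) ^ n" "length w \<le> n"
  shows "s w = t w"
proof (cases "s = t")
  case False
  let ?m = "LEAST m. trunc m s \<noteq> trunc m t"
  have "(1/2) ^ ?m < ((1/2) ^ n :: real)" using assms(1) False by (simp add: tree_dist_def)
  moreover have "(1/2) ^ n \<le> ((1/2) ^ ?m :: real)" if "?m \<le> n" using that by (rule power_decreasing) simp_all
  ultimately have "n < ?m" by force
  then have "trunc n s = trunc n t" using not_less_Least by blast
  then have "trunc n s w = trunc n t w" by simp
  then show ?thesis using assms(2) by (simp add: trunc_def)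
qed simp

lemma limit_tree_rstep:
  assumes "rstep A B" "limit_tree \<Sigma> \<Gamma> B T"
  shows "limit_tree \<Sigma> \<Gamma> A T"
proof -
  obtain S where S: "fair_run B S"
    "\<forall>\<^sub>F k in sequentially. fo_atom (sig_diamond \<Sigma>) \<Gamma> (snapshot \<Sigma> \<Gamma> (S k))"
    "(\<lambda>k. tree_dist (tree_of (snapshot \<Sigma> \<Gamma> (S k))) (tree_embed T)) \<longlonglongrightarrow> 0"
    using assms(2) unfolding limit_tree_def by blast
  have "\<forall>\<^sub>F k in sequentially. fo_atom (sig_diamond \<Sigma>) \<Gamma> (snapshot \<Sigma> \<Gamma> (case_nat A S (Suc k)))"
    using S(2) by simp
  then have "\<forall>\<^sub>F k in sequentially. fo_atom (sig_diamond \<Sigma>) \<Gamma> (snapshot \<Sigma> \<Gamma> (case_nat A S k))"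
    by (subst (asm) eventually_sequentially_Suc)
  moreover have "(\<lambda>k. tree_dist (tree_of (snapshot \<Sigma> \<Gamma> (case_nat A S (Suc k)))) (tree_embed T)) \<longlonglongrightarrow> 0"
    using S(3) by simp
  then have "(\<lambda>k. tree_dist (tree_of (snapshot \<Sigma> \<Gamma> (case_nat A S k))) (tree_embed T)) \<longlonglongrightarrow> 0"
    by (rule LIMSEQ_imp_Suc)
  ultimately show ?thesis using fair_run_Cons[OF assms(1) S(1)] unfolding limit_tree_def by blast
qed

lemma guarded_atom_limit:
  assumes "guarded_atom \<Sigma> \<Gamma> A"
  shows "limit_tree \<Sigma> \<Gamma> A (BT A)"
proof -
  obtain B h ts where B: "rsteps A B" "satom \<Sigma> \<Gamma> h ts B" using guarded_atom_rsteps[OF assms] by blast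
  obtain S where S: "fair_run B S" using fair_run_exists[OF satom_type[OF B(2)]] by blast
  have limB: "limit_tree \<Sigma> \<Gamma> B (BT B)"
    unfolding limit_tree_def
  proof (intro exI conjI)
    show "fair_run B S" by (rule S)
    note sat = fair_run_satom_progress(1)[OF S B(2), rule_format]
    show "\<forall>\<^sub>F k in sequentially. fo_atom (sig_diamond \<Sigma>) \<Gamma> (snapshot \<Sigma> \<Gamma> (S k))"
      using satom_snapshot[OF sat] by simp
    let ?d = "\<lambda>k. tree_dist (tree_of (snapshot \<Sigma> \<Gamma> (S k))) (tree_embed (BT B))"
    show "?d \<longlonglongrightarrow> 0"
    proof (rule LIMSEQ_I)
      fix r :: real assume "r > 0"
      then obtain n where n: "(1/2) ^ n < r" using real_arch_pow_inv[of r "1/2"] by auto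
      \<comment> \<open>There are finitely many arguments, so one stage serves them all.\<close>
      have "\<forall>\<^sub>F k in sequentially. \<forall>i\<in>{..<length ts}.
        fot \<Sigma> \<Gamma> (args (S k) ! i) (ts ! i) \<or> (\<exists>m\<ge>n. ug \<Sigma> \<Gamma> m (args (S k) ! i))"
        using fair_run_satom_progress(2)[OF S B(2)] by (intro eventually_ball_finite) auto
      then obtain k0 where k0: "\<And>k i. k \<ge> k0 \<Longrightarrow> i < length ts \<Longrightarrow>
        fot \<Sigma> \<Gamma> (args (S k) ! i) (ts ! i) \<or> (\<exists>m\<ge>n. ug \<Sigma> \<Gamma> m (args (S k) ! i))"
        unfolding eventually_sequentially by blast
      have "norm (?d k - 0) < r" if "k \<ge> k0" for k
      proof -
        have "BT (S k) = BT B" using fair_run_conv[OF S, of k] BT_conv by metis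
        then have "tree_of (snapshot \<Sigma> \<Gamma> (S k)) w = tree_embed (BT B) w" if "length w \<le> n" for w
          using satom_snapshot_tree[OF sat, of k n w] k0[OF \<open>k \<ge> k0\<close>] that by simp
        then have "?d k \<le> (1/2) ^ n"
          by (rule tree_dist_le)
        then show ?thesis using n by (simp add: abs_of_nonneg[OF tree_dist_nonneg])
      qed
      then show "\<exists>k0. \<forall>k\<ge>k0. norm (?d k - 0) < r"
        by blast
    qed
  qed
  from B(1) have "limit_tree \<Sigma> \<Gamma> A (BT B)"
    by (induction rule: converse_rtranclp_induct) (blast intro: limB limit_tree_rstep)+
  moreover have "BT A = BT B" by (rule BT_conv[OF rsteps_conv[OF B(1)]])
  ultimately show ?thesis by simp
qed

lemma snapshot_head:
  "head (snapshot \<Sigma> \<Gamma> M) = Con (Some c) \<Longrightarrow> head M = Con c \<and> args (snapshot \<Sigma> \<Gamma> M) = map (snapshot \<Sigma> \<Gamma>) (args M)"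
  "head (snapshot \<Sigma> \<Gamma> M) = Var n \<Longrightarrow> head M = Var n"
  by (induction M) (auto split: if_splits)

text \<open>Covers atoms as well as terms, because the induction on paths starts at an atom and
  continues in its arguments.\<close>

definition fo_spine :: "'c sig \<Rightarrow> ty list \<Rightarrow> 'c tm \<Rightarrow> bool" where
  "fo_spine \<Sigma> \<Gamma> X \<longleftrightarrow> (\<exists>n. X = Var n) \<or> (\<exists>c Ms. X = apps (Con c) Ms \<and> (\<forall>M\<in>set Ms. fo_term \<Sigma> \<Gamma> M))"

lemma fo_term_spine: "fo_term \<Sigma> \<Gamma> X \<Longrightarrow> fo_spine \<Sigma> \<Gamma> X"
  unfolding fo_term_iff fo_spine_def by (elim exE, erule fot.cases) (blast dest: list_all2_set1)+

text \<open>\<open>tree_embed T\<close> never carries the label of \<diamond>. Where the snapshot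
  agrees with it, nothing on the path has been replaced, and the labels are those of
  \<open>M\<close> itself. Uniqueness of limits uses this for a \<open>T\<close> not yet known to be
  a tree.\<close>

lemma snapshot_tree_BT:
  "fo_spine \<Sigma>' \<Gamma> (snapshot \<Sigma> \<Gamma> M) \<Longrightarrow>
    (\<And>v. length v \<le> length w \<Longrightarrow> tree_of (snapshot \<Sigma> \<Gamma> M) v = tree_embed T v) \<Longrightarrow>
    T w = Some l \<Longrightarrow> BT M w = Some l"
proof (induction w arbitrary: M T)
  case Nil
  have "head_label (head (snapshot \<Sigma> \<Gamma> M)) = Some (map_label Some l)"
    using Nil.prems(2)[of "[]"] Nil.prems(3) by (simp add: tree_embed_def)
  then consider c where "head (snapshot \<Sigma> \<Gamma> M) = Con (Some c)" "l = LCon c"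
    | n where "head (snapshot \<Sigma> \<Gamma> M) = Var n" "l = LVar n"
    by (cases "head (snapshot \<Sigma> \<Gamma> M)"; cases l) auto
  then show ?case
  proof cases
    case (1 c)
    then show ?thesis using snapshot_head(1)[OF 1(1)] BT_Con(1)[of c "args M"] by (metis apps_head_args)
  next
    case (2 n)
    then show ?thesis using snapshot_head(2)[OF 2(1)] BT_rigid(1)[of "Var n" "args M"]
      by (metis apps_head_args head_label.simps(2))
  qed
next
  case (Cons i w)
  let ?X = "snapshot \<Sigma> \<Gamma> M"
  have some: "tree_of ?X (i # w) = Some (map_label Some l)"
    using Cons.prems(2)[of "i # w"] Cons.prems(3) by (simp add: tree_embed_def)
  then obtain c Ms where X: "?X = apps (Con c) Ms" "\<forall>M\<in>set Ms. fo_term \<Sigma>' \<Gamma> M"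
    using Cons.prems(1) unfolding fo_spine_def by auto
  have "tree_of ?X [] = tree_embed T []" using Cons.prems(2)[of "[]"] by simp
  then have "map_option (map_label Some) (T []) = Some (LCon c)" using X(1) by (simp add: tree_embed_def)
  then obtain l0 where "map_label Some l0 = LCon c" by auto
  then obtain c' where c': "c = Some c'" by (cases l0) auto
  have M: "head M = Con c'" "Ms = map (snapshot \<Sigma> \<Gamma>) (args M)"
    using snapshot_head(1)[of \<Sigma> \<Gamma> M c'] X(1) c' by auto
  have i: "i < length (args M)" using some X(1) M(2) by (auto split: if_splits)
  have sub: "tree_of (snapshot \<Sigma> \<Gamma> (args M ! i)) v = tree_of ?X (i # v)" for v
    using X(1) M(2) i by simp
  have "BT (args M ! i) w = Some l"
  proof (rule Cons.IH[of _ "\<lambda>v. T (i # v)"])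
    have "snapshot \<Sigma> \<Gamma> (args M ! i) \<in> set Ms" using M(2) i by auto
    then show "fo_spine \<Sigma>' \<Gamma> (snapshot \<Sigma> \<Gamma> (args M ! i))" using X(2) fo_term_spine by blast
    show "tree_of (snapshot \<Sigma> \<Gamma> (args M ! i)) v = tree_embed (\<lambda>v. T (i # v)) v" if "length v \<le> length w" for v
      using Cons.prems(2)[of "i # v"] that by (simp only: sub) (simp add: tree_embed_def)
  qed (use Cons.prems(3) in simp)
  then show ?case using BT_Con(2)[of c' "args M" i w] i M(1) by (metis apps_head_args)
qed

text \<open>Trees are maximal: the label at a node fixes its number of children, so a tree included
  in another one already has all its nodes.\<close>

lemma is_tree_le_eq:
  assumes "is_tree \<Sigma> T" "is_tree \<Sigma> T'" "\<And>w l. T w = Some l \<Longrightarrow> T' w = Some l"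
  shows "T = T'"
proof
  have "T w \<noteq> None" if "T' w \<noteq> None" for w
    using that
  proof (induction w rule: rev_induct)
    case Nil
    then show ?case using assms(1) unfolding is_tree_def by blast
  next
    case (snoc i w)
    then obtain l where l: "T' w = Some l" "i < arity \<Sigma> l" using assms(2) unfolding is_tree_def by blast
    then have "T w = Some l" using snoc.IH assms(3) by fastforce
    then have "w @ [i] \<in> dom T" using l(2) assms(1) unfolding is_tree_def by blast
    then show ?case by blast
  qed
  then show "T w = T' w" for w using assms(3) by (metis not_Some_eq)
qed

lemma arity_diamond: "arity (sig_diamond \<Sigma>) (map_label Some l) = arity \<Sigma> l"
  by (cases l) (auto simp: sig_diamond_def)

text \<open>Agreement with snapshots to every finite depth makes \<open>T\<close> a tree included in
  \<open>BT A\<close>, and by maximality of trees the inclusion is an equality.\<close>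

lemma limit_tree_unique:
  assumes "ct \<Sigma> (length \<Gamma>) A" "limit_tree \<Sigma> \<Gamma> A T"
  shows "T = BT A"
proof -
  obtain S where S: "fair_run A S"
    "\<forall>\<^sub>F k in sequentially. fo_atom (sig_diamond \<Sigma>) \<Gamma> (snapshot \<Sigma> \<Gamma> (S k))"
    "(\<lambda>k. tree_dist (tree_of (snapshot \<Sigma> \<Gamma> (S k))) (tree_embed T)) \<longlonglongrightarrow> 0"
    using assms(2) unfolding limit_tree_def by blast
  have approx: "\<exists>k. fo_atom (sig_diamond \<Sigma>) \<Gamma> (snapshot \<Sigma> \<Gamma> (S k)) \<and>
    (\<forall>w. length w \<le> n \<longrightarrow> tree_of (snapshot \<Sigma> \<Gamma> (S k)) w = tree_embed T w)" for n
  proof -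
    have "\<forall>\<^sub>F k in sequentially. tree_dist (tree_of (snapshot \<Sigma> \<Gamma> (S k))) (tree_embed T) < (1/2) ^ n"
      using S(3) by (rule order_tendstoD) simp
    with S(2) have "\<forall>\<^sub>F k in sequentially. fo_atom (sig_diamond \<Sigma>) \<Gamma> (snapshot \<Sigma> \<Gamma> (S k)) \<and>
      tree_dist (tree_of (snapshot \<Sigma> \<Gamma> (S k))) (tree_embed T) < (1/2) ^ n" by (rule eventually_conj)
    then obtain k where "fo_atom (sig_diamond \<Sigma>) \<Gamma> (snapshot \<Sigma> \<Gamma> (S k))"
      "tree_dist (tree_of (snapshot \<Sigma> \<Gamma> (S k))) (tree_embed T) < (1/2) ^ n"
      using eventually_happens'[OF sequentially_bot] by blast
    then show ?thesis using tree_dist_less by blast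
  qed
  have le: "BT A w = Some l" if "T w = Some l" for w l
  proof -
    obtain k where k: "fo_atom (sig_diamond \<Sigma>) \<Gamma> (snapshot \<Sigma> \<Gamma> (S k))"
      "\<forall>v. length v \<le> length w \<longrightarrow> tree_of (snapshot \<Sigma> \<Gamma> (S k)) v = tree_embed T v"
      using approx by blast
    then have "fo_spine (sig_diamond \<Sigma>) \<Gamma> (snapshot \<Sigma> \<Gamma> (S k))"
      unfolding fo_atom_def fo_spine_def by blast
    then have "BT (S k) w = Some l" using k(2) that by (intro snapshot_tree_BT[where T = T]) auto
    then show ?thesis using BT_conv[OF fair_run_conv[OF S(1), of k]] by simp
  qed
  have emb: "tree_embed T w = map_option (map_label Some) (T w)" for w by (simp add: tree_embed_def)
  \<comment> \<open>Being a tree is a condition on nodes and their children, so it transfers to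
    \<open>T\<close> from trees that agree with it up to any given depth.\<close>
  have tree: "\<exists>U. is_tree (sig_diamond \<Sigma>) U \<and> (\<forall>w. length w \<le> n \<longrightarrow> U w = tree_embed T w)" for n
    using approx[of n] fo_atom_ct ct_is_tree fo_atom_tree_of by metis
  have "is_tree \<Sigma> T"
    unfolding is_tree_def
  proof (intro conjI allI impI)
    obtain U where "is_tree (sig_diamond \<Sigma>) U" "U [] = tree_embed T []" using tree[of 0] by auto
    then show "T [] \<noteq> None" unfolding is_tree_def emb by auto
  next
    fix w c assume T: "T w = Some (LCon c)"
    obtain U where "is_tree (sig_diamond \<Sigma>) U" "U w = tree_embed T w" using tree[of "length w"] by auto
    then have "Some c \<in> dom (sig_diamond \<Sigma>)" using T unfolding is_tree_def emb by auto
    then show "c \<in> dom \<Sigma>" by (auto simp: sig_diamond_def)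
  next
    fix w i
    \<comment> \<open>Agreement one level below \<open>w\<close> is required to see its
      children.\<close>
    obtain U where U: "is_tree (sig_diamond \<Sigma>) U" "U w = tree_embed T w" "U (w @ [i]) = tree_embed T (w @ [i])"
      using tree[of "Suc (length w)"] by auto
    have "w @ [i] \<in> dom T \<longleftrightarrow> w @ [i] \<in> dom U" using U(3) by (auto simp: emb domIff)
    also have "\<dots> \<longleftrightarrow> (\<exists>l. U w = Some l \<and> i < arity (sig_diamond \<Sigma>) l)" using U(1) unfolding is_tree_def by blast
    also have "\<dots> \<longleftrightarrow> (\<exists>l. T w = Some l \<and> i < arity \<Sigma> l)"
      unfolding U(2) emb using arity_diamond[of \<Sigma>] by (cases "T w") auto
    finally show "w @ [i] \<in> dom T \<longleftrightarrow> (\<exists>l. T w = Some l \<and> i < arity \<Sigma> l)" .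
  qed
  then show ?thesis using is_tree_le_eq[OF _ ct_is_tree[OF assms(1)]] le by blast
qed

theorem atom_tree_eq_BT:
  assumes "guarded_atom \<Sigma> \<Gamma> A"
  shows "atom_tree \<Sigma> \<Gamma> A = BT A"
proof (cases "fo_atom \<Sigma> \<Gamma> A")
  case True
  then show ?thesis by (simp add: atom_tree_def fo_atom_tree_of)
next
  case False
  have "(THE T. limit_tree \<Sigma> \<Gamma> A T) = BT A"
    using guarded_atom_limit[OF assms] limit_tree_unique[OF guarded_atom_ct[OF assms]] by (rule the_equality)
  with False show ?thesis by (simp add: atom_tree_def)
qed

subsection \<open>Environments\<close>

text \<open>Keyed by labels rather than variables, because eigenconstants receive trees as well;
  \<open>None\<close> leaves a label untouched.\<close>

type_synonym 'c env = "'c label \<Rightarrow> 'c tree option"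

text \<open>At an undefined root the recursion still descends, as in the catch-all case of
  \<open>tree_subst\<close>, so that \<open>tree_subst_esub\<close> holds for arbitrary
  functions.\<close>

primrec esub :: "'c env \<Rightarrow> 'c tree \<Rightarrow> nat list \<Rightarrow> 'c label option" where
  "esub e t [] = (case t [] of None \<Rightarrow> None | Some l \<Rightarrow> (case e l of None \<Rightarrow> Some l | Some s \<Rightarrow> s []))"
| "esub e t (i # w) =
     (case t [] of None \<Rightarrow> esub e (\<lambda>v. t (i # v)) w
      | Some l \<Rightarrow> (case e l of None \<Rightarrow> esub e (\<lambda>v. t (i # v)) w | Some s \<Rightarrow> s (i # w)))"

definition var_env :: "(nat \<Rightarrow> 'c tree) \<Rightarrow> 'c env" where
  "var_env \<sigma> l = (case l of LCon c \<Rightarrow> None | LVar k \<Rightarrow> Some (\<sigma> k))"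

lemma tree_subst_esub: "tree_subst \<sigma> t = esub (var_env \<sigma>) t"
proof
  show "tree_subst \<sigma> t w = esub (var_env \<sigma>) t w" for w
    by (induction w arbitrary: t) (auto simp: var_env_def split: option.split label.split)
qed

lemma esub_cong:
  assumes "\<And>w l. t w = Some l \<Longrightarrow> e l = e' l"
  shows "esub e t = esub e' t"
proof
  show "esub e t w = esub e' t w" for w
    using assms
  proof (induction w arbitrary: t)
    case (Cons i w)
    have "esub e (\<lambda>v. t (i # v)) w = esub e' (\<lambda>v. t (i # v)) w" by (rule Cons.IH) (rule Cons.prems)
    then show ?case using Cons.prems[of "[]"] by (auto split: option.split)
  qed (auto split: option.split)
qed

lemma esub_None [simp]: "esub (\<lambda>_. None) t = t"
proof
  show "esub (\<lambda>_. None) t w = t w" for w by (induction w arbitrary: t) (auto split: option.split)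
qed

lemma esub_empty: "esub e (\<lambda>_. None) w = None"
  by (induction w) auto

lemma esub_Some:
  assumes "t [] = Some l" "e l = Some s"
  shows "esub e t = s"
proof
  show "esub e t w = s w" for w using assms by (cases w) auto
qed

lemma esub_Var: "e (LVar k) = Some s \<Longrightarrow> esub e (BT (Var k)) = s"
  by (rule esub_Some) (auto simp: BT_Var)

lemma esub_apps:
  assumes "e (LCon c) = None"
  shows "esub e (BT (apps (Con c) Ms)) [] = Some (LCon c)"
    and "esub e (BT (apps (Con c) Ms)) (i # w) = (if i < length Ms then esub e (BT (Ms ! i)) w else None)"
  using assms by (auto simp: esub_empty)

lemma is_tree_dom: "is_tree \<Sigma> t \<Longrightarrow> t (w @ [i]) \<noteq> None \<longleftrightarrow> (\<exists>l. t w = Some l \<and> i < arity \<Sigma> l)"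
  unfolding is_tree_def by blast

lemma is_tree_subtree:
  assumes "is_tree \<Sigma> t" "t [j] \<noteq> None"
  shows "is_tree \<Sigma> (\<lambda>v. t (j # v))"
proof -
  have "w @ [i] \<in> dom (\<lambda>v. t (j # v)) \<longleftrightarrow> (\<exists>l. t (j # w) = Some l \<and> i < arity \<Sigma> l)" for w i
    using is_tree_dom[OF assms(1), of "j # w" i] by (simp add: domIff)
  moreover have "\<forall>w c. t (j # w) = Some (LCon c) \<longrightarrow> c \<in> dom \<Sigma>" using assms(1) unfolding is_tree_def by blast
  ultimately show ?thesis using assms(2) unfolding is_tree_def by blast
qed

lemma is_tree_empty: "is_tree \<Sigma> t \<Longrightarrow> t [j] = None \<Longrightarrow> t (j # w) = None"
proof (induction w rule: rev_induct)
  case (snoc i w)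
  then show ?case using is_tree_dom[of \<Sigma> t "j # w" i] by simp
qed

text \<open>Constants that are left alone have the same arity in both signatures, and every other
  label is overwritten by a whole closed tree over \<open>\<Sigma>\<close>.\<close>

lemma esub_is_tree:
  assumes "is_tree \<Sigma>' t"
    and "\<And>w l. t w = Some l \<Longrightarrow> (e l = None \<and> (\<exists>c. l = LCon c \<and> c \<in> dom \<Sigma> \<and> \<Sigma>' c = \<Sigma> c)) \<or>
      (\<exists>s\<in>herbrand_univ \<Sigma>. e l = Some s)"
  shows "esub e t \<in> herbrand_univ \<Sigma>"
proof -
  have root: "esub e t [] \<noteq> None" if *: "t [] \<noteq> None"
    "\<And>w l. t w = Some l \<Longrightarrow> (e l = None \<and> (\<exists>c. l = LCon c \<and> c \<in> dom \<Sigma> \<and> \<Sigma>' c = \<Sigma> c)) \<or>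
      (\<exists>s\<in>herbrand_univ \<Sigma>. e l = Some s)" for t
  proof -
    obtain l where l: "t [] = Some l" using *(1) by (cases "t []") simp_all
    from *(2)[OF l] show ?thesis
    proof (elim disjE bexE conjE exE)
      fix s assume s: "s \<in> herbrand_univ \<Sigma>" "e l = Some s"
      then have "s [] \<noteq> None" unfolding herbrand_univ_def is_tree_def by blast
      then show ?thesis using esub_Some[of t l e s, OF l s(2)] by simp
    qed (use l in simp)
  qed
  have "(\<forall>c. esub e t w = Some (LCon c) \<longrightarrow> c \<in> dom \<Sigma>) \<and> (\<forall>n. esub e t w \<noteq> Some (LVar n)) \<and>
    (\<forall>i. w @ [i] \<in> dom (esub e t) \<longleftrightarrow> (\<exists>l. esub e t w = Some l \<and> i < arity \<Sigma> l))" for w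
    using assms
  proof (induction w arbitrary: t)
    case Nil
    obtain l where l: "t [] = Some l" using Nil.prems(1) by (auto simp: is_tree_def)
    from Nil.prems(2)[OF l] show ?case
    proof (elim disjE bexE conjE exE)
      fix s assume s: "s \<in> herbrand_univ \<Sigma>" "e l = Some s"
      then show ?thesis
        using esub_Some[of t l e s, OF l s(2)] unfolding herbrand_univ_def is_tree_def closed_tree_def by blast
    next
      fix c assume c: "e l = None" "l = LCon c" "c \<in> dom \<Sigma>" "\<Sigma>' c = \<Sigma> c"
      have "[i] \<in> dom (esub e t) \<longleftrightarrow> i < arity \<Sigma> l" for i
      proof -
        have "[i] \<in> dom (esub e t) \<longleftrightarrow> esub e (\<lambda>v. t (i # v)) [] \<noteq> None" using l c(1) by auto
        also have "\<dots> \<longleftrightarrow> t [i] \<noteq> None"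
          using root[of "\<lambda>v. t (i # v)"] Nil.prems(2) by (auto split: option.splits)
        also have "\<dots> \<longleftrightarrow> i < arity \<Sigma>' l"
          using is_tree_dom[OF Nil.prems(1), of "[]" i] l by simp
        also have "arity \<Sigma>' l = arity \<Sigma> l" using c by simp
        finally show ?thesis .
      qed
      then show ?thesis using l c by auto
    qed
  next
    case (Cons j w)
    obtain l where l: "t [] = Some l" using Cons.prems(1) by (auto simp: is_tree_def)
    from Cons.prems(2)[OF l] show ?case
    proof (elim disjE bexE conjE exE)
      fix s assume s: "s \<in> herbrand_univ \<Sigma>" "e l = Some s"
      then show ?thesis
        using esub_Some[of t l e s, OF l s(2)] unfolding herbrand_univ_def is_tree_def closed_tree_def by blast
    next
      fix c assume c: "e l = None" "l = LCon c"
      have sub: "esub e t (j # v) = esub e (\<lambda>v. t (j # v)) v" for v using l c by simp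
      show ?thesis
      proof (cases "t [j] = None")
        case True
        have "(\<lambda>v. t (j # v)) = (\<lambda>_. None)" using is_tree_empty[OF Cons.prems(1) True] by auto
        then have "esub e t (j # v) = None" for v unfolding sub by (simp add: esub_empty)
        then show ?thesis by (simp add: domIff)
      next
        case False
        have "is_tree \<Sigma>' (\<lambda>v. t (j # v))" using Cons.prems(1) False by (rule is_tree_subtree)
        from Cons.IH[OF this] Cons.prems(2) show ?thesis
          using sub[of w] sub[of "w @ [_]"] by (auto simp: domIff)
      qed
    qed
  qed
  moreover have "esub e t [] \<noteq> None" using root assms unfolding is_tree_def by blast
  ultimately show ?thesis unfolding herbrand_univ_def is_tree_def closed_tree_def by blast
qed

text \<open>Related environments: \<open>e\<close> evaluates a term as \<open>e'\<close> evaluates its instance by \<open>\<sigma>\<close>. Terms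
  without a complete tree may be substituted for variables that do not occur in the tree; their
  value is immaterial.\<close>

definition compat :: "'c sig \<Rightarrow> nat \<Rightarrow> (nat \<Rightarrow> 'c tm) \<Rightarrow> 'c env \<Rightarrow> 'c env \<Rightarrow> bool" where
  "compat \<Sigma>' n \<sigma> e e' \<longleftrightarrow> (\<forall>k<n. \<exists>t. e (LVar k) = Some t \<and>
     ((\<exists>j. \<sigma> k = Var j \<and> e' (LVar j) = Some t) \<or>
      fv (\<sigma> k) = {} \<and> (\<forall>m. ct \<Sigma>' m (\<sigma> k) \<longrightarrow> t = esub e' (BT (\<sigma> k)))))"

definition agree :: "'c sig \<Rightarrow> 'c env \<Rightarrow> 'c env \<Rightarrow> bool" where
  "agree \<Sigma> e e' \<longleftrightarrow> (\<forall>c\<in>dom \<Sigma>. e (LCon c) = e' (LCon c))"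

text \<open>Induction on the path, as the trees may be infinite. Conversion is stable under
  substitution, so head normal forms of \<open>A\<close> carry over to its instance. At a variable,
  completeness of the instance passes to the substituted term and unlocks the conditional clause of
  \<open>compat\<close>.\<close>

lemma esub_subst:
  assumes "compat \<Sigma>' n \<sigma> e e'" "agree \<Sigma> e e'"
  shows "ct \<Sigma> n A \<Longrightarrow> ct \<Sigma>' n' (subst \<sigma> A) \<Longrightarrow> esub e (BT A) w = esub e' (BT (subst \<sigma> A)) w"
proof (induction w arbitrary: A rule: measure_induct_rule[of length])
  case (less w A)
  from less.prems(1) show ?case
  proof (cases rule: ct_BT_cases)
    case (Var k)
    have "fixbeta_eq (subst \<sigma> A) (\<sigma> k)" using conv_subst[OF Var(3), of \<sigma>] by simp
    then have s: "BT (subst \<sigma> A) = BT (\<sigma> k)" "ct \<Sigma>' n' (\<sigma> k)"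
      using BT_conv ct_conv[OF conv_sym less.prems(2)] by auto
    show ?thesis using assms(1) Var(2) s esub_Var[of e k] esub_Var[of e'] unfolding compat_def Var(1) s(1) by metis
  next
    case (Con c Ms \<tau>)
    have conv: "fixbeta_eq (subst \<sigma> A) (apps (Con c) (map (subst \<sigma>) Ms))"
      using conv_subst[OF Con(2), of \<sigma>] by simp
    have c: "e (LCon c) = e' (LCon c)" using Con(3) assms(2) unfolding agree_def by auto
    show ?thesis
    proof (cases "e (LCon c)")
      case (Some s)
      then have "esub e (BT A) = s" "esub e' (BT (subst \<sigma> A)) = s"
        using c Con(1) BT_conv[OF conv] by (auto intro!: esub_Some)
      then show ?thesis by simp
    next
      case None
      note apps = esub_apps[of e, OF None] esub_apps[of e' c, OF None[unfolded c]]
      show ?thesis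
      proof (cases w)
        case Nil
        then show ?thesis unfolding Con(1) BT_conv[OF conv] by (simp only: apps)
      next
        case (Cons i v)
        have "ct \<Sigma>' n' (apps (Con c) (map (subst \<sigma>) Ms))"
          using ct_conv[OF conv_sym[OF conv] less.prems(2)] .
        from ct_apps[OF this] have "ct \<Sigma>' n' (subst \<sigma> (Ms ! i))" if "i < length Ms" using that by simp
        then have "esub e (BT (Ms ! i)) v = esub e' (BT (subst \<sigma> (Ms ! i))) v" if "i < length Ms"
          using less.IH[of v "Ms ! i"] Con(5) Cons that by simp
        then show ?thesis
          unfolding Con(1) BT_conv[OF conv] Cons by (simp only: apps length_map) simp
      qed
    qed
  qed
qed

definition push :: "'c tree \<Rightarrow> 'c env \<Rightarrow> 'c env" where
  "push t e l = (case l of LCon c \<Rightarrow> e (LCon c) | LVar k \<Rightarrow> case_nat (Some t) (\<lambda>k. e (LVar k)) k)"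

lemma push_simps [simp]:
  "push t e (LCon c) = e (LCon c)" "push t e (LVar 0) = Some t" "push t e (LVar (Suc k)) = e (LVar k)"
  by (simp_all add: push_def)

text \<open>Closed terms are unaffected by lifting, and their trees carry no variable labels, so the
  extended environment gives them the same value.\<close>

lemma compat_push:
  assumes "compat \<Sigma>' n \<sigma> e e'"
  shows "compat \<Sigma>' (Suc n) (ups \<sigma>) (push t e) (push t e')"
  unfolding compat_def
proof (intro allI impI)
  fix k assume k: "k < Suc n"
  show "\<exists>s. push t e (LVar k) = Some s \<and>
     ((\<exists>j. ups \<sigma> k = Var j \<and> push t e' (LVar j) = Some s) \<or>
      fv (ups \<sigma> k) = {} \<and> (\<forall>m. ct \<Sigma>' m (ups \<sigma> k) \<longrightarrow> s = esub (push t e') (BT (ups \<sigma> k))))"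
  proof (cases k)
    case 0
    then show ?thesis by simp
  next
    case (Suc k')
    then obtain s where s: "e (LVar k') = Some s"
     "(\<exists>j. \<sigma> k' = Var j \<and> e' (LVar j) = Some s) \<or>
      fv (\<sigma> k') = {} \<and> (\<forall>m. ct \<Sigma>' m (\<sigma> k') \<longrightarrow> s = esub e' (BT (\<sigma> k')))"
      using assms k unfolding compat_def by auto
    from s(2) show ?thesis
    proof (elim disjE conjE exE)
      fix j assume "\<sigma> k' = Var j" "e' (LVar j) = Some s"
      then show ?thesis using s(1) Suc by simp
    next
      assume *: "fv (\<sigma> k') = {}" "\<forall>m. ct \<Sigma>' m (\<sigma> k') \<longrightarrow> s = esub e' (BT (\<sigma> k'))"
      have "s = esub (push t e') (BT (\<sigma> k'))" if "ct \<Sigma>' m (\<sigma> k')" for m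
      proof -
        have "esub (push t e') (BT (\<sigma> k')) = esub e' (BT (\<sigma> k'))"
        proof (rule esub_cong)
          fix w l assume "BT (\<sigma> k') w = Some l"
          then show "push t e' l = e' l" using ct_closed[OF that *(1), of w] by (cases l) auto
        qed
        then show ?thesis using *(2) that by metis
      qed
      then show ?thesis using * s(1) Suc by (simp add: ren_closed)
    qed
  qed
qed

subsection \<open>Semantics of formulae\<close>

text \<open>The atom at the head of a clause must lie in \<open>Y\<close> whenever the atoms of the bodies lie in \<open>X\<close>; the
  guarded sequents are interpreted with a \<open>Y\<close> that differs from \<open>X\<close>.\<close>

fun sem :: "'c sig \<Rightarrow> 'c tree set \<Rightarrow> 'c tree set \<Rightarrow> 'c env \<Rightarrow> 'c tm \<Rightarrow> bool" where
  "sem \<Sigma> X Y e (App (App (Log k) F) G) =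
     (if k = Imp then sem \<Sigma> X X e F \<longrightarrow> sem \<Sigma> X Y e G else sem \<Sigma> X Y e F \<and> sem \<Sigma> X Y e G)"
| "sem \<Sigma> X Y e (App (Log k) (Lam \<tau> F)) = (\<forall>t\<in>herbrand_univ \<Sigma>. sem \<Sigma> X Y (push t e) F)"
| "sem \<Sigma> X Y e A = (esub e (BT A) \<in> Y)"

lemma sem_atom: "head A = Con c \<Longrightarrow> sem \<Sigma> X Y e A = (esub e (BT A) \<in> Y)"
  by (cases "(\<Sigma>, X, Y, e, A)" rule: sem.cases) auto

lemma atoms_of_atom: "head A = Con c \<Longrightarrow> atoms_of \<Gamma> A = {(\<Gamma>, A)}"
  by (cases "(\<Gamma>, A)" rule: atoms_of.cases) auto

text \<open>A shape that programs and H-formulae have and that passes from the conclusion to the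
  premises of every rule, see \<open>sh_premises\<close>. It excludes the right rules for
  existential quantification, disjunction and truth.\<close>

inductive sh :: "'c tm \<Rightarrow> bool" where
  sh_atom: "head A = Con c \<Longrightarrow> sh A"
| sh_bin: "k = Imp \<or> k = And \<Longrightarrow> sh F \<Longrightarrow> sh G \<Longrightarrow> sh (App (App (Log k) F) G)"
| sh_all: "sh F \<Longrightarrow> sh (tm_all Iota F)"

inductive_cases sh_impE [elim!]: "sh (tm_imp F G)"
inductive_cases sh_andE [elim!]: "sh (tm_and F G)"
inductive_cases sh_orE [elim!]: "sh (tm_or F G)"
inductive_cases sh_allE [elim!]: "sh (tm_all \<tau> F)"
inductive_cases sh_exE [elim!]: "sh (tm_ex \<tau> F)"
inductive_cases sh_topE [elim!]: "sh (Log k)"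

lemma betas_rigid:
  assumes "rigid_head h" "betas (apps h Ms) N"
  obtains Ns where "N = apps h Ns" "list_all2 betas Ms Ns"
  using steps_rigid_apps[OF assms(1), of True False Ms N] assms(2) by (auto simp: step_beta)

lemma betas_LamE:
  assumes "betas (Lam \<tau> M) N"
  obtains M' where "N = Lam \<tau> M'" "betas M M'"
proof -
  have "\<exists>M'. N = Lam \<tau> M' \<and> betas M M'"
    using assms by induction (auto intro: rtranclp.rtrancl_into_rtrancl)
  then show ?thesis using that by blast
qed

lemma betas_binary:
  assumes "betas (App (App (Log k) F) G) N"
  obtains F' G' where "N = App (App (Log k) F') G'" "betas F F'" "betas G G'"
proof -
  have "betas (apps (Log k) [F, G]) N" using assms by simp
  then obtain Ns where "N = apps (Log k) Ns" "list_all2 betas [F, G] Ns"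
    by (rule betas_rigid[OF rigid_head_simps(3)])
  then show ?thesis using that by (auto simp: list_all2_Cons1)
qed

lemma betas_quant:
  assumes "betas (App (Log k) (Lam \<tau> F)) N"
  obtains F' where "N = App (Log k) (Lam \<tau> F')" "betas F F'"
proof -
  have "betas (apps (Log k) [Lam \<tau> F]) N" using assms by simp
  then obtain Ns where "N = apps (Log k) Ns" "list_all2 betas [Lam \<tau> F] Ns"
    by (rule betas_rigid[OF rigid_head_simps(3)])
  then show ?thesis using that by (auto simp: list_all2_Cons1 elim: betas_LamE)
qed

lemma betas_head_Con:
  assumes "betas (subst \<sigma> A) N" "head A = Con c"
  shows "head N = Con c"
proof -
  have "subst \<sigma> A = apps (Con c) (map (subst \<sigma>) (args A))"
    by (metis apps_head_args assms(2) subst.simps(2) subst_apps)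
  then have "betas (apps (Con c) (map (subst \<sigma>) (args A))) N" using assms(1) by simp
  then show ?thesis by (rule betas_rigid[OF rigid_head_simps(2)]) simp
qed

lemma sh_subst_betas: "sh F \<Longrightarrow> betas (subst \<sigma> F) F' \<Longrightarrow> sh F'"
proof (induction arbitrary: \<sigma> F' rule: sh.induct)
  case (sh_atom A c)
  show ?case by (rule sh.sh_atom[OF betas_head_Con[OF sh_atom.prems sh_atom.hyps]])
next
  case (sh_bin k F G)
  then have "betas (App (App (Log k) (subst \<sigma> F)) (subst \<sigma> G)) F'" by simp
  then show ?case by (rule betas_binary) (use sh_bin in \<open>auto intro: sh.sh_bin\<close>)
next
  case (sh_all F)
  then have "betas (tm_all Iota (subst (ups \<sigma>) F)) F'" by simp
  then show ?case by (rule betas_quant) (auto intro: sh.sh_all sh_all.IH)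
qed

lemma sh_inst: "sh F \<Longrightarrow> betas (inst F N) F' \<Longrightarrow> sh F'"
  unfolding inst_def by (rule sh_subst_betas)

definition cts :: "'c sig \<Rightarrow> ty list \<Rightarrow> 'c tm \<Rightarrow> bool" where
  "cts \<Sigma> \<Gamma> F \<longleftrightarrow> (\<forall>(\<Delta>, A) \<in> atoms_of \<Gamma> F. ct \<Sigma> (length \<Delta>) A)"

lemma cts_simps [simp]:
  "cts \<Sigma> \<Gamma> (App (App (Log k) F) G) \<longleftrightarrow> cts \<Sigma> \<Gamma> F \<and> cts \<Sigma> \<Gamma> G"
  "cts \<Sigma> \<Gamma> (App (Log k) (Lam \<tau> F)) \<longleftrightarrow> cts \<Sigma> (\<tau> # \<Gamma>) F"
  by (auto simp: cts_def)

lemma cts_atom: "head A = Con c \<Longrightarrow> cts \<Sigma> \<Gamma> A \<longleftrightarrow> ct \<Sigma> (length \<Gamma>) A"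
  by (simp add: cts_def atoms_of_atom)

text \<open>Substitution and \<beta>-reduction keep the logical skeleton, whose heads are rigid, so
  the claim comes down to \<open>esub_subst\<close> at the atoms.\<close>

lemma sem_subst:
  "sh F \<Longrightarrow> betas (subst \<sigma> F) F' \<Longrightarrow> cts \<Sigma> \<Gamma> F \<Longrightarrow> cts \<Sigma>' \<Gamma>' F' \<Longrightarrow>
    compat \<Sigma>' (length \<Gamma>) \<sigma> e e' \<Longrightarrow> agree \<Sigma> e e' \<Longrightarrow> sem \<Delta> X Y e F = sem \<Delta> X Y e' F'"
proof (induction arbitrary: \<sigma> F' \<Gamma> \<Gamma>' e e' Y rule: sh.induct)
  case (sh_atom A c)
  have h: "head F' = Con c" by (rule betas_head_Con[OF sh_atom.prems(1) sh_atom.hyps])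
  have conv: "fixbeta_eq (subst \<sigma> A) F'" using sh_atom.prems(1) by (rule beta_conv)
  have "ct \<Sigma> (length \<Gamma>) A" "ct \<Sigma>' (length \<Gamma>') (subst \<sigma> A)"
    using sh_atom.prems(2,3) ct_conv[OF conv] by (auto simp: cts_atom[OF h] cts_atom[OF sh_atom.hyps])
  then have "esub e (BT A) = esub e' (BT (subst \<sigma> A))"
    using esub_subst[OF sh_atom.prems(4,5)] by blast
  then show ?case using BT_conv[OF conv] by (simp add: sem_atom[OF h] sem_atom[OF sh_atom.hyps])
next
  case (sh_bin k F G)
  have "betas (App (App (Log k) (subst \<sigma> F)) (subst \<sigma> G)) F'" using sh_bin.prems by simp
  then obtain F1 G1 where F': "F' = App (App (Log k) F1) G1" and b: "betas (subst \<sigma> F) F1" "betas (subst \<sigma> G) G1"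
    by (rule betas_binary)
  have "sem \<Delta> X Y e F = sem \<Delta> X Y e' F1" "sem \<Delta> X Y e G = sem \<Delta> X Y e' G1" for Y
    using sh_bin.IH(1)[OF b(1)] sh_bin.IH(2)[OF b(2)] sh_bin.prems unfolding F' by auto
  then show ?case by (simp add: F')
next
  case (sh_all F)
  have "betas (tm_all Iota (subst (ups \<sigma>) F)) F'" using sh_all.prems by simp
  then obtain F1 where F': "F' = tm_all Iota F1" and b: "betas (subst (ups \<sigma>) F) F1" by (rule betas_quant)
  have "sem \<Delta> X Y (push t e) F = sem \<Delta> X Y (push t e') F1" for t
  proof (rule sh_all.IH[OF b])
    show "cts \<Sigma> (Iota # \<Gamma>) F" "cts \<Sigma>' (Iota # \<Gamma>') F1" using sh_all.prems unfolding F' by auto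
    show "compat \<Sigma>' (length (Iota # \<Gamma>)) (ups \<sigma>) (push t e) (push t e')"
      using compat_push[OF sh_all.prems(4)] by simp
    show "agree \<Sigma> (push t e) (push t e')" using sh_all.prems(5) by (simp add: agree_def)
  qed
  then show ?case by (simp add: F')
qed

subsection \<open>Soundness of the calculus\<close>

text \<open>\<open>\<Sigma>'\<close> extends \<open>\<Sigma>\<close> by eigenconstants of type \<open>\<iota>\<close>, to which \<open>e\<close> assigns trees over \<open>\<Sigma>\<close>.\<close>

definition sig_env :: "'c sig \<Rightarrow> 'c sig \<Rightarrow> 'c env \<Rightarrow> bool" where
  "sig_env \<Sigma> \<Sigma>' e \<longleftrightarrow>
     (\<forall>c\<in>dom \<Sigma>. \<Sigma>' c = \<Sigma> c \<and> e (LCon c) = None) \<and>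
     (\<forall>c\<in>dom \<Sigma>' - dom \<Sigma>. \<Sigma>' c = Some Iota \<and> (\<exists>t\<in>herbrand_univ \<Sigma>. e (LCon c) = Some t))"

text \<open>In focused sequents \<open>Y\<close> is universally quantified, so that one reading
  serves both a plain decision (\<open>Y = X\<close>) and a guarded decision on an original clause
  (\<open>Y = Z\<close>). Guarded goals are read in \<open>Z\<close>, hypotheses always in
  \<open>X\<close>.\<close>

primrec sound :: "'c sig \<Rightarrow> 'c tree set \<Rightarrow> 'c tree set \<Rightarrow> 'c sequent \<Rightarrow> bool" where
  "sound \<Sigma> X Z (Seq \<Sigma>' Q G) \<longleftrightarrow> (\<forall>e. sig_env \<Sigma> \<Sigma>' e \<longrightarrow>
     (\<forall>D\<in>Q. sem \<Sigma> X X e D) \<longrightarrow> sem \<Sigma> X X e G)"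
| "sound \<Sigma> X Z (Foc \<Sigma>' Q D A) \<longleftrightarrow> (\<forall>e Y. sig_env \<Sigma> \<Sigma>' e \<longrightarrow>
     (\<forall>D\<in>Q. sem \<Sigma> X X e D) \<longrightarrow> sem \<Sigma> X Y e D \<longrightarrow> esub e (BT A) \<in> Y)"
| "sound \<Sigma> X Z (GSeq \<Sigma>' Q M) \<longleftrightarrow> (\<forall>e. sig_env \<Sigma> \<Sigma>' e \<longrightarrow>
     (\<forall>D\<in>Q. sem \<Sigma> X X e D) \<longrightarrow> sem \<Sigma> X Z e M)"
| "sound \<Sigma> X Z (GFoc \<Sigma>' Q D A) \<longleftrightarrow> (\<forall>e Y. sig_env \<Sigma> \<Sigma>' e \<longrightarrow>
     (\<forall>D\<in>Q. sem \<Sigma> X X e D) \<longrightarrow> sem \<Sigma> X Y e D \<longrightarrow> esub e (BT A) \<in> Y)"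
| "sound \<Sigma> X Z (CoSeq \<Sigma>' Q M) \<longleftrightarrow> (\<forall>e. sig_env \<Sigma> \<Sigma>' e \<longrightarrow>
     (\<forall>D\<in>insert M Q. sem \<Sigma> X X e D) \<longrightarrow> sem \<Sigma> X Z e M)"

definition good :: "'c sequent \<Rightarrow> bool" where
  "good s \<longleftrightarrow> (\<forall>F\<in>seq_formulas s. sh F \<and> cts (seq_sig s) [] F)"

lemma sig_env_esub:
  assumes "sig_env \<Sigma> \<Sigma>' e" "ct \<Sigma>' m N" "fv N = {}"
  shows "esub e (BT N) \<in> herbrand_univ \<Sigma>"
proof (rule esub_is_tree[OF ct_is_tree[OF assms(2)]])
  fix w l assume l: "BT N w = Some l"
  then obtain c where c: "l = LCon c" "c \<in> dom \<Sigma>'"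
    using ct_BT_label[OF assms(2) l] ct_closed[OF assms(2,3), of w] by (cases l) auto
  show "e l = None \<and> (\<exists>c. l = LCon c \<and> c \<in> dom \<Sigma> \<and> \<Sigma>' c = \<Sigma> c) \<or> (\<exists>s\<in>herbrand_univ \<Sigma>. e l = Some s)"
  proof (cases "c \<in> dom \<Sigma>")
    case True
    then show ?thesis using assms(1) c unfolding sig_env_def by auto
  next
    case False
    then show ?thesis using assms(1) c unfolding sig_env_def by blast
  qed
qed

lemma sem_all_inst:
  assumes "sig_env \<Sigma> \<Sigma>' e" "herbrand_univ \<Sigma> \<noteq> {}" "wt \<Sigma>' [] N \<tau>" "beta_nf (inst D N) D'"
    "sh (tm_all \<tau> D)" "cts \<Sigma>' [] (tm_all \<tau> D)" "cts \<Sigma>' [] D'" "sem \<Sigma> X Y e (tm_all \<tau> D)"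
  shows "sem \<Sigma> X Y e D'"
proof -
  have fv: "fv N = {}" using assms(3) typeof_fv[of \<Sigma>' "[]" N] by (auto simp: wt_def)
  obtain t0 where t0: "t0 \<in> herbrand_univ \<Sigma>" using assms(2) by blast
  \<comment> \<open>A term without a complete tree gets the default \<open>t0\<close>;
    \<open>compat\<close> puts no condition on its value.\<close>
  define t where "t = (if \<exists>m. ct \<Sigma>' m N then esub e (BT N) else t0)"
  have "t \<in> herbrand_univ \<Sigma>" using t0 sig_env_esub[OF assms(1) _ fv] by (auto simp: t_def)
  then have "sem \<Sigma> X Y (push t e) D" using assms(8) by simp
  moreover have "sem \<Sigma> X Y (push t e) D = sem \<Sigma> X Y e D'"
  proof (rule sem_subst)
    show "sh D" using assms(5) by auto
    show "betas (subst (case_nat N Var) D) D'" using assms(4) by (simp add: beta_nf_def inst_def)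
    show "cts \<Sigma>' [\<tau>] D" "cts \<Sigma>' [] D'" using assms(6,7) by simp_all
    show "compat \<Sigma>' (length [\<tau>]) (case_nat N Var) (push t e) e" using fv by (auto simp: compat_def t_def)
    show "agree \<Sigma>' (push t e) e" by (simp add: agree_def)
  qed
  ultimately show ?thesis by simp
qed

text \<open>An eigenconstant mapped to \<open>t\<close> acts like a bound variable with value
  \<open>t\<close>. Being fresh, it does not occur in the trees of the old hypotheses, which keep
  their meaning.\<close>

lemma sem_all_eigen:
  assumes "\<Sigma>' c = None" "t \<in> herbrand_univ \<Sigma>" "sig_env \<Sigma> \<Sigma>' e"
  shows "sig_env \<Sigma> (\<Sigma>'(c \<mapsto> Iota)) (e(LCon c \<mapsto> t))"
    and "sh G \<Longrightarrow> cts \<Sigma>' [Iota] G \<Longrightarrow> cts (\<Sigma>'(c \<mapsto> Iota)) [] (inst G (Con c)) \<Longrightarrow>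
      sem \<Sigma> X Y (push t e) G = sem \<Sigma> X Y (e(LCon c \<mapsto> t)) (inst G (Con c))"
    and "sh D \<Longrightarrow> cts \<Sigma>' [] D \<Longrightarrow> cts (\<Sigma>'(c \<mapsto> Iota)) [] D \<Longrightarrow>
      sem \<Sigma> X Y e D = sem \<Sigma> X Y (e(LCon c \<mapsto> t)) D"
proof -
  have c: "c \<notin> dom \<Sigma>"
  proof
    assume "c \<in> dom \<Sigma>"
    moreover from this have "\<Sigma>' c = \<Sigma> c" using assms(3) unfolding sig_env_def by blast
    ultimately show False using assms(1) by auto
  qed
  have ag: "agree \<Sigma>' (push t e) (e(LCon c \<mapsto> t))" "agree \<Sigma>' e (e(LCon c \<mapsto> t))"
    using assms(1) by (auto simp: agree_def)
  show "sig_env \<Sigma> (\<Sigma>'(c \<mapsto> Iota)) (e(LCon c \<mapsto> t))"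
    unfolding sig_env_def
  proof (intro conjI ballI)
    fix d assume "d \<in> dom \<Sigma>"
    then have "d \<noteq> c" "\<Sigma>' d = \<Sigma> d" "e (LCon d) = None" using c assms(3) unfolding sig_env_def by blast+
    then show "(\<Sigma>'(c \<mapsto> Iota)) d = \<Sigma> d" "(e(LCon c \<mapsto> t)) (LCon d) = None" by simp_all
  next
    fix d assume d: "d \<in> dom (\<Sigma>'(c \<mapsto> Iota)) - dom \<Sigma>"
    show "(\<Sigma>'(c \<mapsto> Iota)) d = Some Iota" "\<exists>s\<in>herbrand_univ \<Sigma>. (e(LCon c \<mapsto> t)) (LCon d) = Some s"
      using d assms(2,3) unfolding sig_env_def by (cases "d = c"; simp)+
  qed
  have "esub (e(LCon c \<mapsto> t)) (BT (Con c)) = t" by (rule esub_Some) (auto simp: BT_Con_leaf)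
  then have comp: "compat (\<Sigma>'(c \<mapsto> Iota)) (length [Iota]) (case_nat (Con c) Var) (push t e) (e(LCon c \<mapsto> t))"
    by (auto simp: compat_def)
  show "sem \<Sigma> X Y (push t e) G = sem \<Sigma> X Y (e(LCon c \<mapsto> t)) (inst G (Con c))"
    if "sh G" "cts \<Sigma>' [Iota] G" "cts (\<Sigma>'(c \<mapsto> Iota)) [] (inst G (Con c))"
    by (rule sem_subst[OF that(1) _ that(2,3) comp ag(1)]) (simp add: inst_def)
  show "sem \<Sigma> X Y e D = sem \<Sigma> X Y (e(LCon c \<mapsto> t)) D"
    if "sh D" "cts \<Sigma>' [] D" "cts (\<Sigma>'(c \<mapsto> Iota)) [] D"
    by (rule sem_subst[OF that(1) _ that(2,3) _ ag(2), of Var]) (simp_all add: compat_def)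
qed

text \<open>The set \<open>Y\<close> is arbitrary so as to serve the plain rule and its guarded
  variant.\<close>

lemma sem_allR:
  assumes \<Sigma>': "\<Sigma>' c = None" "sig_env \<Sigma> \<Sigma>' e" "\<forall>D\<in>Q. sem \<Sigma> X X e D"
    and good: "\<forall>F\<in>insert (tm_all \<tau> G) Q. sh F \<and> cts \<Sigma>' [] F"
      "\<forall>F\<in>insert (inst G (Con c)) Q. sh F \<and> cts (\<Sigma>'(c \<mapsto> \<tau>)) [] F"
    and prem: "\<And>e. sig_env \<Sigma> (\<Sigma>'(c \<mapsto> \<tau>)) e \<Longrightarrow> \<forall>D\<in>Q. sem \<Sigma> X X e D \<Longrightarrow>
      sem \<Sigma> X Y e (inst G (Con c))"
  shows "sem \<Sigma> X Y e (tm_all \<tau> G)"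
proof -
  have \<tau>: "\<tau> = Iota" "sh G" "cts \<Sigma>' [Iota] G" using good(1) by auto
  have "sem \<Sigma> X Y (push t e) G" if t: "t \<in> herbrand_univ \<Sigma>" for t
  proof -
    note eig = sem_all_eigen[OF \<Sigma>'(1) t \<Sigma>'(2)]
    have "\<forall>D\<in>Q. sem \<Sigma> X X (e(LCon c \<mapsto> t)) D" using \<Sigma>'(3) eig(3) good \<tau> by simp
    then have "sem \<Sigma> X Y (e(LCon c \<mapsto> t)) (inst G (Con c))" using prem eig(1) \<tau>(1) by simp
    then show ?thesis using eig(2)[OF \<tau>(2,3)] good(2) \<tau>(1) by simp
  qed
  then show ?thesis by simp
qed

lemma sh_premises:
  assumes "inference P\<^sub>0 ss s" "\<forall>F\<in>seq_formulas s. sh F" "\<forall>F\<in>P\<^sub>0. sh F" "s' \<in> set ss"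
  shows "\<forall>F\<in>seq_formulas s'. sh F"
  using assms
proof (cases rule: inference.cases)
  case (allR \<Sigma> c \<tau> P G)
  then show ?thesis using assms(2-4) sh_inst[of G "Con c" "inst G (Con c)"] by auto
next
  case (allR_g \<Sigma> c \<tau> P G)
  then show ?thesis using assms(2-4) sh_inst[of G "Con c" "inst G (Con c)"] by auto
next
  case (allL \<Sigma> N \<tau> D D' P A)
  then show ?thesis using assms(2-4) by (auto simp: beta_nf_def intro: sh_inst)
next
  case (allL_g \<Sigma> N \<tau> D D' P A)
  then show ?thesis using assms(2-4) by (auto simp: beta_nf_def intro: sh_inst)
qed auto

lemma closed_atom_head: "atom \<Sigma> [] A \<Longrightarrow> \<exists>c. head A = Con c"
  unfolding atom_def predicate_def by auto

text \<open>The assumption \<open>P0\<close> is called upon by the guarded decision: only original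
  clauses are known to send bodies in \<open>X\<close> to a head in \<open>Z\<close>. A coinductive
  hypothesis is known to hold merely with heads in \<open>X\<close>.\<close>

lemma inference_sound:
  assumes inf: "inference P\<^sub>0 ss s" and good: "good s" "\<And>s'. s' \<in> set ss \<Longrightarrow> good s'"
    and snd: "\<And>s'. s' \<in> set ss \<Longrightarrow> sound \<Sigma> X Z s'"
    and U: "herbrand_univ \<Sigma> \<noteq> {}"
    and P0: "\<And>D \<Sigma>' e. D \<in> P\<^sub>0 \<Longrightarrow> sig_env \<Sigma> \<Sigma>' e \<Longrightarrow> sem \<Sigma> X Z e D"
  shows "sound \<Sigma> X Z s"
  using inf
proof (cases rule: inference.cases)
  case (allR \<Sigma>' c \<tau> P G)
  show ?thesis
    unfolding allR(2) sound.simps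
  proof (intro allI impI)
    fix e assume e: "sig_env \<Sigma> \<Sigma>' e" "\<forall>D\<in>P. sem \<Sigma> X X e D"
    show "sem \<Sigma> X X e (tm_all \<tau> G)"
      by (rule sem_allR[OF allR(3) e])
        (use good(1) good(2)[of "Seq (\<Sigma>'(c \<mapsto> \<tau>)) P (inst G (Con c))"]
          snd[of "Seq (\<Sigma>'(c \<mapsto> \<tau>)) P (inst G (Con c))"] allR in \<open>auto simp: good_def\<close>)
  qed
next
  case (allR_g \<Sigma>' c \<tau> P G)
  show ?thesis
    unfolding allR_g(2) sound.simps
  proof (intro allI impI)
    fix e assume e: "sig_env \<Sigma> \<Sigma>' e" "\<forall>D\<in>P. sem \<Sigma> X X e D"
    show "sem \<Sigma> X Z e (tm_all \<tau> G)"
      by (rule sem_allR[OF allR_g(3) e])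
        (use good(1) good(2)[of "GSeq (\<Sigma>'(c \<mapsto> \<tau>)) P (inst G (Con c))"]
          snd[of "GSeq (\<Sigma>'(c \<mapsto> \<tau>)) P (inst G (Con c))"] allR_g in \<open>auto simp: good_def\<close>)
  qed
next
  case (allL \<Sigma>' N \<tau> D D' P A)
  have "cts \<Sigma>' [] D'" using good(2)[of "Foc \<Sigma>' P D' A"] allL by (auto simp: good_def)
  moreover have "sh (tm_all \<tau> D)" "cts \<Sigma>' [] (tm_all \<tau> D)" using good(1) allL by (auto simp: good_def)
  ultimately show ?thesis
    using snd[of "Foc \<Sigma>' P D' A"] sem_all_inst[OF _ U allL(3,5)] unfolding allL(1,2) by (simp del: sem.simps)
next
  case (allL_g \<Sigma>' N \<tau> D D' P A)
  have "cts \<Sigma>' [] D'" using good(2)[of "GFoc \<Sigma>' P D' A"] allL_g by (auto simp: good_def)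
  moreover have "sh (tm_all \<tau> D)" "cts \<Sigma>' [] (tm_all \<tau> D)" using good(1) allL_g by (auto simp: good_def)
  ultimately show ?thesis
    using snd[of "GFoc \<Sigma>' P D' A"] sem_all_inst[OF _ U allL_g(3,5)] unfolding allL_g(1,2) by (simp del: sem.simps)
next
  case (decide D P \<Sigma>' A)
  obtain c where "head A = Con c" using closed_atom_head decide by blast
  then show ?thesis using decide snd[of "Foc \<Sigma>' P D A"] by (simp add: sem_atom)
next
  case (decide_g D \<Sigma>' A P)
  obtain c where "head A = Con c" using closed_atom_head decide_g by blast
  then show ?thesis using decide_g P0 snd[of "GFoc \<Sigma>' P D A"] by (auto simp: sem_atom)
next
  case (initial \<Sigma>' A' A P)
  obtain c where "head A' = Con c" using initial(3) unfolding rigid_atom_def by auto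
  then show ?thesis using initial BT_conv[OF initial(5)] by (simp add: sem_atom)
next
  case (initial_g \<Sigma>' A' A P)
  obtain c where "head A' = Con c" using initial_g(3) unfolding rigid_atom_def by auto
  then show ?thesis using initial_g BT_conv[OF initial_g(5)] by (simp add: sem_atom)
next
  case (impR \<Sigma>' D P G)
  then show ?thesis using snd[of "Seq \<Sigma>' (insert D P) G"] by simp
next
  case (andR \<Sigma>' P G1 G2)
  then show ?thesis using snd[of "Seq \<Sigma>' P G1"] snd[of "Seq \<Sigma>' P G2"] by simp
next
  case (impL \<Sigma>' P D A G)
  then show ?thesis using snd[of "Foc \<Sigma>' P D A"] snd[of "Seq \<Sigma>' P G"] by simp
next
  case (andL1 \<Sigma>' P D1 A D2)
  then show ?thesis using snd[of "Foc \<Sigma>' P D1 A"] by simp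
next
  case (andL2 \<Sigma>' P D2 A D1)
  then show ?thesis using snd[of "Foc \<Sigma>' P D2 A"] by simp
next
  case (cofix \<Sigma>' M)
  then show ?thesis using snd[of "GSeq \<Sigma>' (insert M P\<^sub>0) M"] by simp
next
  case (impR_g \<Sigma>' D P G)
  then show ?thesis using snd[of "GSeq \<Sigma>' (insert D P) G"] by simp
next
  case (andR_g \<Sigma>' P G1 G2)
  then show ?thesis using snd[of "GSeq \<Sigma>' P G1"] snd[of "GSeq \<Sigma>' P G2"] by simp
next
  case (impL_g \<Sigma>' P D A G)
  then show ?thesis using snd[of "Foc \<Sigma>' P D A"] snd[of "Seq \<Sigma>' P G"] by simp
next
  case (andL1_g \<Sigma>' P D1 A D2)
  then show ?thesis using snd[of "GFoc \<Sigma>' P D1 A"] by simp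
next
  case (andL2_g \<Sigma>' P D2 A D1)
  then show ?thesis using snd[of "GFoc \<Sigma>' P D2 A"] by simp
next
  case exR
  then show ?thesis using good(1) by (auto simp: good_def)
next
  case orR1
  then show ?thesis using good(1) by (auto simp: good_def)
next
  case orR2
  then show ?thesis using good(1) by (auto simp: good_def)
next
  case topR
  then show ?thesis using good(1) by (auto simp: good_def)
qed

lemma all_atoms_guarded_good:
  assumes "all_atoms_guarded \<pi>" "s \<in> sequents \<pi>" "\<forall>F\<in>seq_formulas s. sh F"
  shows "good s"
  unfolding good_def cts_def
  using assms guarded_atom_ct unfolding all_atoms_guarded_def by fast

lemma valid_sound:
  assumes "valid P\<^sub>0 \<pi>" "\<forall>F\<in>seq_formulas (concl \<pi>). sh F" "all_atoms_guarded \<pi>" "\<forall>F\<in>P\<^sub>0. sh F"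
    and "herbrand_univ \<Sigma> \<noteq> {}"
    and "\<And>D \<Sigma>' e. D \<in> P\<^sub>0 \<Longrightarrow> sig_env \<Sigma> \<Sigma>' e \<Longrightarrow> sem \<Sigma> X Z e D"
  shows "sound \<Sigma> X Z (concl \<pi>)"
  using assms(1-3)
proof (induction rule: valid.induct)
  case (1 s \<pi>s)
  have sh: "\<forall>F\<in>seq_formulas (concl \<pi>). sh F" if "\<pi> \<in> set \<pi>s" for \<pi>
    using sh_premises[OF 1(2) _ assms(4), of "concl \<pi>"] "1.prems"(1) that by simp
  have ag: "all_atoms_guarded \<pi>" if "\<pi> \<in> set \<pi>s" for \<pi>
    using "1.prems"(2) that unfolding all_atoms_guarded_def by auto
  have "good (concl \<pi>)" if "\<pi> \<in> set \<pi>s" for \<pi>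
    using all_atoms_guarded_good[OF ag[OF that] _ sh[OF that]] by (cases \<pi>) auto
  moreover have "good s" using all_atoms_guarded_good[OF "1.prems"(2)] "1.prems"(1) by auto
  moreover have "sound \<Sigma> X Z (concl \<pi>)" if "\<pi> \<in> set \<pi>s" for \<pi>
    using "1.IH"[OF that sh[OF that] ag[OF that]] .
  ultimately have "sound \<Sigma> X Z s"
    by (intro inference_sound[OF 1(2) _ _ _ assms(5)]) (auto intro: assms(6))
  then show ?case by simp
qed

subsection \<open>H-formulae\<close>

definition envs :: "(nat \<Rightarrow> 'c tree) \<Rightarrow> nat \<Rightarrow> 'c env \<Rightarrow> 'c env" where
  "envs \<sigma> n e l = (case l of LCon c \<Rightarrow> e (LCon c) | LVar k \<Rightarrow> if k < n then Some (\<sigma> k) else e (LVar (k - n)))"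

lemma sem_alls:
  "sem \<Sigma> X Y e ((tm_all Iota ^^ n) F) \<longleftrightarrow> (\<forall>\<sigma>. (\<forall>j<n. \<sigma> j \<in> herbrand_univ \<Sigma>) \<longrightarrow> sem \<Sigma> X Y (envs \<sigma> n e) F)"
proof (induction n arbitrary: e)
  case 0
  have "envs \<sigma> 0 e = e" for \<sigma> by (auto simp: envs_def split: label.split)
  then show ?case by simp
next
  case (Suc n)
  \<comment> \<open>The outermost quantifier is entered first, so its variable ends up with the
    highest index \<open>n\<close>.\<close>
  have env: "envs \<sigma> n (push t e) = envs (\<sigma>(n := t)) (Suc n) e" for \<sigma> t
  proof
    fix l
    show "envs \<sigma> n (push t e) l = envs (\<sigma>(n := t)) (Suc n) e l"
    proof (cases l)
      case (LVar k)
      show ?thesis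
      proof (cases k n rule: linorder_cases)
        case greater
        then obtain j where "k = Suc (n + j)" using less_imp_Suc_add by blast
        then show ?thesis using LVar by (simp add: envs_def)
      qed (use LVar in \<open>auto simp: envs_def\<close>)
    qed (simp add: envs_def)
  qed
  have "sem \<Sigma> X Y e ((tm_all Iota ^^ Suc n) F) \<longleftrightarrow>
    (\<forall>t\<in>herbrand_univ \<Sigma>. \<forall>\<sigma>. (\<forall>j<n. \<sigma> j \<in> herbrand_univ \<Sigma>) \<longrightarrow> sem \<Sigma> X Y (envs (\<sigma>(n := t)) (Suc n) e) F)"
    by (simp add: Suc env)
  also have "\<dots> \<longleftrightarrow> (\<forall>\<sigma>. (\<forall>j<Suc n. \<sigma> j \<in> herbrand_univ \<Sigma>) \<longrightarrow> sem \<Sigma> X Y (envs \<sigma> (Suc n) e) F)"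
  proof (intro iffI allI impI ballI)
    fix \<sigma> assume *: "\<forall>t\<in>herbrand_univ \<Sigma>. \<forall>\<sigma>. (\<forall>j<n. \<sigma> j \<in> herbrand_univ \<Sigma>) \<longrightarrow> sem \<Sigma> X Y (envs (\<sigma>(n := t)) (Suc n) e) F"
      "\<forall>j<Suc n. \<sigma> j \<in> herbrand_univ \<Sigma>"
    then show "sem \<Sigma> X Y (envs \<sigma> (Suc n) e) F" using *(1)[rule_format, of "\<sigma> n" \<sigma>] by simp
  next
    fix t \<sigma> assume *: "\<forall>\<sigma>. (\<forall>j<Suc n. \<sigma> j \<in> herbrand_univ \<Sigma>) \<longrightarrow> sem \<Sigma> X Y (envs \<sigma> (Suc n) e) F" "t \<in> herbrand_univ \<Sigma>" "\<forall>j<n. \<sigma> j \<in> herbrand_univ \<Sigma>"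
    then show "sem \<Sigma> X Y (envs (\<sigma>(n := t)) (Suc n) e) F" by (auto simp: less_Suc_eq)
  qed
  finally show ?case .
qed

lemma sem_conj:
  "Bs \<noteq> [] \<Longrightarrow> \<forall>A\<in>set Bs. \<exists>c. head A = Con c \<Longrightarrow>
    sem \<Sigma> X Y e (conj Bs) \<longleftrightarrow> (\<forall>A\<in>set Bs. esub e (BT A) \<in> Y)"
  by (induction Bs rule: conj.induct) (auto simp: sem_atom)

lemma sh_conj: "Bs \<noteq> [] \<Longrightarrow> \<forall>A\<in>set Bs. \<exists>c. head A = Con c \<Longrightarrow> sh (conj Bs)"
  by (induction Bs rule: conj.induct) (auto intro: sh.intros)

lemma atoms_of_conj:
  "Bs \<noteq> [] \<Longrightarrow> \<forall>A\<in>set Bs. \<exists>c. head A = Con c \<Longrightarrow> atoms_of \<Gamma> (conj Bs) = Pair \<Gamma> ` set Bs"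
  by (induction Bs rule: conj.induct) (auto simp: atoms_of_atom)

lemma atoms_of_alls: "atoms_of \<Gamma> ((tm_all Iota ^^ n) F) = atoms_of (replicate n Iota @ \<Gamma>) F"
  by (induction n arbitrary: \<Gamma>) (simp_all add: replicate_app_Cons_same)

text \<open>All variables in scope have type \<iota>, whose target is not \<open>o\<close>, so none
  of them is a predicate.\<close>

lemma hform_head:
  assumes "is_hform \<Sigma> K" "A \<in> hatoms K"
  shows "\<exists>c. head A = Con c"
proof -
  obtain h Ms where A: "A = apps h Ms" "predicate \<Sigma> (hctxt K) h"
    using assms unfolding is_hform_def atom_def by blast
  have "h \<noteq> Var n" for n
    using A(2) unfolding predicate_def hctxt_def by (auto split: if_splits)
  then show ?thesis using A unfolding predicate_def by auto
qed

lemma sh_formula: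
  assumes "is_hform \<Sigma> K"
  shows "sh (formula K)"
proof -
  have all: "sh F \<Longrightarrow> sh ((tm_all Iota ^^ n) F)" for n and F :: "'a tm"
    by (induction n) (simp_all add: sh_all)
  obtain c where "head (hd_atom K) = Con c" using hform_head[OF assms] unfolding hatoms_def by blast
  then have "sh (hd_atom K)" by (rule sh_atom)
  moreover have "\<forall>A\<in>set (body K). \<exists>c. head A = Con c" using hform_head[OF assms] unfolding hatoms_def by simp
  then have "body K \<noteq> [] \<Longrightarrow> sh (conj (body K))" by (rule sh_conj[rotated])
  ultimately have "sh (if body K = [] then hd_atom K else tm_imp (conj (body K)) (hd_atom K))"
    by (simp add: sh_bin)
  then show ?thesis unfolding formula_def by (rule all)
qed

lemma atoms_of_formula:
  assumes "is_hform \<Sigma> K"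
  shows "atoms_of [] (formula K) = Pair (hctxt K) ` hatoms K"
proof -
  obtain c where "head (hd_atom K) = Con c" using hform_head[OF assms] unfolding hatoms_def by blast
  moreover have "body K \<noteq> [] \<Longrightarrow> atoms_of (hctxt K) (conj (body K)) = Pair (hctxt K) ` set (body K)"
    using hform_head[OF assms] unfolding hatoms_def by (intro atoms_of_conj) auto
  ultimately show ?thesis
    unfolding formula_def atoms_of_alls hatoms_def by (auto simp: atoms_of_atom hctxt_def)
qed

text \<open>By completeness the labels are variables below \<open>nvars K\<close> and constants of
  \<open>\<Sigma>\<close>; the former are bound by the quantifiers and the latter fixed by
  \<open>e\<close>, so evaluation is plain tree substitution.\<close>

lemma sem_formula:
  assumes "is_hform \<Sigma> K" "\<forall>A\<in>hatoms K. ct \<Sigma> (nvars K) A" "\<forall>c\<in>dom \<Sigma>. e (LCon c) = None"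
  shows "sem \<Sigma> X Y e (formula K) \<longleftrightarrow>
    (\<forall>\<sigma>. (\<forall>j<nvars K. \<sigma> j \<in> herbrand_univ \<Sigma>) \<longrightarrow> (\<forall>A\<in>set (body K). tree_subst \<sigma> (BT A) \<in> X) \<longrightarrow>
      tree_subst \<sigma> (BT (hd_atom K)) \<in> Y)"
proof -
  have esub: "esub (envs \<sigma> (nvars K) e) (BT A) = tree_subst \<sigma> (BT A)" if "A \<in> hatoms K" for A \<sigma>
    unfolding tree_subst_esub
  proof (rule esub_cong)
    fix w l assume "BT A w = Some l"
    then show "envs \<sigma> (nvars K) e l = var_env \<sigma> l"
      using ct_BT_label[of \<Sigma> "nvars K" A w l] assms(2,3) that
      by (auto simp: envs_def var_env_def split: label.splits)
  qed
  obtain c where c: "head (hd_atom K) = Con c" using hform_head[OF assms(1)] unfolding hatoms_def by blast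
  have hd: "sem \<Sigma> X Y (envs \<sigma> (nvars K) e) (hd_atom K) \<longleftrightarrow> tree_subst \<sigma> (BT (hd_atom K)) \<in> Y" for \<sigma>
    using esub[of "hd_atom K"] by (simp add: sem_atom[OF c] hatoms_def)
  have body: "sem \<Sigma> X X (envs \<sigma> (nvars K) e) (conj (body K)) \<longleftrightarrow> (\<forall>A\<in>set (body K). tree_subst \<sigma> (BT A) \<in> X)"
    if "body K \<noteq> []" for \<sigma>
  proof -
    have "\<forall>A\<in>set (body K). \<exists>c. head A = Con c" using hform_head[OF assms(1)] unfolding hatoms_def by blast
    then show ?thesis using sem_conj[OF that] esub unfolding hatoms_def by simp
  qed
  show ?thesis
  proof (cases "body K = []")
    case True
    then show ?thesis unfolding formula_def sem_alls using hd by simp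
  next
    case False
    then show ?thesis unfolding formula_def sem_alls using hd body by simp
  qed
qed

subsection \<open>Coinductive models\<close>

lemma T_op_mono: "Q \<subseteq> Q' \<Longrightarrow> I \<subseteq> J \<Longrightarrow> T_op \<Sigma> Q I \<subseteq> T_op \<Sigma> Q' J"
  unfolding T_op_def by blast

lemma mono_T_op: "mono (T_op \<Sigma> Q)"
  by (intro monoI T_op_mono) auto

lemma coind_model_unfold: "coind_model \<Sigma> Q = T_op \<Sigma> Q (coind_model \<Sigma> Q)"
  unfolding coind_model_def by (rule gfp_unfold[OF mono_T_op])

lemma coind_model_upperbound: "I \<subseteq> T_op \<Sigma> Q I \<Longrightarrow> I \<subseteq> coind_model \<Sigma> Q"
  unfolding coind_model_def by (rule gfp_upperbound)

lemma coind_model_base: "coind_model \<Sigma> Q \<subseteq> herbrand_base \<Sigma>"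
  using coind_model_unfold[of \<Sigma> Q] unfolding T_op_def by blast

lemma program_instance_base:
  assumes "fo_atom \<Sigma> (hctxt K) A" "\<forall>j<nvars K. \<sigma> j \<in> herbrand_univ \<Sigma>"
  shows "tree_subst \<sigma> (BT A) \<in> herbrand_base \<Sigma>"
proof -
  have ct: "ct \<Sigma> (nvars K) A" using fo_atom_ct[OF assms(1)] by (simp add: hctxt_def)
  have "tree_subst \<sigma> (BT A) \<in> herbrand_univ \<Sigma>"
    unfolding tree_subst_esub
  proof (rule esub_is_tree[OF ct_is_tree[OF ct]])
    fix w l assume "BT A w = Some l"
    from ct_BT_label[OF ct this] show "var_env \<sigma> l = None \<and> (\<exists>c. l = LCon c \<and> c \<in> dom \<Sigma> \<and> \<Sigma> c = \<Sigma> c) \<or>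
      (\<exists>s\<in>herbrand_univ \<Sigma>. var_env \<sigma> l = Some s)"
      using assms(2) by (cases l) (simp_all add: var_env_def)
  qed
  moreover obtain h where "BT A [] = Some (LCon h)" "predicate \<Sigma> [] (Con h)"
    using fo_atom_satom[OF assms(1)] by (auto dest: satom_predicate[where \<Delta> = "[]"])
  then have "\<exists>c. tree_subst \<sigma> (BT A) [] = Some (LCon c) \<and> predicate \<Sigma> [] (Con c)" by simp
  ultimately show ?thesis unfolding herbrand_univ_def herbrand_base_def by simp
qed

lemma program_atom_tree: "fo_atom \<Sigma> \<Gamma> A \<Longrightarrow> atom_tree \<Sigma> \<Gamma> A = BT A"
  by (simp add: atom_tree_def fo_atom_tree_of)

text \<open>With heads read in \<open>T_op \<Sigma> P X\<close>, the definition of the operator says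
  that every clause of \<open>P\<close> is valid. This is the instance of \<open>Z\<close> on which
  the guarded decision relies.\<close>

lemma sem_program:
  assumes "logic_program \<Sigma> P" "K \<in> P" "\<forall>c\<in>dom \<Sigma>. e (LCon c) = None"
  shows "sem \<Sigma> X (T_op \<Sigma> P X) e (formula K)"
proof -
  have K: "is_hform \<Sigma> K" "\<forall>A\<in>hatoms K. fo_atom \<Sigma> (hctxt K) A"
    using assms(1,2) unfolding logic_program_def by blast+
  have ct: "\<forall>A\<in>hatoms K. ct \<Sigma> (nvars K) A" using K(2) fo_atom_ct unfolding hctxt_def by fastforce
  show ?thesis
    unfolding sem_formula[OF K(1) ct assms(3)]
  proof (intro allI impI)
    fix \<sigma> assume \<sigma>: "\<forall>j<nvars K. \<sigma> j \<in> herbrand_univ \<Sigma>" and b: "\<forall>A\<in>set (body K). tree_subst \<sigma> (BT A) \<in> X"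
    have "tree_instance \<Sigma> K ((\<lambda>A. tree_subst \<sigma> (BT A)) ` set (body K)) (tree_subst \<sigma> (BT (hd_atom K)))"
      unfolding tree_instance_def using \<sigma> K(2) program_atom_tree[of \<Sigma> "hctxt K"]
      by (intro exI[of _ \<sigma>]) (auto simp: hatoms_def intro!: image_cong)
    moreover have "tree_subst \<sigma> (BT (hd_atom K)) \<in> herbrand_base \<Sigma>"
      using program_instance_base[OF _ \<sigma>] K(2) unfolding hatoms_def by blast
    ultimately show "tree_subst \<sigma> (BT (hd_atom K)) \<in> T_op \<Sigma> P X"
      unfolding T_op_def using assms(2) b by blast
  qed
qed

text \<open>The analogue of \<open>T_op\<close> for the single formula \<open>H\<close>, with trees
  given by \<open>BT\<close> and without the restriction to the Herbrand base.\<close>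

definition hstep :: "'c sig \<Rightarrow> 'c hform \<Rightarrow> 'c tree set \<Rightarrow> 'c tree set" where
  "hstep \<Sigma> H X = {tree_subst \<sigma> (BT (hd_atom H)) | \<sigma>.
     (\<forall>j<nvars H. \<sigma> j \<in> herbrand_univ \<Sigma>) \<and> (\<forall>A\<in>set (body H). tree_subst \<sigma> (BT A) \<in> X)}"

lemma hstep_mono: "X \<subseteq> Y \<Longrightarrow> hstep \<Sigma> H X \<subseteq> hstep \<Sigma> H Y"
  unfolding hstep_def by blast

lemma coproof_hatoms_guarded:
  assumes "is_hform \<Sigma> H" "is_coproof \<pi> \<Sigma> P\<^sub>0 (formula H)" "all_atoms_guarded \<pi>" "A \<in> hatoms H"
  shows "guarded_atom \<Sigma> (hctxt H) A"
proof -
  have c: "concl \<pi> = CoSeq \<Sigma> P\<^sub>0 (formula H)" using assms(2) unfolding is_coproof_def by blast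
  then have "concl \<pi> \<in> sequents \<pi>" by (cases \<pi>) auto
  moreover have "(hctxt H, A) \<in> atoms_of [] (formula H)" using assms(4) atoms_of_formula[OF assms(1)] by blast
  ultimately show ?thesis using assms(3) c unfolding all_atoms_guarded_def by fastforce
qed

lemma coind_model_hstep:
  assumes P: "logic_program \<Sigma> P" and H: "is_hform \<Sigma> H"
    and pf: "is_coproof \<pi> \<Sigma> (formula ` P) (formula H)" "all_atoms_guarded \<pi>"
    and U: "herbrand_univ \<Sigma> \<noteq> {}"
  shows "hstep \<Sigma> H (coind_model \<Sigma> P) \<subseteq> coind_model \<Sigma> P"
proof -
  \<comment> \<open>The fixed point equation gives both directions: \<open>X\<close> is closed under
    \<open>P\<close> and \<open>H\<close>, as the hypotheses in the derivation demand, and each of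
    its elements has one of three sources, so being a post-fixed point can be checked source by
    source.\<close>
  define X where "X = lfp (\<lambda>X. coind_model \<Sigma> P \<union> T_op \<Sigma> P X \<union> hstep \<Sigma> H X)"
  have "mono (\<lambda>X. coind_model \<Sigma> P \<union> T_op \<Sigma> P X \<union> hstep \<Sigma> H X)"
    by (intro monoI Un_mono T_op_mono hstep_mono) auto
  then have X: "X = coind_model \<Sigma> P \<union> T_op \<Sigma> P X \<union> hstep \<Sigma> H X" unfolding X_def by (rule lfp_unfold)
  let ?e = "\<lambda>_. None"
  have shP: "\<forall>F\<in>formula ` P. sh F" using P sh_formula unfolding logic_program_def by blast
  have ct: "\<forall>A\<in>hatoms H. ct \<Sigma> (nvars H) A"
    using coproof_hatoms_guarded[OF H pf] guarded_atom_ct unfolding hctxt_def by fastforce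
  note semH = sem_formula[OF H ct, of ?e X, simplified]
  have c: "concl \<pi> = CoSeq \<Sigma> (formula ` P) (formula H)" and v: "valid (formula ` P) \<pi>"
    using pf(1) unfolding is_coproof_def by auto
  \<comment> \<open>Guarded goals are read in \<open>Z = T_op \<Sigma> P X\<close>.\<close>
  have "sound \<Sigma> X (T_op \<Sigma> P X) (concl \<pi>)"
  proof (rule valid_sound[OF v _ pf(2) shP U])
    show "\<forall>F\<in>seq_formulas (concl \<pi>). sh F" using c shP sh_formula[OF H] by simp
    show "sem \<Sigma> X (T_op \<Sigma> P X) e D" if D: "D \<in> formula ` P" "sig_env \<Sigma> \<Sigma>' e" for D \<Sigma>' e
      using D sem_program[OF P] unfolding sig_env_def by blast
  qed
  moreover have "sig_env \<Sigma> \<Sigma> ?e" by (simp add: sig_env_def)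
  moreover have "sem \<Sigma> X X ?e D" if D: "D \<in> formula ` P" for D
  proof -
    have "T_op \<Sigma> P X \<subseteq> X" using X by blast
    obtain K where K: "K \<in> P" "D = formula K" using D by blast
    then have K': "is_hform \<Sigma> K" "\<forall>A\<in>hatoms K. ct \<Sigma> (nvars K) A"
      using P fo_atom_ct unfolding logic_program_def hctxt_def by fastforce+
    have "sem \<Sigma> X (T_op \<Sigma> P X) ?e D" using sem_program[OF P K(1)] K(2) by simp
    then show ?thesis
      using \<open>T_op \<Sigma> P X \<subseteq> X\<close> unfolding K(2) sem_formula[OF K', of ?e, simplified] by blast
  qed
  moreover have "sem \<Sigma> X X ?e (formula H)"
  proof -
    have "hstep \<Sigma> H X \<subseteq> X" using X by blast
    then show ?thesis unfolding semH hstep_def by blast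
  qed
  ultimately have "sem \<Sigma> X (T_op \<Sigma> P X) ?e (formula H)" unfolding c sound.simps by blast
  then have "hstep \<Sigma> H X \<subseteq> T_op \<Sigma> P X" unfolding semH hstep_def by blast
  moreover have "coind_model \<Sigma> P \<subseteq> T_op \<Sigma> P X"
    using coind_model_unfold[of \<Sigma> P] T_op_mono[of P P "coind_model \<Sigma> P" X] X by blast
  ultimately have "X \<subseteq> T_op \<Sigma> P X" using X by blast
  then have "X \<subseteq> coind_model \<Sigma> P" by (rule coind_model_upperbound)
  moreover have "coind_model \<Sigma> P \<subseteq> X" "hstep \<Sigma> H X \<subseteq> X" using X by blast+
  ultimately show ?thesis using hstep_mono by blast
qed

text \<open>The substituted terms are replaced by their trees, with \<open>t0\<close> for those that
  have no complete tree; such a term cannot show up in the tree of an atom whose instance is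
  complete.\<close>

lemma term_instance_tree:
  assumes "\<forall>j<n. fv (\<theta> j) = {}" "t0 \<in> herbrand_univ \<Sigma>"
  obtains \<sigma> where "\<forall>j<n. \<sigma> j \<in> herbrand_univ \<Sigma>"
    "\<And>A A'. ct \<Sigma> n A \<Longrightarrow> ct \<Sigma> 0 A' \<Longrightarrow> beta_nf (subst \<theta> A) A' \<Longrightarrow> tree_subst \<sigma> (BT A) = BT A'"
proof -
  define \<sigma> where "\<sigma> j = (if \<exists>m. ct \<Sigma> m (\<theta> j) then BT (\<theta> j) else t0)" for j
  have "sig_env \<Sigma> \<Sigma> (\<lambda>_. None)" by (simp add: sig_env_def)
  then have "\<forall>j<n. \<sigma> j \<in> herbrand_univ \<Sigma>"
    using assms sig_env_esub[of \<Sigma> \<Sigma> "\<lambda>_. None"] by (auto simp: \<sigma>_def)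
  moreover have "tree_subst \<sigma> (BT A) = BT A'"
    if A: "ct \<Sigma> n A" "ct \<Sigma> 0 A'" "beta_nf (subst \<theta> A) A'" for A A'
  proof -
    have conv: "fixbeta_eq (subst \<theta> A) A'" using A(3) by (rule beta_nf_conv)
    have "compat \<Sigma> n \<theta> (var_env \<sigma>) (\<lambda>_. None)" using assms(1) by (auto simp: compat_def var_env_def \<sigma>_def)
    moreover have "agree \<Sigma> (var_env \<sigma>) (\<lambda>_. None)" by (simp add: agree_def var_env_def)
    ultimately have "esub (var_env \<sigma>) (BT A) w = esub (\<lambda>_. None) (BT (subst \<theta> A)) w" for w
      using esub_subst[OF _ _ A(1) ct_conv[OF conv A(2)]] by blast
    then show ?thesis using BT_conv[OF conv] by (auto simp: tree_subst_esub)
  qed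
  ultimately show ?thesis using that by blast
qed

lemma tree_subst_closed:
  assumes "ct \<Sigma> 0 A"
  shows "tree_subst \<sigma> (BT A) = BT A"
proof -
  have "esub (var_env \<sigma>) (BT A) = esub (\<lambda>_. None) (BT A)"
  proof (rule esub_cong)
    fix w l assume "BT A w = Some l"
    from ct_BT_label[OF assms this] show "var_env \<sigma> l = None" by (cases l) (simp_all add: var_env_def)
  qed
  then show ?thesis by (simp add: tree_subst_esub)
qed

theorem theorem2:
  fixes \<Sigma> :: "'c sig"
    and P :: "'c hform set"
    and H :: "'c hform"
    and \<pi> :: "'c sequent ptree"
    and Hs :: "'c hform list"
  assumes "fo_signature \<Sigma>"
    and "logic_program \<Sigma> P"
    and "is_hform \<Sigma> H"
    and "is_coproof \<pi> \<Sigma> (formula ` P) (formula H)"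
    and "all_atoms_guarded \<pi>"
    and "distinct Hs"
    and "\<forall>K \<in> set Hs. term_instance \<Sigma> H K"
    and "\<forall>K \<in> set Hs. \<forall>A \<in> hatoms K. guarded_atom \<Sigma> [] A"
    and "\<forall>K \<in> set Hs. \<forall>A \<in> set (body K). atom_tree \<Sigma> [] A \<in> coind_model \<Sigma> P"
  shows "coind_model \<Sigma> P = coind_model \<Sigma> (P \<union> set Hs)"
proof (cases "herbrand_base \<Sigma> = {}")
  case True
  then show ?thesis using coind_model_base[of \<Sigma>] by blast
next
  case False
  \<comment> \<open>As encoded, a closed tree-atom is also a member of \<open>herbrand_univ\<close>,
    so any element of the base provides the default tree.\<close>
  then obtain t0 where t0: "t0 \<in> herbrand_univ \<Sigma>" unfolding herbrand_base_def herbrand_univ_def by blast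
  let ?M = "coind_model \<Sigma> P" and ?M' = "coind_model \<Sigma> (P \<union> set Hs)"
  have ctH: "ct \<Sigma> (nvars H) A" if "A \<in> hatoms H" for A
    using guarded_atom_ct[OF coproof_hatoms_guarded[OF assms(3-5) that]] by (simp add: hctxt_def)
  have hstep: "hstep \<Sigma> H ?M \<subseteq> ?M" using coind_model_hstep[OF assms(2-5)] t0 by blast
  \<comment> \<open>Nothing is asked of \<open>Bs\<close>: the body trees of \<open>K\<close> lie in
    the model by hypothesis, and they are the body trees of an instance of \<open>H\<close>, under
    which the model is closed.\<close>
  have inst: "B \<in> ?M" if K: "K \<in> set Hs" and B: "tree_instance \<Sigma> K Bs B" for K Bs B
  proof -
    obtain \<theta> where \<theta>: "\<forall>j<nvars H. wt \<Sigma> [] (\<theta> j) Iota" "nvars K = 0"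
      "list_all2 (\<lambda>A A'. beta_nf (subst \<theta> A) A') (body H) (body K)"
      "beta_nf (subst \<theta> (hd_atom H)) (hd_atom K)"
      using assms(7) K unfolding term_instance_def by blast
    have g: "guarded_atom \<Sigma> [] A" if "A \<in> hatoms K" for A using assms(8) K that by blast
    then have ctK: "ct \<Sigma> 0 A" if "A \<in> hatoms K" for A using guarded_atom_ct[OF g[OF that]] by simp
    have "\<forall>j<nvars H. fv (\<theta> j) = {}" using \<theta>(1) typeof_fv[of \<Sigma> "[]"] by (fastforce simp: wt_def)
    then obtain \<sigma> where \<sigma>: "\<forall>j<nvars H. \<sigma> j \<in> herbrand_univ \<Sigma>"
      "\<And>A A'. ct \<Sigma> (nvars H) A \<Longrightarrow> ct \<Sigma> 0 A' \<Longrightarrow> beta_nf (subst \<theta> A) A' \<Longrightarrow> tree_subst \<sigma> (BT A) = BT A'"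
      using t0 by (rule term_instance_tree) blast
    have "tree_subst \<sigma> (BT A) \<in> ?M" if A: "A \<in> set (body H)" for A
    proof -
      obtain A' where A': "A' \<in> set (body K)" "beta_nf (subst \<theta> A) A'" using list_all2_set1[OF \<theta>(3) A] by blast
      then have "tree_subst \<sigma> (BT A) = BT A'" using \<sigma>(2) ctH ctK A unfolding hatoms_def by blast
      moreover have "BT A' \<in> ?M"
        using assms(9) K A'(1) atom_tree_eq_BT[OF g[of A']] unfolding hatoms_def by fastforce
      ultimately show ?thesis by simp
    qed
    then have "tree_subst \<sigma> (BT (hd_atom H)) \<in> hstep \<Sigma> H ?M" using \<sigma>(1) unfolding hstep_def by blast
    moreover have "tree_subst \<sigma> (BT (hd_atom H)) = BT (hd_atom K)"
      using \<sigma>(2) \<theta>(4) ctH ctK unfolding hatoms_def by blast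
    moreover have "hd_atom K \<in> hatoms K" unfolding hatoms_def by blast
    then have "B = BT (hd_atom K)"
      using B \<theta>(2) atom_tree_eq_BT[OF g] tree_subst_closed[OF ctK] unfolding tree_instance_def hctxt_def by auto
    ultimately show ?thesis using hstep by auto
  qed
  have sub: "?M \<subseteq> ?M'"
    using coind_model_unfold[of \<Sigma> P] T_op_mono[of P "P \<union> set Hs" ?M ?M]
    by (intro coind_model_upperbound) auto
  \<comment> \<open>A member of \<open>?M'\<close> produced by an element of \<open>Hs\<close>
    already lies in \<open>?M\<close>, a fixed point of \<open>T_op \<Sigma> P\<close> below
    \<open>?M'\<close>.\<close>
  have "?M' \<subseteq> T_op \<Sigma> P ?M'"
  proof
    fix B assume "B \<in> ?M'"
    then have "B \<in> T_op \<Sigma> (P \<union> set Hs) ?M'" using coind_model_unfold by blast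
    then consider "B \<in> T_op \<Sigma> P ?M'" | "B \<in> ?M" unfolding T_op_def using inst by blast
    then show "B \<in> T_op \<Sigma> P ?M'"
      using coind_model_unfold[of \<Sigma> P] T_op_mono[OF subset_refl sub, of \<Sigma> P] by cases auto
  qed
  then have "?M' \<subseteq> ?M" by (rule coind_model_upperbound)
  with sub show ?thesis by blast
qed

end
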